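(* Let $E$ be an abstract system of congruences on $n=\{0,\dots,n-1\}$, and consider the action of the rotation group $\mathsf{SO}_3$ on the $2$-sphere $S^2$. Then there is a realization $\{A_0,\dots,A_{n-1}\}$ of $E$ for this action such that every $A_i$ is Baire measurable and nonmeager if and only if $E$ is non-complementing and non-expanding.
   Context: For a finite set $S$, $\mathcal{P}_{\mathrm{pr}}(S)=\{R\subset S: R\neq\emptyset,\ R\neq S\}$. An abstract system of congruences on $n$ is an equivalence relation $E$ on $\mathcal{P}_{\mathrm{pr}}(n)$ such that $U\mathrel{E}V$ implies $\overline{U}\mathrel{E}\overline{V}$, where $\overline{U}=n\setminus U$. For an action of a group $\Gamma$ on a set $X$, sets $A,B\subset X$ are congruent if $\gamma\cdot A=B$ for some $\gamma\in\Gamma$. A realization of $E$ is a partition $\{A_0,\dots,A_{n-1}\}$ of $X$ such that whenever $U\mathrel{E}V$, the sets $\bigcup_{i\in U}A_i$ and $\bigcup_{i\in V}A_i$ are congruent. $E$ is non-complementing if there is no $U\in\mathcal{P}_{\mathrm{pr}}(n)$ with $U\mathrel{E}\overline{U}$. $E$ is non-expanding if there do not exist $k\ge 0$ and sets $V_0,\dots,V_k,W_0,\dots,W_k\in\mathcal{P}_{\mathrm{pr}}(n)$ with $V_i\mathrel{E}W_i$ for all $i\le k$, $W_i\subset V_{i+1}$ for all $i<k$, and $W_k\subsetneq V_0$. *)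

theory Defs
  imports "HOL-Analysis.Analysis"
begin

definition proper_subsets :: "'a set \<Rightarrow> 'a set set" where
  "proper_subsets S = {R. R \<subseteq> S \<and> R \<noteq> {} \<and> R \<noteq> S}"

text \<open>The natural number \<open>n\<close> is identified with the set \<open>{..<n}\<close>.\<close>

definition congruence_system :: "nat \<Rightarrow> (nat set \<times> nat set) set \<Rightarrow> bool" where
  "congruence_system n E \<longleftrightarrow>
     equiv (proper_subsets {..<n}) E \<and>
     (\<forall>U V. (U, V) \<in> E \<longrightarrow> ({..<n} - U, {..<n} - V) \<in> E)"

definition non_complementing :: "nat \<Rightarrow> (nat set \<times> nat set) set \<Rightarrow> bool" where
  "non_complementing n E \<longleftrightarrow>
     \<not> (\<exists>U \<in> proper_subsets {..<n}. (U, {..<n} - U) \<in> E)"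

definition non_expanding :: "nat \<Rightarrow> (nat set \<times> nat set) set \<Rightarrow> bool" where
  "non_expanding n E \<longleftrightarrow>
     \<not> (\<exists>(k::nat) V W.
          (\<forall>i\<le>k. V i \<in> proper_subsets {..<n} \<and> W i \<in> proper_subsets {..<n} \<and> (V i, W i) \<in> E) \<and>
          (\<forall>i<k. W i \<subseteq> V (Suc i)) \<and>
          W k \<subset> V 0)"

text \<open>
  \<open>\<Gamma>\<close> is the underlying set of the acting group and \<open>act\<close> the action map; congruence depends
  on the action only through these.
\<close>

definition congruent_under :: "'g set \<Rightarrow> ('g \<Rightarrow> 'x \<Rightarrow> 'x) \<Rightarrow> 'x set \<Rightarrow> 'x set \<Rightarrow> bool" where
  "congruent_under \<Gamma> act A B \<longleftrightarrow> (\<exists>\<gamma>\<in>\<Gamma>. act \<gamma> ` A = B)"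

text \<open>
  Injectivity makes the \<open>n\<close> indexed pieces distinct, so that (all pieces being nonempty)
  different indices carry disjoint pieces.
\<close>

definition realization ::
    "'g set \<Rightarrow> ('g \<Rightarrow> 'x \<Rightarrow> 'x) \<Rightarrow> 'x set \<Rightarrow> nat \<Rightarrow> (nat set \<times> nat set) set \<Rightarrow> (nat \<Rightarrow> 'x set) \<Rightarrow> bool"
  where
  "realization \<Gamma> act X n E A \<longleftrightarrow>
     inj_on A {..<n} \<and> partition_on X (A ` {..<n}) \<and>
     (\<forall>U V. (U, V) \<in> E \<longrightarrow> congruent_under \<Gamma> act (\<Union>i\<in>U. A i) (\<Union>i\<in>V. A i))"

definition nowhere_dense_in :: "'a topology \<Rightarrow> 'a set \<Rightarrow> bool" where
  "nowhere_dense_in T N \<longleftrightarrow> N \<subseteq> topspace T \<and> T interior_of (T closure_of N) = {}"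

definition meager_in :: "'a topology \<Rightarrow> 'a set \<Rightarrow> bool" where
  "meager_in T M \<longleftrightarrow> (\<exists>N :: nat \<Rightarrow> 'a set. (\<forall>i. nowhere_dense_in T (N i)) \<and> M = (\<Union>i. N i))"

text \<open>Baire measurable sets are the sets with the Baire property.\<close>

definition Baire_measurable_in :: "'a topology \<Rightarrow> 'a set \<Rightarrow> bool" where
  "Baire_measurable_in T B \<longleftrightarrow>
     B \<subseteq> topspace T \<and> (\<exists>U. openin T U \<and> meager_in T ((B - U) \<union> (U - B)))"

definition SO3 :: "(real ^ 3 ^ 3) set" where
  "SO3 = {Q. rotation_matrix Q}"

abbreviation S2 :: "(real ^ 3) set" where
  "S2 \<equiv> sphere 0 1"

end

theory Submission
  imports Defs "HOL-Library.Nat_Bijection"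
begin

text \<open>
  Necessity. Every rotation has a fixed point on the sphere, so no piece can be rotated onto its
  complement. If an expanding chain existed, a rotation would map a union \<open>B\<close> of pieces into
  \<open>B\<close> minus a piece \<open>C\<close>; the iterated images of \<open>C\<close> are then disjoint, but \<open>C\<close> is comeager in some
  open set, which meets one of its images because some power of the rotation is close to the identity.

  Sufficiency. Choose free rotations, one for each generator of the congruences; a realization
  is a coloring \<open>c\<close> of the sphere with \<open>c x \<in> U \<longleftrightarrow> c (g x) \<in> V\<close> for each generator \<open>g\<close> attached to
  \<open>(U, V)\<close>. Since the system is non-expanding, the colors of the two ends of a long reduced word can
  be prescribed independently, so that on free orbits, which are trees, any valid coloring of
  well separated connected sets extends. This independence survives prescribing the colors on a small
  open set whose points are far apart in their orbits. Hence one can color smaller and smaller open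
  sets, one in each member of a countable basis: by compactness the points that can
  receive a given color form a relatively closed set, and by the Baire category theorem some color is
  available on a whole open set. The remaining orbits form a meager set and are colored by the axiom
  of choice; there an orbit contains at most one cycle, and a coloring of the cycle exists since the
  system is non-complementing.
\<close>

section \<open>Words in signed letters and actions\<close>

text \<open>A realization amounts to coloring a graph: the rotations give the edges, and an edge
  labelled \<open>s\<close> admits only the pairs of colors in \<open>rel s\<close>. On free orbits
  such colorings abound, but picking one per orbit gives no control over the Baire property. So no
  coloring is fixed before the end: a stage prescribes colors only on open sets \<open>W j\<close>
  and keeps the whole family \<open>cols W\<close> of compatible colorings. The invariant is
  quantitative: partial colorings glue if their clusters are at distance more than \<open>r\<close>
  in the orbit graph. Prescribing colors at points more than \<open>2 * r\<close> apart preserves it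
  with \<open>3 * r\<close> in place of \<open>r\<close>. The radius only has to stay finite,
  because a generic point has neighbourhoods whose points are as far apart in their orbits as
  desired. The first radius is twice \<open>2 * card P + 2\<close>, a word length at which every
  pair of end colors is possible; \<open>card P\<close> bounds the rank \<open>depth\<close> that
  grows along reduced words. The union of the stages needs no further limit: validity is a condition
  on single edges, and two prescribed points are always prescribed together at some stage.\<close>

definition linv :: "'k \<times> bool \<Rightarrow> 'k \<times> bool" where
  "linv s = (fst s, \<not> snd s)"

definition winv :: "('k \<times> bool) list \<Rightarrow> ('k \<times> bool) list" where
  "winv w = rev (map linv w)"

definition reduced :: "('k \<times> bool) list \<Rightarrow> bool" where
  "reduced = successively (\<lambda>s t. s \<noteq> linv t)"

lemma linv_linv [simp]: "linv (linv s) = s"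
  by (simp add: linv_def)

lemma fst_linv [simp]: "fst (linv s) = fst s"
  by (simp add: linv_def)

lemma linv_neq [simp]: "linv s \<noteq> s" "s \<noteq> linv s"
  by (simp_all add: linv_def prod_eq_iff)

lemma linv_eq_iff [simp]: "linv s = linv t \<longleftrightarrow> s = t"
  by (metis linv_linv)

lemma eq_linv_sym: "s = linv t \<longleftrightarrow> t = linv s"
  by (metis linv_linv)

lemma winv_simps [simp]:
  "winv [] = []" "winv (s # w) = winv w @ [linv s]" "winv (v @ w) = winv w @ winv v"
  "winv w = [] \<longleftrightarrow> w = []" "length (winv w) = length w" "winv (winv w) = w"
  by (auto simp: winv_def rev_map comp_def)

lemma set_winv: "set (winv w) = linv ` set w"
  by (auto simp: winv_def)

lemma hd_winv: "w \<noteq> [] \<Longrightarrow> hd (winv w) = linv (last w)"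
  by (simp add: winv_def hd_rev last_map)

lemma last_winv: "w \<noteq> [] \<Longrightarrow> last (winv w) = linv (hd w)"
  by (simp add: winv_def last_rev hd_map)

lemma reduced_simps [simp]:
  "reduced []" "reduced [s]" "reduced (s # t # w) \<longleftrightarrow> s \<noteq> linv t \<and> reduced (t # w)"
  by (simp_all add: reduced_def)

lemma reduced_Cons: "reduced (s # w) \<longleftrightarrow> w = [] \<or> s \<noteq> linv (hd w) \<and> reduced w"
  by (cases w) auto

lemma reduced_append:
  "reduced (v @ w) \<longleftrightarrow> reduced v \<and> reduced w \<and> (v = [] \<or> w = [] \<or> last v \<noteq> linv (hd w))"
  by (auto simp: reduced_def successively_append_iff)

lemma reduced_winv [simp]: "reduced (winv w) \<longleftrightarrow> reduced w"
proof (induction w)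
  case (Cons s w)
  then show ?case
    by (cases w) (auto simp: reduced_append reduced_Cons eq_linv_sym)
qed simp

locale letter_action =
  fixes act :: "'k \<times> bool \<Rightarrow> 'x \<Rightarrow> 'x" and L :: "('k \<times> bool) set"
  assumes act_linv [simp]: "act (linv s) (act s x) = x"
    and linv_L [simp]: "linv s \<in> L \<longleftrightarrow> s \<in> L"
begin

text \<open>Words compose like functions: the last letter acts first, and a walk is prolonged at the
  head of its word.\<close>

definition wact :: "('k \<times> bool) list \<Rightarrow> 'x \<Rightarrow> 'x" where
  "wact w = foldr act w"

definition rword :: "('k \<times> bool) list \<Rightarrow> bool" where
  "rword w \<longleftrightarrow> reduced w \<and> set w \<subseteq> L"

lemma act_linv' [simp]: "act s (act (linv s) x) = x"
  using act_linv[of "linv s"] by simp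

lemma act_eq_iff: "act s x = y \<longleftrightarrow> x = act (linv s) y"
  by auto

lemma act_inj [simp]: "act s x = act s y \<longleftrightarrow> x = y"
  by (metis act_linv)

lemma wact_simps [simp]:
  "wact [] x = x" "wact (s # w) x = act s (wact w x)" "wact (v @ w) x = wact v (wact w x)"
  by (simp_all add: wact_def)

lemma wact_winv [simp]: "wact (winv w) (wact w x) = x"
  by (induction w arbitrary: x) auto

lemma wact_winv' [simp]: "wact w (wact (winv w) x) = x"
  using wact_winv[of "winv w"] by simp

lemma set_winv_L [simp]: "set (winv w) \<subseteq> L \<longleftrightarrow> set w \<subseteq> L"
  by (auto simp: set_winv image_subset_iff)

lemma rword_Nil [simp]: "rword []"
  by (simp add: rword_def)

lemma rword_single [simp]: "rword [s] \<longleftrightarrow> s \<in> L"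
  by (simp add: rword_def)

lemma rword_Cons: "rword (s # w) \<longleftrightarrow> s \<in> L \<and> rword w \<and> (w = [] \<or> s \<noteq> linv (hd w))"
  by (auto simp: rword_def reduced_Cons)

lemma rword_append:
  "rword (v @ w) \<longleftrightarrow> rword v \<and> rword w \<and> (v = [] \<or> w = [] \<or> last v \<noteq> linv (hd w))"
  by (auto simp: rword_def reduced_append)

lemma rword_winv [simp]: "rword (winv w) \<longleftrightarrow> rword w"
  by (simp add: rword_def)

lemma reduce_word:
  assumes "set w \<subseteq> L"
  shows "\<exists>v. rword v \<and> length v \<le> length w \<and> (\<forall>x. wact v x = wact w x)"
  using assms
proof (induction w)
  case (Cons s w)
  then obtain v where v: "rword v" "length v \<le> length w" "\<forall>x. wact v x = wact w x"
    by auto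
  show ?case
  proof (cases "v \<noteq> [] \<and> s = linv (hd v)")
    case True
    then obtain u where "v = linv s # u" by (cases v) auto
    then show ?thesis
      using v by (intro exI[of _ u]) (auto simp: rword_Cons act_eq_iff)
  next
    case False
    then show ?thesis
      using v Cons.prems by (intro exI[of _ "s # v"]) (auto simp: rword_Cons)
  qed
qed (auto intro: exI[of _ "[]"])

section \<open>Distance, components and clusters in the orbit graph\<close>

definition near :: "nat \<Rightarrow> 'x \<Rightarrow> 'x \<Rightarrow> bool" where
  "near r x y \<longleftrightarrow> (\<exists>w. set w \<subseteq> L \<and> length w \<le> r \<and> y = wact w x)"

lemma near_refl [simp]: "near r x x"
  unfolding near_def by (intro exI[of _ "[]"]) auto

lemma near_sym: "near r x y \<Longrightarrow> near r y x"
  unfolding near_def by (metis set_winv_L winv_simps(5) wact_winv)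

lemma near_trans: "near r x y \<Longrightarrow> near s y z \<Longrightarrow> near (r + s) x z"
  unfolding near_def
proof (elim exE conjE)
  fix v w
  assume "set v \<subseteq> L" "length v \<le> r" "y = wact v x" "set w \<subseteq> L" "length w \<le> s" "z = wact w y"
  then show "\<exists>u. set u \<subseteq> L \<and> length u \<le> r + s \<and> z = wact u x"
    by (intro exI[of _ "w @ v"]) auto
qed

lemma near_mono: "near r x y \<Longrightarrow> r \<le> s \<Longrightarrow> near s x y"
  unfolding near_def using le_trans by blast

lemma near_act: "s \<in> L \<Longrightarrow> near 1 x (act s x)"
  unfolding near_def by (intro exI[of _ "[s]"]) auto

definition step_in :: "'x set \<Rightarrow> 'x rel" where
  "step_in A = {(x, act s x) | x s. s \<in> L \<and> x \<in> A \<and> act s x \<in> A}"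

text \<open>Components of the subgraph induced on \<open>A\<close>. The relation is reflexive at
  every point, so membership in \<open>A\<close> has to be tracked separately.\<close>

definition conn :: "'x set \<Rightarrow> 'x \<Rightarrow> 'x \<Rightarrow> bool" where
  "conn A x y \<longleftrightarrow> (x, y) \<in> (step_in A)\<^sup>*"

lemma conn_refl [simp]: "conn A x x"
  by (simp add: conn_def)

lemma conn_trans: "conn A x y \<Longrightarrow> conn A y z \<Longrightarrow> conn A x z"
  by (simp add: conn_def)

lemma sym_step_in: "sym (step_in A)"
proof (rule symI)
  fix x y assume "(x, y) \<in> step_in A"
  then obtain s where "y = act s x" "s \<in> L" "x \<in> A" "y \<in> A" by (auto simp: step_in_def)
  then have "(y, act (linv s) y) \<in> step_in A"
    unfolding step_in_def by (intro CollectI exI[of _ y] exI[of _ "linv s"]) simp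
  then show "(y, x) \<in> step_in A"
    using \<open>y = act s x\<close> by simp
qed

lemma conn_sym: "conn A x y \<Longrightarrow> conn A y x"
  unfolding conn_def using sym_rtrancl[OF sym_step_in] by (meson symD)

lemma conn_mono: "conn A x y \<Longrightarrow> A \<subseteq> B \<Longrightarrow> conn B x y"
  unfolding conn_def by (erule rtrancl_mono[THEN subsetD, rotated]) (auto simp: step_in_def)

lemma conn_step: "s \<in> L \<Longrightarrow> x \<in> A \<Longrightarrow> act s x \<in> A \<Longrightarrow> conn A x (act s x)"
  unfolding conn_def by (rule r_into_rtrancl) (unfold step_in_def, blast)

lemma conn_induct [consumes 1, case_names refl step]:
  assumes "conn A x y" "P x"
    "\<And>y s. conn A x y \<Longrightarrow> P y \<Longrightarrow> s \<in> L \<Longrightarrow> y \<in> A \<Longrightarrow> act s y \<in> A \<Longrightarrow> P (act s y)"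
  shows "P y"
  using assms(1) unfolding conn_def
proof (induction rule: rtrancl_induct)
  case (step y z)
  then show ?case using assms(3)[of y] unfolding step_in_def conn_def by auto
qed (use assms in auto)

lemma conn_in: "conn A x y \<Longrightarrow> x \<in> A \<Longrightarrow> y \<in> A"
  by (erule conn_induct)

text \<open>Different components of \<open>A\<close> are at distance more than \<open>r\<close> in
  the orbit graph.\<close>

definition clustered :: "nat \<Rightarrow> 'x set \<Rightarrow> bool" where
  "clustered r A \<longleftrightarrow> (\<forall>x\<in>A. \<forall>y\<in>A. near r x y \<longrightarrow> conn A x y)"

text \<open>
  Gluing is only required over clustered sets: prescribing the colors on a large sphere in a tree
  can force the color of its center, so arbitrary separated sets would be too much to ask.
\<close>

definition irreducible_family :: "'x set \<Rightarrow> ('x \<Rightarrow> nat) set \<Rightarrow> nat \<Rightarrow> bool" where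
  "irreducible_family G F r \<longleftrightarrow>
     (\<forall>A a. A \<subseteq> G \<and> clustered r A \<and> (\<forall>x\<in>A. \<exists>e\<in>F. \<forall>y. conn A x y \<longrightarrow> e y = a y)
        \<longrightarrow> (\<exists>e\<in>F. \<forall>x\<in>A. e x = a x))"

text \<open>Enlarge \<open>A\<close> by \<open>Q\<close> and by short walks from \<open>A\<close> to
  \<open>Q\<close>. A point of the result is either an isolated prescribed point, more than
  \<open>r\<close> from everything else, or within \<open>r\<close> of exactly one component of
  \<open>A\<close>. The enlarged set is therefore clustered for \<open>r\<close>, and gluing over it
  respects both \<open>a\<close> and \<open>h\<close>.\<close>

lemma irreducible_refine:
  assumes irr: "irreducible_family G F r" and r: "r \<ge> 1"
    and G: "\<And>x s. x \<in> G \<Longrightarrow> s \<in> L \<Longrightarrow> act s x \<in> G"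
    and Q: "Q \<subseteq> G" and sep: "\<And>p q. p \<in> Q \<Longrightarrow> q \<in> Q \<Longrightarrow> near (2 * r) p q \<Longrightarrow> p = q"
    and h: "\<And>q. q \<in> Q \<Longrightarrow> \<exists>e\<in>F. e q = h q"
  shows "irreducible_family G {e \<in> F. \<forall>q\<in>Q. e q = h q} (3 * r)"
  unfolding irreducible_family_def
proof (intro allI impI, elim conjE)
  fix A a
  let ?F = "{e \<in> F. \<forall>q\<in>Q. e q = h q}"
  assume AG: "A \<subseteq> G" and cl: "clustered (3 * r) A"
    and wit: "\<forall>x\<in>A. \<exists>e\<in>?F. \<forall>y. conn A x y \<longrightarrow> e y = a y"
  have clA: "conn A x y" if "x \<in> A" "y \<in> A" "near k x y" "k \<le> 3 * r" for x y k
    using cl near_mono that unfolding clustered_def by blast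
  \<comment> \<open>One point per component, so that the witness \<open>E x\<close> depends only on
    the component of \<open>x\<close>.\<close>
  define rep where "rep x = (SOME y. conn A x y)" for x
  have rep: "conn A x (rep x)" for x
    unfolding rep_def by (rule someI[of _ x]) simp
  have rep_eq: "rep x = rep y" if "conn A x y" for x y
  proof -
    have "conn A x = conn A y" using that conn_sym conn_trans by (intro ext) blast
    then show ?thesis by (simp add: rep_def)
  qed
  have "\<forall>x\<in>A. \<exists>e. e \<in> ?F \<and> (\<forall>y. conn A x y \<longrightarrow> e y = a y)" using wit by blast
  from bchoice[OF this] obtain E0 where
    E0: "\<And>x. x \<in> A \<Longrightarrow> E0 x \<in> ?F \<and> (\<forall>y. conn A x y \<longrightarrow> E0 x y = a y)"
    by blast
  define E where "E x = E0 (rep x)" for x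
  have E: "E x \<in> ?F" "\<And>y. conn A x y \<Longrightarrow> E x y = a y" if "x \<in> A" for x
    using E0[OF conn_in[OF rep that]] conn_trans[OF conn_sym[OF rep]] by (auto simp: E_def)
  have E_eq: "E x = E y" if "conn A x y" for x y
    using rep_eq[OF that] by (simp add: E_def)
  \<comment> \<open>Vertices of walks of length at most \<open>r\<close> from \<open>A\<close> to
    \<open>Q\<close>: \<open>u\<close> is the part already walked, \<open>v\<close> the rest. They
    tie each prescribed point within \<open>r\<close> of \<open>A\<close> to a component of
    \<open>A\<close>.\<close>
  define P where "P = {wact u x | u v x. x \<in> A \<and> wact (v @ u) x \<in> Q \<and> set (v @ u) \<subseteq> L \<and>
    length (v @ u) \<le> r}"
  define B where "B = A \<union> P \<union> Q"
  define isol where "isol y \<longleftrightarrow> y \<in> Q \<and> (\<forall>x\<in>A. \<not> near r x y)" for y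
  have Gw: "wact w x \<in> G" if "set w \<subseteq> L" "x \<in> G" for w x
    using that by (induction w) (auto intro: G)
  have BG: "B \<subseteq> G"
    using AG Q Gw by (auto simp: B_def P_def)
  have AB: "A \<subseteq> B" by (auto simp: B_def)
  have path: "conn B x (wact u x)"
    if "x \<in> A" "wact (v @ u) x \<in> Q" "set (v @ u) \<subseteq> L" "length (v @ u) \<le> r" for x u v
    using that
  proof (induction u arbitrary: v)
    case (Cons s u)
    have "conn B x (wact u x)"
      using Cons.IH[of "v @ [s]"] Cons.prems by simp
    moreover have "wact u x \<in> P"
      unfolding P_def using Cons.prems by (intro CollectI exI[of _ u] exI[of _ "v @ [s]"] exI[of _ x]) auto
    moreover have "wact (s # u) x \<in> P"
      unfolding P_def using Cons.prems by (intro CollectI exI[of _ "s # u"] exI[of _ v] exI[of _ x]) auto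
    ultimately show ?case
      using conn_step[of s "wact u x" B] Cons.prems by (auto simp: B_def intro: conn_trans)
  qed simp
  have att: "isol y \<or> (\<exists>x\<in>A. near r x y \<and> conn B x y)" if y: "y \<in> B" for y
  proof -
    consider "y \<in> A" | "y \<in> P" | "y \<in> Q" using y by (auto simp: B_def)
    then show ?thesis
    proof cases
      case 2
      then obtain u v x where x: "y = wact u x" "x \<in> A" "wact (v @ u) x \<in> Q" "set (v @ u) \<subseteq> L"
        "length (v @ u) \<le> r" by (auto simp: P_def)
      then have "near r x y" unfolding near_def by (intro exI[of _ u]) auto
      then show ?thesis using path x by blast
    next
      case 3
      show ?thesis
      proof (cases "isol y")
        case False
        then obtain x where x: "x \<in> A" "near r x y" using 3 by (auto simp: isol_def)
        then obtain u where "set u \<subseteq> L" "length u \<le> r" "y = wact u x" by (auto simp: near_def)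
        then show ?thesis
          using path[of x "[]" u] x 3 by auto
      qed simp
    qed (use near_refl conn_refl in blast)
  qed
  \<comment> \<open>A vertex of \<open>P\<close> within \<open>r\<close> of an isolated
    \<open>q\<close> is also within \<open>r\<close> of the end \<open>p\<close> in \<open>Q\<close>
    of its walk. Separation by \<open>2 * r\<close> forces \<open>p = q\<close>, but
    \<open>p\<close> is within \<open>r\<close> of \<open>A\<close>.\<close>
  have far: "y = q" if yB: "y \<in> B" and q: "isol q" and ny: "near r q y" for q y
  proof (rule ccontr)
    assume ne: "y \<noteq> q"
    consider "y \<in> A" | "y \<in> P" | "y \<in> Q" using yB by (auto simp: B_def)
    then show False
    proof cases
      case 1 then show False using q ny near_sym by (auto simp: isol_def)
    next
      case 2
      then obtain u v x where x: "y = wact u x" "x \<in> A" "wact (v @ u) x \<in> Q" "set (v @ u) \<subseteq> L"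
        "length (v @ u) \<le> r" by (auto simp: P_def)
      have "near r y (wact (v @ u) x)"
        unfolding near_def using x by (intro exI[of _ v]) auto
      then have "q = wact (v @ u) x"
        using sep[of q "wact (v @ u) x"] near_trans[OF ny] q x by (auto simp: isol_def mult_2)
      moreover have "near r x (wact (v @ u) x)"
        unfolding near_def using x by (intro exI[of _ "v @ u"]) auto
      ultimately show False using q x by (auto simp: isol_def)
    next
      case 3
      then show False using sep[of q y] ne ny q near_mono[of r q y "2 * r"] by (auto simp: isol_def)
    qed
  qed
  define \<nu> where "\<nu> y = (SOME x. x \<in> A \<and> near r x y)" for y
  have \<nu>: "\<nu> y \<in> A" "near r (\<nu> y) y" if "x \<in> A" "near r x y" for x y
    using someI[of "\<lambda>x. x \<in> A \<and> near r x y" x] that by (auto simp: \<nu>_def)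
  \<comment> \<open>Two points of \<open>A\<close> within \<open>r\<close> of \<open>y\<close> are
    within \<open>2 * r\<close> of each other, hence in one component: the choice of
    \<open>\<nu> y\<close> does not matter.\<close>
  have \<nu>_conn: "conn A x (\<nu> y)" if "x \<in> A" "near r x y" for x y
  proof -
    have "near (r + r) x (\<nu> y)" using near_trans that \<nu> near_sym by blast
    then show ?thesis using clA that \<nu> by auto
  qed
  define b where "b y = (if isol y then h y else E (\<nu> y) y)" for y
  have bE: "b y = E x y" if "x \<in> A" "near r x y" for x y
  proof -
    have "\<not> isol y" using that by (auto simp: isol_def)
    then show ?thesis using \<nu>_conn[OF that] E_eq by (auto simp: b_def)
  qed
  have clB: "clustered r B"
    unfolding clustered_def
  proof (intro ballI impI)
    fix y z assume yz: "y \<in> B" "z \<in> B" "near r y z"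
    show "conn B y z"
    proof (cases "isol y \<or> isol z")
      case True
      then have "y = z" using far yz near_sym by metis
      then show ?thesis by simp
    next
      case False
      then obtain x x' where x: "x \<in> A" "near r x y" "conn B x y" "x' \<in> A" "near r x' z" "conn B x' z"
        using att yz by meson
      \<comment> \<open>The origin of the factor 3: attached vertices at distance at most
        \<open>r\<close> have anchors at distance at most \<open>3 * r\<close>.\<close>
      have "near (r + (r + r)) x x'"
        using x yz by (meson near_sym near_trans)
      then have "conn A x x'" using clA x by auto
      then show ?thesis
        using x AB by (meson conn_mono conn_sym conn_trans)
    qed
  qed
  \<comment> \<open>A component of \<open>B\<close> is a single isolated point, served by a coloring
    with the prescribed color there, or it is anchored in one component of \<open>A\<close>, whose
    witness serves it.\<close>
  have witB: "\<exists>e\<in>F. \<forall>z. conn B y z \<longrightarrow> e z = b z" if y: "y \<in> B" for y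
  proof (cases "isol y")
    case True
    then obtain e where e: "e \<in> F" "e y = h y" using h by (auto simp: isol_def)
    have "z = y" if "conn B y z" for z
      using that
    proof (induction rule: conn_induct)
      case (step z s)
      then show ?case using far[of "act s z" y] True near_mono[OF near_act r] by auto
    qed simp
    then show ?thesis using e True by (intro bexI[of _ e]) (auto simp: b_def)
  next
    case False
    then obtain x where x: "x \<in> A" "near r x y" using att y by blast
    have *: "\<exists>x'\<in>A. near r x' z \<and> conn A x x'" if "conn B y z" for z
      using that
    proof (induction rule: conn_induct)
      case (step z s)
      then obtain x' where x': "x' \<in> A" "near r x' z" "conn A x x'" by blast
      have n: "near r z (act s z)" using step near_mono[OF near_act r] by blast
      have "\<not> isol (act s z)"
      proof
        assume "isol (act s z)"
        moreover from this have "z = act s z" using far step n near_sym by blast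
        ultimately show False using x' by (metis isol_def)
      qed
      then obtain x'' where x'': "x'' \<in> A" "near r x'' (act s z)" using att step by blast
      have "near (r + (r + r)) x' x''"
        using x' x'' n by (meson near_sym near_trans)
      then have "conn A x' x''" using clA x' x'' by auto
      then show ?case using x' x'' conn_trans by blast
    qed (use x in auto)
    have "E x z = b z" if "conn B y z" for z
      using *[OF that] bE E_eq by metis
    then show ?thesis using E(1)[OF x(1)] by blast
  qed
  have "\<exists>e\<in>F. \<forall>y\<in>B. e y = b y"
    using irr[unfolded irreducible_family_def, rule_format, of B b] BG clB witB by blast
  then obtain e where e: "e \<in> F" "\<And>y. y \<in> B \<Longrightarrow> e y = b y"
    by blast
  have "e q = h q" if q: "q \<in> Q" for q
  proof (cases "isol q")
    case False
    then obtain x where x: "x \<in> A" "near r x q" using q by (auto simp: isol_def)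
    then show ?thesis using e(2)[of q] bE[OF x] E(1)[OF x(1)] q by (auto simp: B_def)
  qed (use e q in \<open>auto simp: b_def B_def\<close>)
  moreover have "e x = a x" if "x \<in> A" for x
    using e(2)[of x] bE[of x x] E(2)[of x x] that AB by auto
  ultimately show "\<exists>e\<in>?F. \<forall>x\<in>A. e x = a x" using e by blast
qed

end

section \<open>Colorings along words\<close>

text \<open>Existence of an admissible coloring of the path traced by a word, from color
  \<open>c\<close> to color \<open>d\<close>. As in \<open>wact\<close>, the last letter is the
  first edge.\<close>

fun word_rel :: "nat \<Rightarrow> ('a \<Rightarrow> nat \<Rightarrow> nat \<Rightarrow> bool) \<Rightarrow> 'a list \<Rightarrow> nat \<Rightarrow> nat \<Rightarrow> bool" where
  "word_rel n rel [] c d \<longleftrightarrow> c = d"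
| "word_rel n rel (s # w) c d \<longleftrightarrow> (\<exists>e<n. word_rel n rel w c e \<and> rel s e d)"

locale letter_coloring = letter_action act L
  for act :: "'k \<times> bool \<Rightarrow> 'x \<Rightarrow> 'x" and L +
  fixes n :: nat and rel :: "'k \<times> bool \<Rightarrow> nat \<Rightarrow> nat \<Rightarrow> bool"
  assumes n_pos: "n \<ge> 1"
    and rel_linv: "rel (linv s) d c \<longleftrightarrow> rel s c d"
    and rel_total: "s \<in> L \<Longrightarrow> c < n \<Longrightarrow> \<exists>d<n. rel s c d"
begin

abbreviation "relw \<equiv> word_rel n rel"

lemma relw_append: "d < n \<Longrightarrow> relw (v @ w) c d \<longleftrightarrow> (\<exists>e<n. relw w c e \<and> relw v e d)"
proof (induction v arbitrary: d)
  case (Cons s v)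
  then show ?case by auto blast
qed simp

lemma relw_onto:
  assumes "set w \<subseteq> L" "d < n"
  shows "\<exists>c<n. relw w c d"
  using assms
proof (induction w arbitrary: d)
  case (Cons s w)
  obtain e where "e < n" "rel s e d"
    using rel_total[of "linv s" d] Cons.prems rel_linv by auto
  then show ?case using Cons.IH[of e] Cons.prems by auto
qed auto

definition valid :: "'x set \<Rightarrow> ('x \<Rightarrow> nat) \<Rightarrow> bool" where
  "valid X x \<longleftrightarrow> (\<forall>p\<in>X. x p < n) \<and> (\<forall>p\<in>X. \<forall>s\<in>L. act s p \<in> X \<longrightarrow> rel s (x p) (x (act s p)))"

text \<open>
  \<open>C\<close> is a base meeting every orbit, and \<open>cyc b s\<close> marks the edges at \<open>b\<close> inside the base.
  A word is off the base if its first step (its last letter) is not such an edge; in a \<open>coded\<close>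
  action the orbits are forests planted on the base.
\<close>

definition offw :: "'x set \<Rightarrow> ('x \<Rightarrow> 'k \<times> bool \<Rightarrow> bool) \<Rightarrow> 'x \<Rightarrow> ('k \<times> bool) list \<Rightarrow> bool" where
  "offw C cyc b w \<longleftrightarrow> b \<in> C \<and> rword w \<and> (w \<noteq> [] \<longrightarrow> \<not> cyc b (last w))"

definition coded :: "'x set \<Rightarrow> 'x set \<Rightarrow> ('x \<Rightarrow> 'k \<times> bool \<Rightarrow> bool) \<Rightarrow> bool" where
  "coded X C cyc \<longleftrightarrow> C \<subseteq> X \<and> (\<forall>x\<in>X. \<forall>s\<in>L. act s x \<in> X) \<and>
     (\<forall>b\<in>C. \<forall>s\<in>L. cyc b s \<longrightarrow> act s b \<in> C) \<and>
     (\<forall>x\<in>X. \<exists>b w. offw C cyc b w \<and> x = wact w b) \<and>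
     (\<forall>b w b' w'. offw C cyc b w \<longrightarrow> offw C cyc b' w' \<longrightarrow> wact w b = wact w' b' \<longrightarrow>
        b = b' \<and> w = w')"

lemma wact_in:
  assumes "\<forall>x\<in>X. \<forall>s\<in>L. act s x \<in> X" "set w \<subseteq> L" "x \<in> X"
  shows "wact w x \<in> X"
  using assms(2) by (induction w) (use assms in auto)

lemma offw_Nil [simp]: "offw C cyc b [] \<longleftrightarrow> b \<in> C"
  by (simp add: offw_def)

lemma offw_append: "offw C cyc b (v @ w) \<Longrightarrow> offw C cyc b w"
  by (auto simp: offw_def rword_append)

lemma offw_Cons: "offw C cyc b (s # w) \<Longrightarrow> offw C cyc b w"
  using offw_append[of C cyc b "[s]" w] by simp

text \<open>Unique codes permit a recursion along the code word, outward from the base;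
  \<open>good\<close> is an invariant to be maintained on the way.\<close>

lemma coded_coloring:
  assumes cod: "coded X C cyc"
    and base: "\<And>b. b \<in> C \<Longrightarrow> \<kappa> b < n \<and> good b [] (\<kappa> b)"
    and cyc: "\<And>b s. b \<in> C \<Longrightarrow> s \<in> L \<Longrightarrow> cyc b s \<Longrightarrow> rel s (\<kappa> b) (\<kappa> (act s b))"
    and step: "\<And>b w s c. offw C cyc b (s # w) \<Longrightarrow> c < n \<Longrightarrow> good b w c \<Longrightarrow>
      \<exists>d<n. rel s c d \<and> good b (s # w) d"
  shows "\<exists>x. valid X x \<and> (\<forall>b w. offw C cyc b w \<longrightarrow> good b w (x (wact w b)))"
proof -
  have inv: "\<forall>x\<in>X. \<forall>s\<in>L. act s x \<in> X" and CX: "C \<subseteq> X"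
    and uniq: "\<And>b w b' w'. offw C cyc b w \<Longrightarrow> offw C cyc b' w' \<Longrightarrow> wact w b = wact w' b' \<Longrightarrow>
        b = b' \<and> w = w'"
    using cod unfolding coded_def by blast+
  define col where "col b = rec_list (\<kappa> b)
    (\<lambda>s w c. SOME d. d < n \<and> rel s c d \<and> good b (s # w) d)" for b
  have col_Nil: "col b [] = \<kappa> b" for b by (simp add: col_def)
  have col: "col b w < n \<and> good b w (col b w)" if "offw C cyc b w" for b w
    using that
  proof (induction w)
    case Nil then show ?case using base col_Nil by simp
  next
    case (Cons s w)
    have "\<exists>d. d < n \<and> rel s (col b w) d \<and> good b (s # w) d"
      using step Cons offw_Cons by blast
    from someI_ex[OF this] show ?case by (simp add: col_def)
  qed
  have col_rel: "rel s (col b w) (col b (s # w))" if "offw C cyc b (s # w)" for b s w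
  proof -
    have "\<exists>d. d < n \<and> rel s (col b w) d \<and> good b (s # w) d"
      using step col that offw_Cons by blast
    from someI_ex[OF this] show ?thesis by (simp add: col_def)
  qed
  have "\<exists>b w. offw C cyc b w \<and> x = wact w b" if "x \<in> X" for x
    using cod that unfolding coded_def by blast
  then obtain \<beta> \<omega> where code: "\<And>x. x \<in> X \<Longrightarrow> offw C cyc (\<beta> x) (\<omega> x) \<and> x = wact (\<omega> x) (\<beta> x)"
    by metis
  define x where "x p = col (\<beta> p) (\<omega> p)" for p
  have x: "x (wact w b) = col b w" if "offw C cyc b w" for b w
  proof -
    have "wact w b \<in> X"
      using that wact_in[OF inv] CX by (auto simp: offw_def rword_def)
    then show ?thesis using uniq[OF that] code x_def by metis
  qed
  have "rel s (x p) (x (act s p))" if p: "p \<in> X" and s: "s \<in> L" for p s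
  proof -
    define b where "b = \<beta> p"
    define w where "w = \<omega> p"
    have bw: "offw C cyc b w" "p = wact w b" using code[OF p] by (auto simp: b_def w_def)
    \<comment> \<open>The edge \<open>s\<close> at \<open>p\<close> stays inside the base, undoes
      the last step of the code, or prolongs the code.\<close>
    consider "w = []" "cyc b s" | v where "w = linv s # v" | "offw C cyc b (s # w)"
      using bw s by (cases w) (auto simp: offw_def rword_Cons eq_linv_sym)
    then show ?thesis
    proof cases
      case 1
      then have "act s b \<in> C" using cod bw s by (auto simp: coded_def)
      then show ?thesis
        using x[of b "[]"] x[of "act s b" "[]"] 1 bw cyc[of b s] s col_Nil by auto
    next
      case 2
      then have "offw C cyc b v" using bw offw_Cons by blast
      then show ?thesis
        using x[of b v] x[of b w] col_rel[of b "linv s" v] bw 2 rel_linv by auto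
    next
      case 3
      then show ?thesis
        using x[of b w] x[of b "s # w"] bw col_rel by auto
    qed
  qed
  moreover have "x p < n" if "p \<in> X" for p
    using code[OF that] col by (simp add: x_def)
  ultimately have "valid X x" by (auto simp: valid_def)
  then show ?thesis using x col by auto
qed

text \<open>Color outward from the roots. At most one component of \<open>A\<close> is entered
  within \<open>N\<close> edges beyond a vertex: two entry points would be within
  \<open>2 * N\<close>, hence in one component, and a component has a single entry point. So only
  one target must be kept reachable, and \<open>mix\<close> makes it reachable when it first comes
  into view.\<close>

lemma extend_coloring:
  assumes cod: "coded X C (\<lambda>_ _. False)"
    and mix: "\<And>w c d. rword w \<Longrightarrow> length w = N \<Longrightarrow> c < n \<Longrightarrow> d < n \<Longrightarrow> relw w c d"
    and AX: "A \<subseteq> X" and cl: "clustered (2 * N) A" and a: "valid A a"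
  shows "\<exists>x. valid X x \<and> (\<forall>p\<in>A. x p = a p)"
proof -
  let ?off = "offw C (\<lambda>_ _. False)"
  have uniq: "\<And>b w b' w'. ?off b w \<Longrightarrow> ?off b' w' \<Longrightarrow> wact w b = wact w' b' \<Longrightarrow> b = b' \<and> w = w'"
    using cod unfolding coded_def by blast
  have an: "a p < n" if "p \<in> A" for p using a that by (auto simp: valid_def)
  \<comment> \<open>Entry point of a component of \<open>A\<close> on the way from the root;
    \<open>tl w\<close> codes the parent vertex.\<close>
  define top where "top b w \<longleftrightarrow> wact w b \<in> A \<and> (w = [] \<or> wact (tl w) b \<notin> A)" for b w
  have below: "\<exists>v. y = wact (v @ w) b \<and> ?off b (v @ w)"
    if t: "top b w" "?off b w" and y: "conn A (wact w b) y" for b w y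
    using y
  proof (induction rule: conn_induct)
    case refl
    then show ?case using t by (intro exI[of _ "[]"]) auto
  next
    case (step y s)
    then obtain v where v: "y = wact (v @ w) b" "?off b (v @ w)" by blast
    show ?case
    proof (cases "?off b (s # v @ w)")
      case True
      then show ?thesis using v by (intro exI[of _ "s # v"]) auto
    next
      case False
      then have hd: "v @ w \<noteq> []" "s = linv (hd (v @ w))"
        using v step by (auto simp: offw_def rword_Cons)
      show ?thesis
      proof (cases v)
        case Nil
        then have "w = linv s # tl w" using hd by (cases w) auto
        then have "act s y = wact (tl w) b"
          using v Nil by (metis act_linv' append_Nil wact_simps(2))
        then show ?thesis using t step \<open>w = linv s # tl w\<close> by (auto simp: top_def)
      next
        case (Cons r u)
        then show ?thesis using v hd offw_Cons by (intro exI[of _ u]) auto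
      qed
    qed
  qed
  have top_uniq: "w = w'"
    if tu: "top b w" "?off b w" "top b w'" "?off b w'" "conn A (wact w b) (wact w' b)" for b w w'
  proof -
    obtain v where "wact w' b = wact (v @ w) b" "?off b (v @ w)"
      using below[OF tu(1,2,5)] by blast
    then have 1: "w' = v @ w" using uniq tu by blast
    obtain v' where "wact w b = wact (v' @ w') b" "?off b (v' @ w')"
      using below[OF tu(3,4) conn_sym[OF tu(5)]] by blast
    then have "w = v' @ w'" using uniq tu by blast
    then show ?thesis using 1 by simp
  qed
  have near_off: "near N (wact w b) (wact (v @ w) b)" if "length v \<le> N" "?off b (v @ w)" for b v w
    unfolding near_def using that by (intro exI[of _ v]) (auto simp: offw_def rword_append rword_def)
  have conn2: "conn A p q" if "p \<in> A" "q \<in> A" "near N r p" "near N r q" for p q r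
    using cl near_trans[OF near_sym[OF that(3)] that(4)] that by (auto simp: clustered_def mult_2)
  have top_uniq': "v = v'"
    if "length v \<le> N" "?off b (v @ w)" "top b (v @ w)"
      "length v' \<le> N" "?off b (v' @ w)" "top b (v' @ w)" for b v v' w
  proof -
    have "wact (v @ w) b \<in> A" "wact (v' @ w) b \<in> A"
      using that by (auto simp only: top_def)
    then have "conn A (wact (v @ w) b) (wact (v' @ w) b)"
      using that by (intro conn2[OF _ _ near_off near_off])
    then have "v @ w = v' @ w"
      using top_uniq that by blast
    then show ?thesis by simp
  qed
  \<comment> \<open>Look-ahead of \<open>N\<close> edges: the color must still be joinable to the
    one prescribed at an entry point at most \<open>N\<close> edges further out.\<close>
  define good where "good b w c \<longleftrightarrow> (wact w b \<in> A \<longrightarrow> c = a (wact w b)) \<and>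
    (\<forall>v. length v \<le> N \<and> ?off b (v @ w) \<and> top b (v @ w) \<longrightarrow> relw v c (a (wact (v @ w) b)))" for b w c
  have goodI: "good b w c"
    if "?off b w" "length v \<le> N" "?off b (v @ w)" "top b (v @ w)" "relw v c (a (wact (v @ w) b))"
      "top b w \<or> wact w b \<notin> A" for b w v c
    unfolding good_def
  proof (intro conjI impI allI; (elim conjE)?)
    assume "wact w b \<in> A"
    then have "v = []" using top_uniq'[of v b w "[]"] that by auto
    then show "c = a (wact w b)" using that by simp
  next
    fix v' assume "length v' \<le> N" "?off b (v' @ w)" "top b (v' @ w)"
    then show "relw v' c (a (wact (v' @ w) b))" using top_uniq'[of v b w v'] that by auto
  qed
  have goodI': "good b w c" if "wact w b \<notin> A"
    "\<nexists>v. length v \<le> N \<and> ?off b (v @ w) \<and> top b (v @ w)" for b w c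
    using that unfolding good_def by blast
  have base: "\<exists>c<n. good b [] c" if b: "b \<in> C" for b
  proof (cases "\<exists>v. length v \<le> N \<and> ?off b (v @ []) \<and> top b (v @ [])")
    case True
    then obtain v where v: "length v \<le> N" "?off b (v @ [])" "top b (v @ [])" by blast
    then have "wact v b \<in> A" "set v \<subseteq> L" by (auto simp: top_def offw_def rword_def)
    then obtain c where "c < n" "relw v c (a (wact v b))"
      using relw_onto an by blast
    then show ?thesis
      using goodI[of b "[]" v c] v b by (auto simp: top_def)
  next
    case False
    moreover have "b \<notin> A" using False b by (auto simp: top_def dest: spec[of _ "[]"])
    ultimately show ?thesis using goodI'[of "[]" b 0] n_pos by (intro exI[of _ 0]) auto
  qed
  obtain \<kappa> where \<kappa>: "\<And>b. b \<in> C \<Longrightarrow> \<kappa> b < n \<and> good b [] (\<kappa> b)"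
    using base by metis
  have step: "\<exists>d<n. rel s c d \<and> good b (s # w) d"
    if off: "?off b (s # w)" and c: "c < n" and g: "good b w c" for b w s c
  proof -
    have sL: "s \<in> L" using off by (auto simp: offw_def rword_def)
    have ow: "?off b w" using off offw_Cons by blast
    consider (inside) "wact w b \<in> A" "wact (s # w) b \<in> A"
      | (top) v where "length v \<le> N" "?off b (v @ s # w)" "top b (v @ s # w)"
          "\<not> (wact w b \<in> A \<and> wact (s # w) b \<in> A)"
      | (none) "\<nexists>v. length v \<le> N \<and> ?off b (v @ s # w) \<and> top b (v @ s # w)"
          "\<not> (wact w b \<in> A \<and> wact (s # w) b \<in> A)"
      by blast
    then show ?thesis
    proof cases
      case inside
      \<comment> \<open>Such an entry point would lie in the same component as the present vertex,
        but a component lies entirely beyond its entry point.\<close>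
      have no: "\<not> top b (v @ s # w)" if vN: "length v \<le> N" "?off b (v @ s # w)" for v
      proof
        assume t: "top b (v @ s # w)"
        have v: "v \<noteq> []" using t inside by (auto simp: top_def)
        have "conn A (wact (v @ s # w) b) (wact (s # w) b)"
          using conn2[OF _ _ near_off[of v b "s # w"] near_refl[of N]] vN t inside by (auto simp: top_def)
        then obtain u where "wact (s # w) b = wact (u @ v @ s # w) b" "?off b (u @ v @ s # w)"
          using below[OF t vN(2)] by auto
        then have "s # w = u @ v @ s # w" using uniq off by blast
        then have "length (s # w) = length (u @ v @ s # w)" by (rule arg_cong)
        then show False using v by simp
      qed
      have "c = a (wact w b)" using g inside by (simp add: good_def)
      then have "rel s c (a (wact (s # w) b))" "a (wact (s # w) b) < n"
        using a inside sL by (auto simp: valid_def)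
      then show ?thesis
        using no inside by (intro exI[of _ "a (wact (s # w) b)"]) (auto simp: good_def)
    next
      case top
      have av: "a (wact (v @ s # w) b) < n" using top an by (auto simp: top_def)
      \<comment> \<open>An entry point at exactly \<open>N\<close> edges has just come into view and
        \<open>mix\<close> reaches it from any color; a closer one was already visible from the
        parent, whose color keeps it reachable.\<close>
      have "\<exists>d<n. rel s c d \<and> relw v d (a (wact (v @ s # w) b))"
      proof (cases "length v = N")
        case True
        obtain d where "d < n" "rel s c d" using rel_total sL c by blast
        moreover have "rword v" using top by (auto simp: offw_def rword_append)
        ultimately show ?thesis using mix True av by blast
      next
        case False
        then have "relw (v @ [s]) c (a (wact (v @ s # w) b))"
          using g top unfolding good_def by (auto dest!: spec[of _ "v @ [s]"])
        then show ?thesis using relw_append[OF av, of v "[s]" c] c by auto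
      qed
      then obtain d where d: "d < n" "rel s c d" "relw v d (a (wact (v @ s # w) b))" by blast
      have "good b (s # w) d"
        using goodI[OF off top(1-3) d(3)] top(4) by (auto simp: top_def)
      then show ?thesis using d by blast
    next
      case none
      have "wact (s # w) b \<notin> A"
      proof
        assume "wact (s # w) b \<in> A"
        then have "top b ([] @ s # w)" using none by (auto simp: top_def)
        then show False using none off by (metis append_Nil le0 list.size(3))
      qed
      then show ?thesis using goodI'[of "s # w" b] none rel_total[OF sL c] by blast
    qed
  qed
  obtain x where x: "valid X x" "\<And>b w. ?off b w \<Longrightarrow> good b w (x (wact w b))"
    using coded_coloring[where good = good and \<kappa> = \<kappa>, OF cod \<kappa>] step by blast
  have "x p = a p" if p: "p \<in> A" for p
  proof -
    obtain b w where "?off b w" "p = wact w b"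
      using cod AX p unfolding coded_def by blast
    then show ?thesis using x(2)[of b w] p by (auto simp: good_def)
  qed
  then show ?thesis using x by blast
qed

end

section \<open>Orbits and their cycles\<close>

context letter_coloring
begin

text \<open>Validity concerns single edges, and an edge inside \<open>A\<close> lies in one
  component, so the witnesses on the components already make \<open>a\<close> valid on
  \<open>A\<close>.\<close>

lemma irreducible_valid:
  assumes "coded X C (\<lambda>_ _. False)"
    and "\<And>w c d. rword w \<Longrightarrow> length w = N \<Longrightarrow> c < n \<Longrightarrow> d < n \<Longrightarrow> relw w c d"
  shows "irreducible_family X {x. valid X x} (2 * N)"
  unfolding irreducible_family_def
proof (intro allI impI, elim conjE)
  fix A a
  assume A: "A \<subseteq> X" "clustered (2 * N) A"
    and wit: "\<forall>x\<in>A. \<exists>e\<in>{x. valid X x}. \<forall>y. conn A x y \<longrightarrow> e y = a y"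
  have "valid A a"
    unfolding valid_def
  proof (intro conjI ballI impI)
    fix p assume p: "p \<in> A"
    then obtain e where e: "valid X e" "\<And>y. conn A p y \<Longrightarrow> e y = a y" using wit by auto
    then show "a p < n" using A(1) p conn_refl by (metis subsetD valid_def)
    fix s assume s: "s \<in> L" "act s p \<in> A"
    then have "e (act s p) = a (act s p)" "e p = a p" using e(2) conn_step p conn_refl by blast+
    moreover have "rel s (e p) (e (act s p))" using e(1) A(1) p s by (auto simp: valid_def)
    ultimately show "rel s (a p) (a (act s p))" by simp
  qed
  then show "\<exists>e\<in>{x. valid X x}. \<forall>x\<in>A. e x = a x"
    using extend_coloring[OF assms A] by blast
qed

text \<open>Uniqueness of codes reduces to excluding returns to the base: two codes of one point
  with different heads combine into a word that leaves the base and comes back.\<close>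

lemma codedI:
  assumes inv: "\<And>x s. x \<in> X \<Longrightarrow> s \<in> L \<Longrightarrow> act s x \<in> X" and CX: "C \<subseteq> X"
    and cyc: "\<And>b s. b \<in> C \<Longrightarrow> s \<in> L \<Longrightarrow> cyc b s \<Longrightarrow> act s b \<in> C \<and> cyc (act s b) (linv s)"
    and meets: "\<And>x. x \<in> X \<Longrightarrow> \<exists>b\<in>C. \<exists>w. set w \<subseteq> L \<and> x = wact w b"
    and no_return: "\<And>b w. offw C cyc b w \<Longrightarrow> w \<noteq> [] \<Longrightarrow> wact w b \<in> C \<Longrightarrow>
      \<not> cyc (wact w b) (linv (hd w)) \<Longrightarrow> False"
  shows "coded X C cyc"
proof -
  \<comment> \<open>\<open>no_return\<close> excludes arrivals along other edges; an arrival along a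
    base edge means that the word was in the base one step earlier, so induction applies.\<close>
  have leaves: "wact w b \<notin> C" if "offw C cyc b w" "w \<noteq> []" for b w
    using that
  proof (induction w)
    case (Cons s v)
    show ?case
    proof
      assume C: "wact (s # v) b \<in> C"
      then have "cyc (wact (s # v) b) (linv s)"
        using no_return[OF Cons.prems(1)] by auto
      then have *: "wact v b \<in> C" "cyc (wact v b) s"
        using cyc[OF C, of "linv s"] Cons.prems by (auto simp: offw_def rword_def)
      show False
        using Cons.IH[OF offw_Cons[OF Cons.prems(1)]] * Cons.prems by (cases "v = []") (auto simp: offw_def)
    qed
  qed simp
  have uniq: "b = b' \<and> w = w'"
    if "offw C cyc b w" "offw C cyc b' w'" "wact w b = wact w' b'" for b w b' w'
    using that
  proof (induction w arbitrary: w')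
    case Nil
    then show ?case using leaves[of b' w'] by (cases "w' = []") auto
  next
    case (Cons s v)
    have "w' \<noteq> []" using leaves[OF Cons.prems(1)] Cons.prems by auto
    then obtain t v' where w': "w' = t # v'" by (cases w') auto
    have "s = t"
    proof (rule ccontr)
      assume "s \<noteq> t"
      then have "rword (winv w' @ s # v)"
        using Cons.prems \<open>w' \<noteq> []\<close> w'
        unfolding rword_append by (simp add: offw_def last_winv del: winv_simps)
      then have "offw C cyc b (winv w' @ s # v)"
        using Cons.prems by (simp add: offw_def)
      moreover have "wact (winv w' @ s # v) b = b'"
        using Cons.prems wact_winv[of w' b'] by (simp del: winv_simps)
      ultimately show False using leaves[of b "winv w' @ s # v"] Cons.prems by (auto simp: offw_def)
    qed
    then show ?case using Cons.IH[of v'] Cons.prems w' offw_Cons by auto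
  qed
  have "\<exists>b w. offw C cyc b w \<and> x = wact w b" if x: "x \<in> X" for x
  proof -
    \<comment> \<open>A shortest word from the base to \<open>x\<close> cannot begin along a base
      edge, since starting at the other end of that edge would shorten it.\<close>
    define P where "P m \<longleftrightarrow> (\<exists>b\<in>C. \<exists>w. set w \<subseteq> L \<and> x = wact w b \<and> length w = m)" for m
    define m where "m = (LEAST m. P m)"
    have "\<exists>m. P m" using meets[OF x] by (auto simp: P_def)
    then have "P m" unfolding m_def by (rule LeastI_ex)
    then obtain b w0 where w0: "b \<in> C" "set w0 \<subseteq> L" "x = wact w0 b" "length w0 = m" by (auto simp: P_def)
    then obtain w where w: "rword w" "length w \<le> m" "x = wact w b"
      using reduce_word[of w0] by auto
    have "\<not> cyc b (last w)" if ne: "w \<noteq> []"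
    proof
      assume c: "cyc b (last w)"
      obtain u s where us: "w = u @ [s]" using ne by (cases w rule: rev_cases) auto
      then have "act s b \<in> C" using cyc c w w0 by (auto simp: rword_def)
      then have "P (length u)"
        unfolding P_def using us w by (intro bexI[of _ "act s b"] exI[of _ u]) (auto simp: rword_def)
      then have "m \<le> length u" unfolding m_def by (rule Least_le)
      then show False using w us by simp
    qed
    then show ?thesis using w w0 by (auto simp: offw_def)
  qed
  then show ?thesis
    using inv CX cyc uniq by (simp add: coded_def)
qed

definition orbit :: "'x \<Rightarrow> 'x set" where
  "orbit x = {wact w x | w. set w \<subseteq> L}"

lemma orbit_refl [simp]: "x \<in> orbit x"
  unfolding orbit_def by (auto intro!: exI[of _ "[]"])

lemma wact_in_orbit: "y \<in> orbit x \<Longrightarrow> set w \<subseteq> L \<Longrightarrow> wact w y \<in> orbit x"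
proof -
  assume "y \<in> orbit x" "set w \<subseteq> L"
  then obtain v where "set (w @ v) \<subseteq> L" "y = wact v x" by (auto simp: orbit_def)
  then show "wact w y \<in> orbit x"
    unfolding orbit_def by (intro CollectI exI[of _ "w @ v"]) simp
qed

lemma orbit_sym: "y \<in> orbit x \<Longrightarrow> x \<in> orbit y"
proof -
  assume "y \<in> orbit x"
  then obtain w where "set w \<subseteq> L" "y = wact w x" by (auto simp: orbit_def)
  then show "x \<in> orbit y"
    unfolding orbit_def by (intro CollectI exI[of _ "winv w"]) simp
qed

lemma orbit_eq: "y \<in> orbit x \<Longrightarrow> orbit y = orbit x"
proof -
  have "orbit b \<subseteq> orbit a" if "b \<in> orbit a" for a b
    using wact_in_orbit[OF that] by (subst orbit_def) auto
  then show "y \<in> orbit x \<Longrightarrow> orbit y = orbit x" using orbit_sym by blast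
qed

text \<open>The base is one root per orbit. Two roots in one orbit coincide, so a return to the base
  would be a fixed point of a nonempty reduced word.\<close>

lemma coded_free:
  assumes inv: "\<And>x s. x \<in> X \<Longrightarrow> s \<in> L \<Longrightarrow> act s x \<in> X"
    and free: "\<And>x w. x \<in> X \<Longrightarrow> rword w \<Longrightarrow> w \<noteq> [] \<Longrightarrow> wact w x \<noteq> x"
  shows "\<exists>C. coded X C (\<lambda>_ _. False)"
proof -
  define root where "root x = (SOME y. y \<in> orbit x)" for x
  have root: "root x \<in> orbit x" for x
    unfolding root_def by (rule someI[of _ x]) simp
  have root_eq: "root y = root x" if "y \<in> orbit x" for x y
    using orbit_eq[OF that] by (simp add: root_def)
  have inX: "y \<in> X" if "x \<in> X" "y \<in> orbit x" for x y
    using that wact_in[of X] inv by (auto simp: orbit_def)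
  have "coded X (root ` X) (\<lambda>_ _. False)"
  proof (rule codedI)
    show "root ` X \<subseteq> X" using root inX by blast
    show "\<exists>b\<in>root ` X. \<exists>w. set w \<subseteq> L \<and> x = wact w b" if "x \<in> X" for x
    proof -
      obtain w where "set w \<subseteq> L" "x = wact w (root x)"
        using orbit_sym[OF root] by (auto simp: orbit_def)
      then show ?thesis using that by blast
    qed
  next
    fix b w assume *: "offw (root ` X) (\<lambda>_ _. False) b w" "w \<noteq> []" "wact w b \<in> root ` X"
    then obtain x y where xy: "x \<in> X" "b = root x" "wact w b = root y" by (auto simp: offw_def)
    have "set w \<subseteq> L" using * by (simp add: offw_def rword_def)
    then have "wact w b \<in> orbit x" unfolding xy(2) by (rule wact_in_orbit[OF root])
    then have "wact w b = b" using root_eq root xy by metis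
    moreover have "b \<in> X" using xy root inX by blast
    ultimately show False using free * by (auto simp: offw_def)
  qed (use inv in auto)
  then show ?thesis by blast
qed

text \<open>Indices follow the letters from the left while the path is walked from the right; hence
  the start color sits at \<open>length w\<close> and the end color at 0.\<close>

lemma relw_path:
  assumes "relw w c d" "c < n" "d < n"
  shows "\<exists>e. e (length w) = c \<and> e 0 = d \<and> (\<forall>i\<le>length w. e i < n) \<and>
    (\<forall>i<length w. rel (w ! i) (e (Suc i)) (e i))"
  using assms
proof (induction w arbitrary: d)
  case (Cons s w)
  have "\<exists>f<n. relw w c f \<and> rel s f d" using Cons.prems(1) by simp
  then obtain f where f: "f < n" "relw w c f" "rel s f d" by (elim exE conjE)
  obtain e where e: "e (length w) = c" "e 0 = f" "\<forall>i\<le>length w. e i < n"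
    "\<forall>i<length w. rel (w ! i) (e (Suc i)) (e i)"
    using Cons.IH[OF f(2) Cons.prems(2) f(1)] by (elim exE conjE)
  define e' where "e' = case_nat d e"
  have "e' (length (s # w)) = c" "e' 0 = d" using e by (simp_all add: e'_def)
  moreover have "e' i < n" if "i \<le> length (s # w)" for i
    using that e(3) Cons.prems by (cases i) (auto simp: e'_def)
  moreover have "rel ((s # w) ! i) (e' (Suc i)) (e' i)" if "i < length (s # w)" for i
    using that e(2,4) f(3) by (cases i) (auto simp: e'_def)
  ultimately show ?case by (intro exI[of _ e'] conjI allI impI)
next
  case Nil
  then show ?case by (intro exI[of _ "\<lambda>_. c"]) simp
qed

text \<open>
  In a faithful action with commutative stabilizers, two different cycles in an orbit would give
  a nonempty reduced commutator acting trivially. So every orbit is a forest planted on a single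
  cycle, read off from a shortest word with a fixed point in the orbit.
\<close>

lemma locally_commutative_coloring:
  assumes inv: "\<And>x s. x \<in> X \<Longrightarrow> s \<in> L \<Longrightarrow> act s x \<in> X"
    and faithful: "\<And>w. rword w \<Longrightarrow> w \<noteq> [] \<Longrightarrow> \<exists>x\<in>X. wact w x \<noteq> x"
    and comm: "\<And>b u v x. b \<in> X \<Longrightarrow> set u \<subseteq> L \<Longrightarrow> set v \<subseteq> L \<Longrightarrow> wact u b = b \<Longrightarrow> wact v b = b \<Longrightarrow>
      x \<in> X \<Longrightarrow> wact u (wact v x) = wact v (wact u x)"
    and closed: "\<And>w. set w \<subseteq> L \<Longrightarrow> w \<noteq> [] \<Longrightarrow> \<exists>c<n. relw w c c"
  shows "\<exists>x. valid X x"
proof -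
  define fixes_in where "fixes_in Q w p \<longleftrightarrow> p \<in> Q \<and> rword w \<and> w \<noteq> [] \<and> wact w p = p" for Q w p
  \<comment> \<open>The empty word marks an orbit in which no nonempty reduced word has a fixed
    point; \<open>p\<close> is then an arbitrary base point.\<close>
  define shortest where "shortest Q p w \<longleftrightarrow> p \<in> Q \<and> rword w \<and> wact w p = p \<and>
      (w = [] \<longrightarrow> (\<nexists>u q. fixes_in Q u q)) \<and> (\<forall>u q. fixes_in Q u q \<longrightarrow> length w \<le> length u)" for Q p w
  have "\<exists>p w. shortest (orbit x) p w" for x
  proof (cases "\<exists>u q. fixes_in (orbit x) u q")
    case True
    define P where "P m \<longleftrightarrow> (\<exists>u q. fixes_in (orbit x) u q \<and> length u = m)" for m
    have "\<exists>m. P m" using True by (auto simp: P_def)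
    then have "P (LEAST m. P m)" by (rule LeastI_ex)
    then obtain u q where uq: "fixes_in (orbit x) u q" "length u = (LEAST m. P m)" by (auto simp: P_def)
    have "length u \<le> length u'" if "fixes_in (orbit x) u' q'" for u' q'
      unfolding uq(2) by (rule Least_le) (use that in \<open>auto simp: P_def\<close>)
    moreover have "q \<in> orbit x" "rword u" "u \<noteq> []" "wact u q = q"
      using uq(1) by (simp_all add: fixes_in_def)
    ultimately have "shortest (orbit x) q u" unfolding shortest_def by blast
    then show ?thesis by blast
  next
    case False
    then have "shortest (orbit x) x []" by (simp add: shortest_def)
    then show ?thesis by blast
  qed
  then have "\<forall>Q\<in>range orbit. \<exists>p w. shortest Q p w" by blast
  then obtain pt wd where "\<And>Q. Q \<in> range orbit \<Longrightarrow> shortest Q (pt Q) (wd Q)"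
    by metis
  then have D: "\<And>Q. Q \<in> range orbit \<Longrightarrow> pt Q \<in> Q \<and> rword (wd Q) \<and> wact (wd Q) (pt Q) = pt Q \<and>
      (wd Q = [] \<longrightarrow> (\<nexists>u q. fixes_in Q u q)) \<and>
      (\<forall>u q. fixes_in Q u q \<longrightarrow> length (wd Q) \<le> length u)"
    unfolding shortest_def .
  \<comment> \<open>Vertices of the cycle. The walk starts at \<open>pt Q\<close> with index
    \<open>length (wd Q)\<close> and closes up there with index 0.\<close>
  define pos where "pos Q i = wact (drop i (wd Q)) (pt Q)" for Q i
  have pos_in: "pos Q i \<in> Q" if "Q \<in> range orbit" for Q i
  proof -
    have "set (drop i (wd Q)) \<subseteq> L"
      using D[OF that] set_drop_subset[of i "wd Q"] unfolding rword_def by blast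
    moreover have "Q = orbit (pt Q)" using D[OF that] that orbit_eq by auto
    ultimately show ?thesis unfolding pos_def using wact_in_orbit orbit_refl by metis
  qed
  have pos_0: "pos Q 0 = pos Q (length (wd Q))" if "Q \<in> range orbit" for Q
    using D[OF that] by (simp add: pos_def)
  have pos_Suc: "act (wd Q ! i) (pos Q (Suc i)) = pos Q i" if "i < length (wd Q)" for Q i
    using Cons_nth_drop_Suc[OF that] by (metis pos_def wact_simps(2))
  \<comment> \<open>A repeated vertex would cut out a shorter nonempty reduced word with a fixed
    point in the same orbit.\<close>
  have subword: "False" if Q: "Q \<in> range orbit" and ij: "i < j" "j \<le> length (wd Q)" "i > 0 \<or> j < length (wd Q)"
    and eq: "pos Q i = pos Q j" for Q i j
  proof -
    define u where "u = take (j - i) (drop i (wd Q))"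
    have u: "drop i (wd Q) = u @ drop j (wd Q)"
      unfolding u_def using ij append_take_drop_id[of "j - i" "drop i (wd Q)"] by simp
    have "rword (take i (wd Q) @ drop i (wd Q))" using D[OF Q] by simp
    then have "rword u" unfolding u by (simp add: rword_append)
    moreover have "length u = j - i" using ij by (simp add: u_def)
    moreover have "wact u (pos Q j) = pos Q j" using eq u by (simp add: pos_def)
    ultimately have "fixes_in Q u (pos Q j)" using ij pos_in[OF Q] by (auto simp: fixes_in_def)
    then show False using D[OF Q] ij \<open>length u = j - i\<close> by fastforce
  qed
  \<comment> \<open>Otherwise deleting both end letters, a conjugation, would give a shorter word
    with a fixed point in the orbit.\<close>
  have cyc_red: "last (wd Q) \<noteq> linv (hd (wd Q))" if Q: "Q \<in> range orbit" and ne: "wd Q \<noteq> []" for Q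
  proof
    assume eq: "last (wd Q) = linv (hd (wd Q))"
    define s where "s = hd (wd Q)"
    have "tl (wd Q) \<noteq> []" using eq ne by (cases "wd Q") auto
    then obtain v where v: "wd Q = s # v @ [linv s]"
      using ne eq unfolding s_def by (metis append_butlast_last_id last_tl list.collapse)
    have rv: "rword v" "v \<noteq> []" "linv s \<in> L"
      using D[OF Q] v by (auto simp: rword_Cons rword_append)
    moreover have "wact v (act (linv s) (pt Q)) = act (linv s) (pt Q)"
      using D[OF Q] v by (simp add: act_eq_iff)
    moreover have "act (linv s) (pt Q) \<in> Q"
      using wact_in_orbit[of "pt Q" "pt Q" "[linv s]"] D[OF Q] Q orbit_eq rv by fastforce
    ultimately have "fixes_in Q v (act (linv s) (pt Q))" by (auto simp: fixes_in_def)
    then have "length (wd Q) \<le> length v" using D[OF Q] by blast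
    then show False using v by simp
  qed
  define Os where "Os = orbit ` X"
  have Os: "Q \<in> range orbit" if "Q \<in> Os" for Q using that by (auto simp: Os_def)
  define C where "C = {pos Q i | Q i. Q \<in> Os \<and> i \<le> length (wd Q)}"
  define cyc where "cyc b s \<longleftrightarrow> (\<exists>Q\<in>Os. \<exists>i<length (wd Q).
    (b = pos Q (Suc i) \<and> s = wd Q ! i) \<or> (b = pos Q i \<and> s = linv (wd Q ! i)))" for b s
  have same: "Q = Q'" if "Q \<in> Os" "Q' \<in> Os" "y \<in> Q" "y \<in> Q'" for Q Q' y
  proof -
    have "orbit y = R" if "R \<in> Os" "y \<in> R" for R
      using that orbit_eq unfolding Os_def by blast
    then show ?thesis using that by metis
  qed
  have OX: "Q \<subseteq> X" if "Q \<in> Os" for Q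
    using that wact_in[of X] inv by (auto simp: Os_def orbit_def)
  \<comment> \<open>A cyclic rotation of \<open>wd Q\<close>: once around the cycle from any of its
    vertices, using cycle edges at both ends.\<close>
  have loop: "\<exists>W. rword W \<and> W \<noteq> [] \<and> wact W b = b \<and> cyc b (last W) \<and> cyc b (linv (hd W))"
    if Q: "Q \<in> Os" and wd: "wd Q \<noteq> []" and b: "b = pos Q i" "i \<le> length (wd Q)" for b Q i
  proof -
    define l where "l = length (wd Q)"
    have l: "l > 0" using wd by (simp add: l_def)
    obtain i where i: "i < l" "b = pos Q i"
    proof (cases "i = l")
      case True
      then show ?thesis using that[of 0] l b pos_0[OF Os[OF Q]] l_def by auto
    next
      case False
      then show ?thesis using that[of i] b l_def by auto
    qed
    define W where "W = drop i (wd Q) @ take i (wd Q)"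
    have "wact (take i (wd Q)) b = pt Q"
      using i D[OF Os[OF Q]] wact_simps(3)[of "take i (wd Q)" "drop i (wd Q)" "pt Q"]
      by (simp add: pos_def)
    then have "wact W b = b" by (simp add: W_def i pos_def)
    moreover have "hd W = wd Q ! i"
      using i by (simp add: W_def hd_append hd_drop_conv_nth l_def)
    moreover have last: "last W = (if i = 0 then wd Q ! (l - 1) else wd Q ! (i - 1))"
      using i wd by (auto simp: W_def last_append last_conv_nth l_def min_def)
    moreover have "cyc b (wd Q ! (i - 1))" if "i > 0"
      unfolding cyc_def using Q i that l_def by (intro bexI[of _ Q] exI[of _ "i - 1"]) auto
    moreover have "cyc b (wd Q ! (l - 1))" if "i = 0"
      unfolding cyc_def using Q i that l_def l pos_0[OF Os[OF Q]] by (intro bexI[of _ Q] exI[of _ "l - 1"]) auto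
    moreover have "cyc b (linv (wd Q ! i))"
      unfolding cyc_def using Q i l_def by (intro bexI[of _ Q] exI[of _ i]) auto
    moreover have "rword W"
    proof -
      have "rword (take i (wd Q) @ drop i (wd Q))" using D[OF Os[OF Q]] by simp
      then have "rword (take i (wd Q))" "rword (drop i (wd Q))" by (auto simp only: rword_append)
      moreover have "last (drop i (wd Q)) \<noteq> linv (hd (take i (wd Q)))" if "i > 0"
        using cyc_red[OF Os[OF Q] wd] i that by (simp add: l_def)
      ultimately show ?thesis by (auto simp: W_def rword_append)
    qed
    moreover have "W \<noteq> []" using i by (simp add: W_def l_def)
    ultimately show ?thesis by (intro exI[of _ W]) auto
  qed
  have cod: "coded X C cyc"
  proof (rule codedI)
    show "act s x \<in> X" if "x \<in> X" "s \<in> L" for x s using inv that .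
    show "C \<subseteq> X"
    proof
      fix b assume "b \<in> C"
      then obtain Q i where "Q \<in> Os" "b = pos Q i" by (auto simp: C_def)
      then show "b \<in> X" using pos_in[OF Os, of Q i] OX[of Q] by auto
    qed
    show "\<exists>b\<in>C. \<exists>w. set w \<subseteq> L \<and> x = wact w b" if "x \<in> X" for x
    proof -
      have Q: "orbit x \<in> Os" using that by (simp add: Os_def)
      then have "pt (orbit x) \<in> orbit x" using D[OF Os[OF Q]] by blast
      then have "x \<in> orbit (pt (orbit x))" by (rule orbit_sym)
      moreover have "pt (orbit x) \<in> C"
        unfolding C_def using Q by (intro CollectI exI[of _ "orbit x"] exI[of _ "length (wd (orbit x))"]) (auto simp: pos_def)
      ultimately show ?thesis by (auto simp: orbit_def)
    qed
    show "act s b \<in> C \<and> cyc (act s b) (linv s)" if "cyc b s" for b s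
    proof -
      obtain Q i where Q: "Q \<in> Os" "i < length (wd Q)"
        "(b = pos Q (Suc i) \<and> s = wd Q ! i) \<or> (b = pos Q i \<and> s = linv (wd Q ! i))"
        using \<open>cyc b s\<close> by (auto simp: cyc_def)
      from Q(3) show ?thesis
      proof
        assume b: "b = pos Q (Suc i) \<and> s = wd Q ! i"
        then have "act s b = pos Q i" using pos_Suc Q by simp
        moreover have "pos Q i \<in> C"
          unfolding C_def using Q(1,2) by (intro CollectI exI[of _ Q] exI[of _ i]) simp
        moreover have "cyc (pos Q i) (linv (wd Q ! i))"
          unfolding cyc_def using Q(1,2) by (intro bexI[of _ Q] exI[of _ i]) auto
        ultimately show ?thesis using b by simp
      next
        assume b: "b = pos Q i \<and> s = linv (wd Q ! i)"
        then have "act s b = pos Q (Suc i)" using pos_Suc Q by (metis act_linv)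
        moreover have "pos Q (Suc i) \<in> C"
          unfolding C_def using Q(1,2) by (intro CollectI exI[of _ Q] exI[of _ "Suc i"]) simp
        moreover have "cyc (pos Q (Suc i)) (wd Q ! i)"
          unfolding cyc_def using Q(1,2) by (intro bexI[of _ Q] exI[of _ i]) auto
        ultimately show ?thesis using b by simp
      qed
    qed
  next
    fix b \<beta>
    assume off: "offw C cyc b \<beta>" and ne: "\<beta> \<noteq> []" and ret: "wact \<beta> b \<in> C"
      and ncyc: "\<not> cyc (wact \<beta> b) (linv (hd \<beta>))"
    obtain Q i where Q: "Q \<in> Os" "i \<le> length (wd Q)" "b = pos Q i" using off by (auto simp: offw_def C_def)
    obtain Q' j where Q': "Q' \<in> Os" "j \<le> length (wd Q')" "wact \<beta> b = pos Q' j" using ret by (auto simp: C_def)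
    have "b \<in> Q" using pos_in Q Os by auto
    moreover from this have "wact \<beta> b \<in> Q"
      using wact_in_orbit[of b b \<beta>] off Q(1) orbit_eq by (auto simp: offw_def rword_def Os_def)
    ultimately have OO: "Q' = Q" using same[OF Q'(1) Q(1)] pos_in[OF Os[OF Q'(1)], of j] Q'(3) by simp
    show False
    proof (cases "wd Q = []")
      case True
      then have "fixes_in Q \<beta> b"
        using Q Q' OO off ne \<open>b \<in> Q\<close> by (auto simp: fixes_in_def offw_def)
      then show False using D[OF Os[OF Q(1)]] True by blast
    next
      case False
      obtain W where W: "rword W" "W \<noteq> []" "wact W b = b" "cyc b (last W)" "cyc b (linv (hd W))"
        using loop[OF Q(1) False Q(3,2)] by blast
      obtain W' where W': "rword W'" "W' \<noteq> []" "wact W' (wact \<beta> b) = wact \<beta> b"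
        "cyc (wact \<beta> b) (last W')" "cyc (wact \<beta> b) (linv (hd W'))"
        using loop[OF Q(1) False _ , of "wact \<beta> b" j] Q' OO by auto
      have nc: "\<not> cyc b (last \<beta>)" "rword \<beta>" using off ne by (auto simp: offw_def)
      \<comment> \<open>Both \<open>W\<close> and \<open>Y\<close> fix \<open>b\<close>:
        \<open>W\<close> runs around the cycle, while \<open>Y\<close> follows
        \<open>\<beta>\<close>, runs around the cycle at its other end and returns. Their commutator
        \<open>Z\<close> is reduced because \<open>\<beta>\<close> starts and ends with edges off
        the cycle, whereas \<open>W\<close> and \<open>W'\<close> start and end with cycle
        edges.\<close>
      define Y where "Y = winv \<beta> @ W' @ \<beta>"
      define Z where "Z = winv W @ winv Y @ W @ Y"
      have ne': "last \<beta> \<noteq> linv (hd W)" "last W \<noteq> last \<beta>" "linv (hd \<beta>) \<noteq> last W'" "hd W' \<noteq> hd \<beta>"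
        "last W' \<noteq> linv (hd \<beta>)" "linv (hd W) \<noteq> last \<beta>"
        using nc W W' ncyc by auto
      have "rword Z"
        unfolding Z_def Y_def using ne' W(1,2) W'(1,2) nc(2) ne
        by (auto simp: rword_append hd_winv last_winv eq_linv_sym)
      moreover have "Z \<noteq> []" using W by (simp add: Z_def)
      ultimately obtain x where x: "x \<in> X" "wact Z x \<noteq> x" using faithful by blast
      have "wact W (wact Y x) = wact Y (wact W x)"
      proof (rule comm[of b])
        show "b \<in> X" using \<open>b \<in> Q\<close> OX Q by blast
        show "set W \<subseteq> L" "set Y \<subseteq> L"
          using W W' nc by (auto simp: rword_def Y_def set_winv)
        show "wact W b = b" "wact Y b = b" using W W' by (auto simp: Y_def)
      qed (fact x)
      then have "wact Z x = x" unfolding Z_def by (simp only: wact_simps wact_winv)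
      then show False using x by simp
    qed
  qed
  have "\<exists>e. e (length (wd Q)) = e 0 \<and> (\<forall>i\<le>length (wd Q). e i < n) \<and>
    (\<forall>i<length (wd Q). rel (wd Q ! i) (e (Suc i)) (e i))" if "Q \<in> Os" for Q
  proof -
    have "\<exists>c<n. relw (wd Q) c c"
    proof (cases "wd Q = []")
      case True
      then show ?thesis using n_pos by (intro exI[of _ 0]) simp
    next
      case False
      then show ?thesis using closed[of "wd Q"] D[OF Os[OF that]] by (auto simp: rword_def)
    qed
    then obtain c where "c < n" "relw (wd Q) c c" by blast
    from relw_path[OF this(2,1,1)] show ?thesis by metis
  qed
  then obtain e where e: "\<And>Q. Q \<in> Os \<Longrightarrow> e Q (length (wd Q)) = e Q 0 \<and> (\<forall>i\<le>length (wd Q). e Q i < n) \<and>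
    (\<forall>i<length (wd Q). rel (wd Q ! i) (e Q (Suc i)) (e Q i))" by metis
  \<comment> \<open>By minimality only the indices 0 and \<open>length (wd Q)\<close> can share a
    vertex, and there the closed coloring agrees.\<close>
  have e_eq: "e Q i = e Q j" if "Q \<in> Os" "i \<le> length (wd Q)" "j \<le> length (wd Q)" "pos Q i = pos Q j" for Q i j
    using that
  proof (induction i j rule: linorder_wlog)
    case (le i j)
    consider "i = j" | "i < j" "i > 0 \<or> j < length (wd Q)" | "i = 0" "j = length (wd Q)"
      using le by linarith
    then show ?case
      using subword[OF Os[of Q], of i j] e[of Q] le by cases auto
  qed auto
  define \<kappa> where "\<kappa> b = e (orbit b) (SOME i. i \<le> length (wd (orbit b)) \<and> b = pos (orbit b) i)" for b
  have \<kappa>: "\<kappa> (pos Q i) = e Q i" if "Q \<in> Os" "i \<le> length (wd Q)" for Q i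
  proof -
    have Q: "orbit (pos Q i) = Q"
      using pos_in[OF Os[OF that(1)], of i] that orbit_eq by (auto simp: Os_def)
    define k where "k = (SOME k. k \<le> length (wd Q) \<and> pos Q i = pos Q k)"
    have k: "k \<le> length (wd Q) \<and> pos Q i = pos Q k"
      unfolding k_def by (rule someI[of _ i]) (use that in auto)
    have "\<kappa> (pos Q i) = e Q k" by (simp only: \<kappa>_def Q k_def)
    also have "\<dots> = e Q i" using e_eq[of Q i k] that k by simp
    finally show ?thesis .
  qed
  have "\<exists>x. valid X x \<and> (\<forall>b w. offw C cyc b w \<longrightarrow> True)"
  proof (rule coded_coloring[OF cod, where \<kappa> = \<kappa> and good = "\<lambda>_ _ _. True"])
    show "\<kappa> b < n \<and> True" if "b \<in> C" for b
      using that \<kappa> e by (auto simp: C_def)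
    show "rel s (\<kappa> b) (\<kappa> (act s b))" if "cyc b s" for b s
    proof -
      obtain Q i where Q: "Q \<in> Os" "i < length (wd Q)"
        "(b = pos Q (Suc i) \<and> s = wd Q ! i) \<or> (b = pos Q i \<and> s = linv (wd Q ! i))"
        using \<open>cyc b s\<close> by (auto simp: cyc_def)
      have r: "rel (wd Q ! i) (\<kappa> (pos Q (Suc i))) (\<kappa> (pos Q i))"
        using \<kappa> e Q by auto
      from Q(3) show ?thesis
      proof
        assume "b = pos Q (Suc i) \<and> s = wd Q ! i"
        then show ?thesis using r pos_Suc Q by simp
      next
        assume b: "b = pos Q i \<and> s = linv (wd Q ! i)"
        then have "act s b = pos Q (Suc i)" using pos_Suc Q by (metis act_linv)
        then show ?thesis using r b rel_linv by simp
      qed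
    qed
    show "\<exists>d<n. rel s c d \<and> True" if "offw C cyc b (s # w)" "c < n" for b w s c
      using rel_total that by (auto simp: offw_def rword_def)
  qed
  then show ?thesis by blast
qed

end

section \<open>Combinatorics of a congruence system\<close>

locale congruences =
  fixes n :: nat and E :: "(nat set \<times> nat set) set"
  assumes sys: "congruence_system n E" and ncomp: "non_complementing n E"
    and nexp: "non_expanding n E"
begin

abbreviation "P \<equiv> proper_subsets {..<n}"
abbreviation co :: "nat set \<Rightarrow> nat set" where "co U \<equiv> {..<n} - U"

lemma E_P: "(U, V) \<in> E \<Longrightarrow> U \<in> P" "(U, V) \<in> E \<Longrightarrow> V \<in> P"
  using sys by (auto simp: congruence_system_def equiv_def refl_on_def)

lemma E_refl: "U \<in> P \<Longrightarrow> (U, U) \<in> E"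
  using sys by (auto simp: congruence_system_def equiv_def refl_on_def)

lemma E_sym: "(U, V) \<in> E \<Longrightarrow> (V, U) \<in> E"
  using sys by (auto simp: congruence_system_def equiv_def sym_def)

lemma E_trans: "(U, V) \<in> E \<Longrightarrow> (V, W) \<in> E \<Longrightarrow> (U, W) \<in> E"
  using sys unfolding congruence_system_def equiv_def trans_def by blast

lemma E_co: "(U, V) \<in> E \<Longrightarrow> (co U, co V) \<in> E"
  using sys by (auto simp: congruence_system_def)

lemma E_co_neq: "(U, co U) \<notin> E"
  using ncomp E_P by (auto simp: non_complementing_def)

lemma P_D: "U \<in> P \<Longrightarrow> U \<subseteq> {..<n}" "U \<in> P \<Longrightarrow> U \<noteq> {}" "U \<in> P \<Longrightarrow> co U \<noteq> {}"
  by (auto simp: proper_subsets_def)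

lemma co_P: "U \<in> P \<Longrightarrow> co U \<in> P"
  by (auto simp: proper_subsets_def)

lemma co_co: "U \<in> P \<Longrightarrow> co (co U) = U"
  by (auto simp: proper_subsets_def)

lemma finite_P: "finite P"
  by (rule finite_subset[of _ "Pow {..<n}"]) (auto simp: proper_subsets_def)

section \<open>Representatives, generators and the color rule\<close>

definition joint_class :: "nat set \<Rightarrow> nat set set" where
  "joint_class U = E `` {U} \<union> E `` {co U}"

text \<open>The choice depends only on the set \<open>joint_class U\<close>, so it is constant on
  classes and unchanged by complementation.\<close>

definition rho :: "nat set \<Rightarrow> nat set" where
  "rho U = (SOME R. R \<in> joint_class U)"

lemma joint_class_cong: "(U, V) \<in> E \<Longrightarrow> joint_class U = joint_class V"
proof -
  assume UV: "(U, V) \<in> E"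
  have "E `` {U} = E `` {V}" if "(U, V) \<in> E" for U V
    using that E_trans E_sym by blast
  from this[OF UV] this[OF E_co[OF UV]] show ?thesis by (simp only: joint_class_def)
qed

lemma joint_class_co: "U \<in> P \<Longrightarrow> joint_class (co U) = joint_class U"
  by (simp add: joint_class_def co_co Un_commute)

lemma rho_cong: "(U, V) \<in> E \<Longrightarrow> rho U = rho V"
  by (simp add: rho_def joint_class_cong)

lemma rho_co: "U \<in> P \<Longrightarrow> rho (co U) = rho U"
  by (simp add: rho_def joint_class_co)

lemma rho_cases: "U \<in> P \<Longrightarrow> (U, rho U) \<in> E \<or> (co U, rho U) \<in> E"
proof -
  assume "U \<in> P"
  then have "U \<in> joint_class U" using E_refl by (auto simp: joint_class_def)
  then have "rho U \<in> joint_class U" unfolding rho_def by (rule someI[of "\<lambda>R. R \<in> joint_class U"])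
  then show ?thesis by (auto simp: joint_class_def)
qed

text \<open>
  Every class, up to complementation, gets a representative \<open>rho U\<close> and one generator for each
  further member. This star shape ensures that along a reduced word no two consecutive
  junctions are trivial.
\<close>

definition gens :: "nat set set" where
  "gens = {V \<in> P. (V, rho V) \<in> E \<and> V \<noteq> rho V}"

text \<open>Finite sets of colors are coded by naturals, so that generators can index the rotations
  directly.\<close>

definition letters :: "(nat \<times> bool) set" where
  "letters = {s. set_decode (fst s) \<in> gens}"

text \<open>Source (\<open>dm\<close>) and target (\<open>rn\<close>) of a letter: with sign
  \<open>True\<close> it leads from the representative to the generator set, with
  \<open>False\<close> back.\<close>

definition dm :: "nat \<times> bool \<Rightarrow> nat set" where
  "dm s = (if snd s then rho (set_decode (fst s)) else set_decode (fst s))"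

definition rn :: "nat \<times> bool \<Rightarrow> nat set" where
  "rn s = (if snd s then set_decode (fst s) else rho (set_decode (fst s)))"

text \<open>The rule that makes the rotation of \<open>s\<close> carry the union of the pieces in
  \<open>dm s\<close> onto the union of those in \<open>rn s\<close>.\<close>

definition rel :: "nat \<times> bool \<Rightarrow> nat \<Rightarrow> nat \<Rightarrow> bool" where
  "rel s c d \<longleftrightarrow> (c \<in> dm s \<longleftrightarrow> d \<in> rn s)"

lemma linv_letters: "linv s \<in> letters \<longleftrightarrow> s \<in> letters"
  by (simp add: letters_def)

lemma finite_letters: "finite letters"
proof -
  have "fst ` letters \<subseteq> set_encode ` gens"
  proof
    fix k assume "k \<in> fst ` letters"
    then have "set_decode k \<in> gens" by (auto simp: letters_def)
    then show "k \<in> set_encode ` gens" by (metis imageI set_decode_inverse)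
  qed
  moreover have "finite gens" using finite_P by (simp add: gens_def)
  ultimately have "finite (fst ` letters)" by (metis finite_imageI finite_subset)
  then have "finite (fst ` letters \<times> (UNIV :: bool set))" by simp
  then show ?thesis by (rule rev_finite_subset) force
qed

lemma rel_linv: "rel (linv s) d c \<longleftrightarrow> rel s c d"
  by (auto simp: rel_def linv_def dm_def rn_def)

lemma dm_rn: "s \<in> letters \<Longrightarrow> (dm s, rn s) \<in> E"
  using E_sym by (auto simp: letters_def gens_def dm_def rn_def)

lemma rel_total:
  assumes "s \<in> letters" "c < n"
  shows "\<exists>d<n. rel s c d"
proof -
  have "rn s \<in> P" using dm_rn[OF assms(1)] E_P by blast
  then show ?thesis using P_D[of "rn s"] by (cases "c \<in> dm s") (auto simp: rel_def)
qed

text \<open>A set other than its representative is an end of only one generator, so without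
  backtracking a trivial junction can only occur at a representative, entered by a negative letter
  and left by a positive one. Non-complementing rules out coincidences up to complement. Two
  consecutive junctions thus cannot both be trivial.\<close>

lemma trivial_junction:
  assumes L: "s \<in> letters" "t \<in> letters" and ne: "t \<noteq> linv s"
    and eq: "rn s = dm t \<or> rn s = co (dm t)"
  shows "\<not> snd s \<and> snd t"
proof -
  define V where "V = set_decode (fst s)"
  define W where "W = set_decode (fst t)"
  have V: "V \<in> P" "(V, rho V) \<in> E" "V \<noteq> rho V" and W: "W \<in> P" "(W, rho W) \<in> E" "W \<noteq> rho W"
    using L by (auto simp: letters_def gens_def V_def W_def)
  have no: "X \<noteq> rho Y" "X \<noteq> co (rho Y)"
    if X: "X \<in> P" "(X, rho X) \<in> E" "X \<noteq> rho X" and Y: "(Y, rho Y) \<in> E" for X Y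
  proof -
    have YP: "rho Y \<in> P" "rho (rho Y) = rho Y" using Y E_P rho_cong E_sym by blast+
    show "X \<noteq> rho Y" using YP X by auto
    show "X \<noteq> co (rho Y)"
    proof
      assume "X = co (rho Y)"
      moreover from this have "rho X = rho Y" using rho_co YP by simp
      ultimately show False using X(2) E_co_neq YP E_sym by metis
    qed
  qed
  have no': "X \<noteq> Y \<and> X \<noteq> co Y" if "X \<in> P" "Y \<in> P" "(X, rho X) \<in> E" "(Y, rho Y) \<in> E" "X \<noteq> Y" for X Y
  proof -
    have "X \<noteq> co Y"
    proof
      assume "X = co Y"
      moreover from this have "rho X = rho Y" using rho_co that by simp
      ultimately show False using that E_co_neq E_sym E_trans by metis
    qed
    then show ?thesis using that by simp
  qed
  have flip: "rho V = co W \<Longrightarrow> W = co (rho V)"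
    using co_co W by auto
  have VW: "V \<noteq> W" if "snd s" "\<not> snd t"
  proof
    assume "V = W"
    then have "fst s = fst t" unfolding V_def W_def by (metis set_decode_inverse)
    then show False using ne that by (auto simp: linv_def prod_eq_iff)
  qed
  show ?thesis
  proof (cases "snd s"; cases "snd t")
    assume "snd s" "snd t"
    then show ?thesis using eq no[OF V W(2)] by (auto simp: rn_def dm_def V_def W_def)
  next
    assume "snd s" "\<not> snd t"
    then show ?thesis using eq no'[OF V(1) W(1) V(2) W(2)] VW by (auto simp: rn_def dm_def V_def W_def)
  next
    assume "\<not> snd s" "\<not> snd t"
    then show ?thesis using eq no[OF W V(2)] flip by (auto simp: rn_def dm_def V_def W_def)
  qed auto
qed

section \<open>Depth, mixing and closed words\<close>

definition below :: "nat set rel" where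
  "below = {(A, D). \<exists>B. (A, B) \<in> E \<and> B \<subseteq> D \<and> D \<in> P}"

text \<open>A rank for the preorder "congruent to a subset of", with values between 1 and
  \<open>card P\<close> on proper sets.\<close>

definition depth :: "nat set \<Rightarrow> nat" where
  "depth A = card {Y \<in> P. (Y, A) \<in> below\<^sup>*}"

text \<open>A path in \<open>below\<close> unrolls into a chain as in \<open>non_expanding\<close>,
  and a strict final inclusion would close it.\<close>

lemma no_strict_cycle:
  assumes "(D, A) \<in> below\<^sup>*" "(A, B) \<in> E"
  shows "\<not> B \<subset> D"
proof
  assume BD: "B \<subset> D"
  obtain k f where f: "f 0 = D" "f k = A" "\<And>i. i < k \<Longrightarrow> (f i, f (Suc i)) \<in> below"
    using assms(1) by (auto simp: rtrancl_is_UN_relpow relpow_fun_conv)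
  have "\<forall>i<k. \<exists>B. (f i, B) \<in> E \<and> B \<subseteq> f (Suc i)"
    using f(3) by (auto simp: below_def)
  then obtain g where g: "\<And>i. i < k \<Longrightarrow> (f i, g i) \<in> E \<and> g i \<subseteq> f (Suc i)" by metis
  define W where "W i = (if i < k then g i else B)" for i
  have fW: "(f i, W i) \<in> E" if "i \<le> k" for i
    using that g f(2) assms(2) by (cases "i = k") (auto simp: W_def)
  then have "(\<forall>i\<le>k. f i \<in> P \<and> W i \<in> P \<and> (f i, W i) \<in> E) \<and> (\<forall>i<k. W i \<subseteq> f (Suc i)) \<and> W k \<subset> f 0"
    using E_P[OF fW] fW g BD f(1) by (simp add: W_def)
  then show False using nexp unfolding non_expanding_def by blast
qed

lemma depth_mono: "(A, D) \<in> below \<Longrightarrow> depth A \<le> depth D"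
  unfolding depth_def by (rule card_mono) (use finite_P in \<open>auto intro: rtrancl_into_rtrancl\<close>)

text \<open>Everything below \<open>A\<close> is below \<open>D\<close>, but \<open>D\<close> itself
  is not below \<open>A\<close>: that would be an expanding cycle.\<close>

lemma depth_strict:
  assumes "(A, B) \<in> E" "B \<subset> D" "D \<in> P"
  shows "depth A < depth D"
  unfolding depth_def
proof (rule psubset_card_mono)
  have "(A, D) \<in> below" using assms by (auto simp: below_def)
  moreover have "(D, A) \<notin> below\<^sup>*" using no_strict_cycle assms by blast
  ultimately show "{Y \<in> P. (Y, A) \<in> below\<^sup>*} \<subset> {Y \<in> P. (Y, D) \<in> below\<^sup>*}"
    using assms by (auto intro: rtrancl_into_rtrancl)
qed (use finite_P in auto)

lemma depth_pos: "A \<in> P \<Longrightarrow> depth A \<ge> 1"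
  unfolding depth_def using finite_P card_gt_0_iff[of "{Y \<in> P. (Y, A) \<in> below\<^sup>*}"]
  by (auto simp: Suc_le_eq)

lemma depth_le: "depth A \<le> card P"
  unfolding depth_def by (rule card_mono) (use finite_P in auto)

abbreviation "relw \<equiv> word_rel n rel"

text \<open>A color in \<open>dm t\<close> leads to all of \<open>rn t\<close> and a color outside
  leads to the complement, so colors on both sides together reach everything.\<close>

lemma relw_full_Cons:
  assumes "t \<in> letters" "B \<inter> dm t \<noteq> {}" "B \<inter> co (dm t) \<noteq> {}" "B \<subseteq> {..<n}" "\<And>d. d \<in> B \<Longrightarrow> relw w c d"
  shows "relw (t # w) c d"
proof (cases "d \<in> rn t")
  case True
  obtain e where "e \<in> B" "e \<in> dm t" using assms by blast
  then show ?thesis using assms True by (auto simp: rel_def intro!: exI[of _ e])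
next
  case False
  obtain e where "e \<in> B" "e \<in> co (dm t)" using assms by blast
  then show ?thesis using assms False by (auto simp: rel_def intro!: exI[of _ e])
qed

text \<open>
  The reachable colors form one side of the last letter until some junction splits that side.
  Before that, \<open>depth\<close> grows at every nontrivial junction, so at least at every second one.
\<close>

lemma reach_cases:
  assumes "set w \<subseteq> letters" "reduced w" "w \<noteq> []" "c < n"
  shows "(\<forall>d<n. relw w c d) \<or>
    (\<exists>A B. (A, B) \<in> E \<and> (B = rn (hd w) \<or> B = co (rn (hd w))) \<and> (\<forall>d\<in>B. relw w c d) \<and>
      length w \<le> 2 * depth A + (if snd (hd w) then 1 else 0))"
  using assms
proof (induction w)
  case (Cons t w)
  have t: "t \<in> letters" "(dm t, rn t) \<in> E" "(co (dm t), co (rn t)) \<in> E"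
    using Cons.prems dm_rn E_co by auto
  have tP: "dm t \<in> P" "rn t \<in> P" "co (dm t) \<in> P" using E_P t(2,3) by blast+
  show ?case
  proof (cases "w = []")
    case True
    show ?thesis
    proof (cases "c \<in> dm t")
      case c: True
      then show ?thesis
        using t depth_pos[OF tP(1)] True Cons.prems(4)
        by (intro disjI2 exI[of _ "dm t"] exI[of _ "rn t"]) (auto simp: rel_def)
    next
      case c: False
      then show ?thesis
        using t depth_pos[OF tP(3)] True Cons.prems(4)
        by (intro disjI2 exI[of _ "co (dm t)"] exI[of _ "co (rn t)"]) (auto simp: rel_def)
    qed
  next
    case False
    define s where "s = hd w"
    have s: "s \<in> letters" "t \<noteq> linv s" "reduced w" "set w \<subseteq> letters"
      using Cons.prems False by (auto simp: s_def reduced_Cons)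
    consider (all) "\<forall>d<n. relw w c d"
      | (part) A B where "(A, B) \<in> E" "B = rn s \<or> B = co (rn s)" "\<forall>d\<in>B. relw w c d"
          "length w \<le> 2 * depth A + (if snd s then 1 else 0)"
      using Cons.IH[OF s(4,3) False Cons.prems(4)] unfolding s_def by blast
    then show ?thesis
    proof cases
      case all
      then have "relw (t # w) c d" for d
        using relw_full_Cons[of t "{..<n}" w c d] t P_D[OF tP(1)] by blast
      then have "\<forall>d<n. relw (t # w) c d" by blast
      then show ?thesis by (rule disjI1)
    next
      case part
      have BP: "B \<in> P" using part E_P by blast
      show ?thesis
      proof (cases "B \<inter> dm t \<noteq> {} \<and> B \<inter> co (dm t) \<noteq> {}")
        case True
        then have "relw (t # w) c d" for d
          using relw_full_Cons[of t B w c d] t P_D[OF BP] part(3) by blast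
        then have "\<forall>d<n. relw (t # w) c d" by blast
        then show ?thesis by (rule disjI1)
      next
        case False
        \<comment> \<open>Since \<open>B\<close> is not split, it lies in one side \<open>D\<close>
          of \<open>dm t\<close>; \<open>D'\<close> is the side of \<open>rn t\<close> to which
          \<open>t\<close> leads.\<close>
        define D where "D = (if B \<subseteq> dm t then dm t else co (dm t))"
        define D' where "D' = (if B \<subseteq> dm t then rn t else co (rn t))"
        have D: "B \<subseteq> D" "D = dm t \<and> D' = rn t \<or> D = co (dm t) \<and> D' = co (rn t)"
          using False P_D(1)[OF BP] by (auto simp: D_def D'_def)
        have DE: "(D, D') \<in> E" using D t by blast
        have DP: "D \<in> P" using E_P DE by blast
        obtain e where e: "e \<in> B" using P_D[OF BP] by blast
        have "relw (t # w) c d" if "d \<in> D'" for d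
          using that D e part(3) P_D[OF BP] P_D[OF tP(1)]
          by (auto simp: rel_def intro!: exI[of _ e])
        moreover have "length (t # w) \<le> 2 * depth D + (if snd t then 1 else 0)"
        \<comment> \<open>At a trivial junction depth may stall, but the sign turns from negative to
          positive and the summand 1 pays for the new letter. Otherwise depth rises, adding 2 to the
          bound, enough for the letter and a possible loss of that summand.\<close>
        proof (cases "B = D")
          case True
          have "rn s \<in> P" using dm_rn[OF s(1)] E_P by blast
          then have "rn s = dm t \<or> rn s = co (dm t)"
            using True D(2) part(2) co_co tP by metis
          then have "\<not> snd s \<and> snd t" using trivial_junction s t by blast
          moreover have "depth A \<le> depth D"
            using part(1) D DP by (intro depth_mono) (auto simp: below_def)
          ultimately show ?thesis using part(4) by auto
        next
          case False
          then have "depth A < depth D" using depth_strict part(1) D DP by blast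
          then show ?thesis using part(4) by (auto split: if_splits)
        qed
        ultimately show ?thesis
          using DE D(2) by (intro disjI2 exI[of _ D] exI[of _ D']) auto
      qed
    qed
  qed
qed simp

text \<open>The length is one more than the largest value \<open>2 * card P + 1\<close> of the bound
  in \<open>reach_cases\<close>, so only full reachability remains.\<close>

lemma mixing:
  assumes "set w \<subseteq> letters" "reduced w" "length w = 2 * card P + 2" "c < n" "d < n"
  shows "relw w c d"
proof -
  have "w \<noteq> []" using assms by auto
  have "\<not> length w \<le> 2 * depth A + (if snd (hd w) then 1 else 0)" for A
    using depth_le[of A] assms(3) by auto
  then show ?thesis using reach_cases[OF assms(1,2) \<open>w \<noteq> []\<close> assms(4)] assms(5) by blast
qed

text \<open>A word either splits somewhere, and then a whole set of start colors reaches every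
  color, or it behaves like one congruence from \<open>U\<close> to \<open>V\<close>. In that case
  \<open>V\<close> is not the complement of \<open>U\<close>, so \<open>U\<close> meets
  \<open>V\<close> or their complements meet, and a common color closes the path.\<close>

lemma closed_word:
  assumes "set w \<subseteq> letters" "w \<noteq> []"
  shows "\<exists>c<n. relw w c c"
proof -
  have cases: "(\<exists>A\<in>P. \<forall>c\<in>A. \<forall>d<n. relw w c d) \<or>
    (\<exists>U V. (U, V) \<in> E \<and> (\<forall>c\<in>U. \<forall>d\<in>V. relw w c d) \<and> (\<forall>c\<in>co U. \<forall>d\<in>co V. relw w c d))"
    using assms
  proof (induction w)
    case (Cons t w)
    have t: "t \<in> letters" "(dm t, rn t) \<in> E" "(co (dm t), co (rn t)) \<in> E"
      using Cons.prems dm_rn E_co by auto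
    have tP: "dm t \<in> P" "rn t \<in> P" using E_P t(2) by blast+
    show ?case
    proof (cases "w = []")
      case True
      then show ?thesis
        using t P_D[OF tP(1)] by (intro disjI2 exI[of _ "dm t"] exI[of _ "rn t"]) (auto simp: rel_def)
    next
      case False
      consider (all) A where "A \<in> P" "\<forall>c\<in>A. \<forall>d<n. relw w c d"
        | (part) U V where "(U, V) \<in> E" "\<forall>c\<in>U. \<forall>d\<in>V. relw w c d" "\<forall>c\<in>co U. \<forall>d\<in>co V. relw w c d"
        using Cons.IH False Cons.prems by auto
      then show ?thesis
      proof cases
        case all
        have "relw (t # w) c d" if "c \<in> A" for c d
          using relw_full_Cons[of t "{..<n}" w c d] t P_D[OF tP(1)] all that by blast
        then show ?thesis using all by blast
      next
        case part
        have UV: "U \<in> P" "V \<in> P" using part E_P by blast+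
        \<comment> \<open>If \<open>V\<close> is neither side of \<open>dm t\<close>, then
          \<open>V\<close> or its complement meets both sides, and the corresponding start colors
          reach everything.\<close>
        consider "V = dm t" | "V = co (dm t)"
          | X Y where "X \<in> P" "Y \<in> P" "Y \<inter> dm t \<noteq> {}" "Y \<inter> co (dm t) \<noteq> {}" "\<forall>c\<in>X. \<forall>d\<in>Y. relw w c d"
        proof (cases "(V \<inter> dm t \<noteq> {} \<and> V \<inter> co (dm t) \<noteq> {}) \<or> (co V \<inter> dm t \<noteq> {} \<and> co V \<inter> co (dm t) \<noteq> {})")
          case True
          then show ?thesis
          proof (elim disjE conjE)
            assume "V \<inter> dm t \<noteq> {}" "V \<inter> co (dm t) \<noteq> {}"
            then show ?thesis by (rule that(3)[OF UV _ _ part(2)])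
          next
            assume "co V \<inter> dm t \<noteq> {}" "co V \<inter> co (dm t) \<noteq> {}"
            then show ?thesis by (rule that(3)[OF co_P[OF UV(1)] co_P[OF UV(2)] _ _ part(3)])
          qed
        next
          case False
          note V = P_D(1)[OF UV(2)] and dmt = P_D[OF tP(1)]
          have "V \<subseteq> dm t \<or> V \<inter> dm t = {}" using False V by blast
          moreover have "co V \<subseteq> dm t \<or> co V \<inter> dm t = {}" using False by blast
          ultimately consider "V \<subseteq> dm t" "co V \<subseteq> dm t" | "V \<subseteq> dm t" "co V \<inter> dm t = {}"
            | "V \<inter> dm t = {}" "co V \<subseteq> dm t" | "V \<inter> dm t = {}" "co V \<inter> dm t = {}" by argo
          then show ?thesis
          proof cases
            case 1 then show ?thesis using dmt by auto
          next
            case 2 then have "V = dm t" using dmt V by auto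
            then show ?thesis by (rule that(1))
          next
            case 3 then have "V = co (dm t)" using dmt V by auto
            then show ?thesis by (rule that(2))
          next
            case 4 then show ?thesis using dmt by auto
          qed
        qed
        then show ?thesis
        proof cases
          case 1
          then have "(U, rn t) \<in> E" using part(1) t(2) E_trans by blast
          moreover have "relw (t # w) c d" if cd: "c \<in> U" "d \<in> rn t" for c d
          proof -
            obtain e where e: "e \<in> V" "e < n" using P_D[OF UV(2)] by blast
            then show ?thesis using part(2) cd 1 by (auto simp: rel_def intro!: exI[of _ e])
          qed
          moreover have "relw (t # w) c d" if cd: "c \<in> co U" "d \<in> co (rn t)" for c d
          proof -
            obtain e where e: "e \<in> co V" "e < n" using P_D[OF UV(2)] by blast
            then show ?thesis using part(3) cd 1 by (auto simp: rel_def intro!: exI[of _ e])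
          qed
          ultimately show ?thesis by blast
        next
          case 2
          then have "(U, co (rn t)) \<in> E" using part(1) t(3) E_trans by blast
          moreover have "relw (t # w) c d" if cd: "c \<in> U" "d \<in> co (rn t)" for c d
          proof -
            obtain e where e: "e \<in> V" "e < n" using P_D[OF UV(2)] by blast
            then show ?thesis using part(2) cd 2 by (auto simp: rel_def intro!: exI[of _ e])
          qed
          moreover have "relw (t # w) c d" if cd: "c \<in> co U" "d \<in> co (co (rn t))" for c d
          proof -
            obtain e where e: "e \<in> co V" "e < n" using P_D[OF UV(2)] by blast
            then show ?thesis using part(3) cd 2 by (auto simp: rel_def intro!: exI[of _ e])
          qed
          ultimately show ?thesis by blast
        next
          case 3
          have "relw (t # w) c d" if "c \<in> X" for c d
            using relw_full_Cons[of t Y w c d] t 3 P_D[OF 3(2)] that by blast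
          then show ?thesis using 3 by blast
        qed
      qed
    qed
  qed simp
  then show ?thesis
  proof (elim disjE exE bexE conjE)
    fix A assume "A \<in> P" "\<forall>c\<in>A. \<forall>d<n. relw w c d"
    then show ?thesis using P_D[of A] by blast
  next
    fix U V assume UV: "(U, V) \<in> E" "\<forall>c\<in>U. \<forall>d\<in>V. relw w c d" "\<forall>c\<in>co U. \<forall>d\<in>co V. relw w c d"
    have "V \<noteq> co U" using UV(1) E_co_neq by blast
    then have "U \<inter> V \<noteq> {} \<or> co U \<inter> co V \<noteq> {}"
      using P_D[OF E_P(1)[OF UV(1)]] P_D[OF E_P(2)[OF UV(1)]] by blast
    then show ?thesis using UV(2,3) P_D[OF E_P(1)[OF UV(1)]] by blast
  qed
qed

end

section \<open>Free rotations of the sphere\<close>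

lemma rotation_matrix_transpose_mult:
  fixes Q :: "real^3^3"
  assumes "rotation_matrix Q"
  shows "transpose Q *v (Q *v x) = x" "Q *v (transpose Q *v x) = x"
  using assms by (simp_all add: rotation_matrix_def orthogonal_matrix_def matrix_vector_mul_assoc
      del: transpose_matrix_vector)

lemma rotation_matrix_mult:
  fixes A B :: "real^3^3"
  assumes "rotation_matrix A" "rotation_matrix B"
  shows "rotation_matrix (A ** B)"
  using assms by (simp add: rotation_matrix_def orthogonal_matrix_mul det_mul)

lemma rotation_matrix_one: "rotation_matrix (mat 1 :: real^3^3)"
  by (simp add: rotation_matrix_def orthogonal_matrix_id)

lemma rotation_matrix_transpose:
  fixes A :: "real^3^3"
  assumes "rotation_matrix A"
  shows "rotation_matrix (transpose A)"
  using assms by (simp add: rotation_matrix_def orthogonal_matrix_transpose)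

lemma rotation_matrix_norm:
  fixes Q :: "real^3^3"
  assumes "rotation_matrix Q"
  shows "norm (Q *v x) = norm x"
  using assms orthogonal_transformation_matrix[of "(*v) Q"] orthogonal_transformation_norm
  by (auto simp: rotation_matrix_def)

lemma rotation_matrix_dist:
  fixes Q :: "real^3^3"
  assumes "rotation_matrix Q"
  shows "dist (Q *v x) (Q *v y) = dist x y"
  by (metis assms dist_norm matrix_vector_mult_diff_distrib rotation_matrix_norm)

lemma rotation_matrix_S2:
  fixes Q :: "real^3^3"
  assumes "rotation_matrix Q"
  shows "Q *v x \<in> S2 \<longleftrightarrow> x \<in> S2"
  by (simp add: rotation_matrix_norm[OF assms])

text \<open>In dimension 3, \<open>det (Q - mat 1)\<close> equals its own negative: multiplying by
  the transpose of \<open>Q\<close> turns \<open>Q - mat 1\<close> into the transpose of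
  \<open>mat 1 - Q\<close>.\<close>

lemma rotation_matrix_fixed_point:
  fixes Q :: "real^3^3"
  assumes "rotation_matrix Q"
  obtains x where "x \<in> S2" "Q *v x = x"
proof -
  have neg: "det (mat 1 - Q) = - det (Q - mat 1)"
    by (simp add: det_3 algebra_simps)
  have "transpose Q ** (Q - mat 1) = transpose Q ** Q - transpose Q"
    by (simp add: matrix_eq matrix_vector_mult_diff_rdistrib matrix_vector_mult_diff_distrib
        del: transpose_matrix_vector flip: matrix_vector_mul_assoc)
  also have "\<dots> = transpose (mat 1 - Q)"
    using assms by (simp add: rotation_matrix_def orthogonal_matrix vec_eq_iff transpose_def mat_def)
  finally have "transpose Q ** (Q - mat 1) = transpose (mat 1 - Q)" .
  then have "det (transpose Q) * det (Q - mat 1) = det (mat 1 - Q)"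
    by (metis det_mul det_transpose)
  then have "det (Q - mat 1) = 0"
    using neg assms by (simp add: rotation_matrix_def)
  then have "\<not> invertible (Q - mat 1)" by (simp add: invertible_det_nz)
  then obtain x where x: "x \<noteq> 0" "(Q - mat 1) *v x = 0"
    using matrix_left_invertible_ker[of "Q - mat 1"] invertible_left_inverse by blast
  then have "Q *v x = x" by (simp add: matrix_vector_mult_diff_rdistrib)
  then have "Q *v (x /\<^sub>R norm x) = x /\<^sub>R norm x"
    by (simp add: matrix_vector_mult_scaleR)
  then show thesis using x that[of "x /\<^sub>R norm x"] by simp
qed

text \<open>Conjugation moves the axis to the third coordinate axis, where both matrices are planar
  rotation blocks.\<close>

lemma rotations_about_axis_commute:
  fixes A B :: "real^3^3"
  assumes A: "rotation_matrix A" "A *v p = p" and B: "rotation_matrix B" "B *v p = p" and p: "p \<in> S2"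
  shows "A *v (B *v x) = B *v (A *v x)"
proof -
  obtain R :: "real^3^3" where R: "rotation_matrix R" "R *v axis 3 1 = p"
    using rotation_matrix_exists_basis[of p 3] p by auto
  have form: "M$1$1 = M$2$2 \<and> M$1$2 = - M$2$1 \<and> M$1$3 = 0 \<and> M$2$3 = 0 \<and> M$3$1 = 0 \<and> M$3$2 = 0 \<and> M$3$3 = 1"
    if M: "rotation_matrix M" "M *v axis 3 1 = axis 3 1" for M :: "real^3^3"
  proof -
    have c: "M$1$3 = 0" "M$2$3 = 0" "M$3$3 = 1"
      using M(2) by (auto simp: vec_eq_iff forall_3 matrix_vector_mult_def sum_3 axis_def)
    have "transpose M *v axis 3 1 = axis 3 1"
      using rotation_matrix_transpose_mult(1)[OF M(1), of "axis 3 1"] M(2) by simp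
    then have r: "M$3$1 = 0" "M$3$2 = 0"
      by (auto simp: vec_eq_iff forall_3 matrix_vector_mult_def sum_3 axis_def transpose_def)
    have "transpose M ** M = mat 1" "det M = 1"
      using M(1) by (auto simp: rotation_matrix_def orthogonal_matrix_def)
    then have e: "M$1$1 * M$1$1 + M$2$1 * M$2$1 = 1" "M$1$2 * M$1$2 + M$2$2 * M$2$2 = 1"
      "M$1$1 * M$2$2 - M$1$2 * M$2$1 = 1"
      using r c by (auto simp: vec_eq_iff forall_3 matrix_matrix_mult_def sum_3 transpose_def mat_def det_3)
    \<comment> \<open>The two column norms minus twice the determinant of the block: 1 + 1 - 2 =
      0.\<close>
    have "(M$1$1 - M$2$2)\<^sup>2 + (M$1$2 + M$2$1)\<^sup>2 = 0"
      using e by (simp add: power2_eq_square algebra_simps)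
    then have "M$1$1 - M$2$2 = 0 \<and> M$1$2 + M$2$1 = 0"
      by (simp only: sum_power2_eq_zero_iff)
    then show ?thesis using c r by auto
  qed
  define A' where "A' = transpose R ** A ** R"
  define B' where "B' = transpose R ** B ** R"
  have fixp: "transpose R *v p = axis 3 1"
    using R rotation_matrix_transpose_mult(1) by metis
  have A': "rotation_matrix A'" "A' *v axis 3 1 = axis 3 1"
    using A R fixp by (simp_all add: A'_def rotation_matrix_mult rotation_matrix_transpose flip: matrix_vector_mul_assoc)
  have B': "rotation_matrix B'" "B' *v axis 3 1 = axis 3 1"
    using B R fixp by (simp_all add: B'_def rotation_matrix_mult rotation_matrix_transpose flip: matrix_vector_mul_assoc)
  have "A' ** B' = B' ** A'"
    using form[OF A'] form[OF B']
    by (simp add: vec_eq_iff forall_3 matrix_matrix_mult_def sum_3)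
  then have "A' *v (B' *v (transpose R *v x)) = B' *v (A' *v (transpose R *v x))"
    by (simp add: matrix_vector_mul_assoc)
  moreover have "A' *v y = transpose R *v (A *v (R *v y))" "B' *v y = transpose R *v (B *v (R *v y))" for y
    by (simp_all add: A'_def B'_def flip: matrix_vector_mul_assoc)
  ultimately have "transpose R *v (A *v (B *v x)) = transpose R *v (B *v (A *v x))"
    using rotation_matrix_transpose_mult[OF R(1)] by simp
  then show ?thesis using rotation_matrix_transpose_mult(2)[OF R(1)] by metis
qed

text \<open>By compactness two powers bring \<open>x\<close> close together; the smaller power is an
  isometry and can be cancelled.\<close>

lemma rotation_recurrence:
  fixes Q :: "real^3^3"
  assumes Q: "rotation_matrix Q" and x: "x \<in> S2" and "e > 0"
  obtains m where "m > 0" "dist (((*v) Q ^^ m) x) x < e"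
proof -
  let ?f = "\<lambda>i. ((*v) Q ^^ i) x"
  have "?f i \<in> S2" for i
    using x by (induction i) (auto simp: rotation_matrix_norm[OF Q])
  then obtain l r where r: "strict_mono r" "(?f \<circ> r) \<longlonglongrightarrow> l"
    using compact_sphere[of "0::real^3" 1] unfolding compact_def by meson
  then have "Cauchy (?f \<circ> r)" by (simp add: LIMSEQ_imp_Cauchy)
  then obtain N where N: "\<And>i j. i \<ge> N \<Longrightarrow> j \<ge> N \<Longrightarrow> dist ((?f \<circ> r) i) ((?f \<circ> r) j) < e"
    using \<open>e > 0\<close> unfolding Cauchy_def by meson
  define i where "i = r N"
  define m where "m = r (Suc N) - i"
  have m: "m > 0" "r (Suc N) = i + m"
    using strict_monoD[OF r(1), of N "Suc N"] by (auto simp: m_def i_def)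
  have iso: "dist (((*v) Q ^^ i) y) (((*v) Q ^^ i) z) = dist y z" for y z
    by (induction i) (auto simp: rotation_matrix_dist[OF Q])
  have "dist (((*v) Q ^^ i) (?f m)) (((*v) Q ^^ i) x) < e"
    using N[of "Suc N" N] m by (simp add: funpow_add i_def)
  then show thesis using that m iso by simp
qed

text \<open>
  \<open>(1 + t\<^sup>2)\<close> times the rotation about the axis \<open>(a, b, 0)\<close> with \<open>t\<close> the tangent of half the
  angle. At \<open>t = \<i>\<close> it degenerates to a matrix of rank one.
\<close>

definition half_tan_matrix :: "'a::comm_ring_1 \<Rightarrow> 'a \<Rightarrow> 'a \<Rightarrow> 'a^3^3" where
  "half_tan_matrix a b t = vector
     [vector [1 - t^2 + 2 * t^2 * a^2, 2 * t^2 * a * b, 2 * t * b],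
      vector [2 * t^2 * a * b, 1 - t^2 + 2 * t^2 * b^2, - 2 * t * a],
      vector [- 2 * t * b, 2 * t * a, 1 - t^2]]"

lemma half_tan_matrix_mult:
  fixes a b t :: real
  assumes "a^2 + b^2 = 1"
  shows "half_tan_matrix a b (- t) ** half_tan_matrix a b t = (1 + t^2)^2 *\<^sub>R mat 1"
proof -
  have b: "b * b = 1 - a * a" using assms by (simp add: power2_eq_square)
  have b': "b * (b * x) = x - a * (a * x)" for x
    using b by (metis (no_types, opaque_lifting) left_diff_distrib mult.assoc mult_1)
  show ?thesis
    by (simp add: vec_eq_iff forall_3 matrix_matrix_mult_def sum_3 half_tan_matrix_def mat_def power2_eq_square)
      (simp add: algebra_simps b b')
qed

lemma transpose_half_tan_matrix: "transpose (half_tan_matrix a b t) = half_tan_matrix a b (- t)"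
  by (simp add: vec_eq_iff forall_3 transpose_def half_tan_matrix_def)

lemma det_half_tan_matrix:
  fixes a b t :: real
  assumes "a^2 + b^2 = 1"
  shows "det (half_tan_matrix a b t) = (1 + t^2)^3"
proof -
  have b: "b * b = 1 - a * a" using assms by (simp add: power2_eq_square)
  have b': "b * (b * x) = x - a * (a * x)" for x
    using b by (metis (no_types, opaque_lifting) left_diff_distrib mult.assoc mult_1)
  show ?thesis
    by (simp add: det_3 half_tan_matrix_def power2_eq_square power3_eq_cube)
      (simp add: algebra_simps b b')
qed

lemma rotation_half_tan_matrix:
  fixes a b t :: real
  assumes "a^2 + b^2 = 1"
  shows "rotation_matrix ((1 / (1 + t^2)) *\<^sub>R half_tan_matrix a b t)" (is "rotation_matrix ?Q")
proof -
  have p: "1 + t^2 > 0" by (simp add: add_pos_nonneg)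
  have tr: "transpose ?Q = (1 / (1 + t^2)) *\<^sub>R half_tan_matrix a b (- t)"
    by (simp add: transpose_half_tan_matrix[symmetric]) (simp add: vec_eq_iff transpose_def)
  have mul: "(c *\<^sub>R A) ** (d *\<^sub>R B) = (c * d) *\<^sub>R (A ** B)" for c d :: real and A B :: "real^3^3"
    by (simp add: matrix_matrix_mult_def vec_eq_iff sum_distrib_left algebra_simps)
  have "transpose ?Q ** ?Q = mat 1"
    unfolding tr mul half_tan_matrix_mult[OF assms] using p by (simp add: power2_eq_square)
  moreover have "det (c *\<^sub>R A) = c^3 * det A" for c and A :: "real^3^3"
    by (simp add: det_3 power3_eq_cube algebra_simps)
  then have "det ?Q = 1"
    using p by (simp add: det_half_tan_matrix[OF assms] power_divide)
  ultimately show ?thesis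
    by (simp add: rotation_matrix_def orthogonal_matrix)
qed

section \<open>Free words of rotations by degeneration to rank one\<close>

definition letter_matrix :: "(nat \<Rightarrow> real^3^3) \<Rightarrow> nat \<times> bool \<Rightarrow> real^3^3" where
  "letter_matrix g s = (if snd s then g (fst s) else transpose (g (fst s)))"

definition word_matrix :: "('l \<Rightarrow> 'a::semiring_1^3^3) \<Rightarrow> 'l list \<Rightarrow> 'a^3^3" where
  "word_matrix m w = foldr (\<lambda>l A. m l ** A) w (mat 1)"

lemma word_matrix_simps [simp]:
  "word_matrix m [] = mat 1" "word_matrix m (l # w) = m l ** word_matrix m w"
  by (simp_all add: word_matrix_def)


text \<open>The rank-one matrix \<open>k p q^T\<close>. In a product the inner vectors are paired
  bilinearly, without conjugation.\<close>

definition outer :: "complex \<Rightarrow> complex^3 \<Rightarrow> complex^3 \<Rightarrow> complex^3^3" where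
  "outer k p q = (\<chi> i j. k * p$i * q$j)"

lemma outer_mult: "outer k p q ** outer l r t = outer (k * l * (\<Sum>i\<in>UNIV. q$i * r$i)) p t"
  by (simp add: vec_eq_iff forall_3 outer_def matrix_matrix_mult_def sum_3 algebra_simps)

definition poly_entries :: "(complex \<Rightarrow> complex^3^3) \<Rightarrow> bool" where
  "poly_entries A \<longleftrightarrow> (\<forall>i j. \<exists>p. \<forall>t. A t $ i $ j = poly p t)"

lemma poly_entries_mult:
  assumes "poly_entries A" "poly_entries B"
  shows "poly_entries (\<lambda>t. A t ** B t)"
proof -
  obtain p where p: "\<And>i j t. A t $ i $ j = poly (p i j) t"
    using assms(1) unfolding poly_entries_def by metis
  obtain q where q: "\<And>i j t. B t $ i $ j = poly (q i j) t"
    using assms(2) unfolding poly_entries_def by metis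
  show ?thesis
    unfolding poly_entries_def
  proof (intro allI)
    fix i j
    show "\<exists>r. \<forall>t. (A t ** B t) $ i $ j = poly r t"
      by (rule exI[of _ "\<Sum>k\<in>UNIV. p i k * q k j"])
        (simp add: matrix_matrix_mult_def p q poly_sum)
  qed
qed

lemma poly_entries_half_tan_matrix: "poly_entries (half_tan_matrix a b)"
  unfolding poly_entries_def forall_3 half_tan_matrix_def
  apply (simp add: power2_eq_square)
  apply (intro conjI)
  apply (rule exI[of _ "[:1, 0, 2 * a * a - 1:]"], simp add: algebra_simps)
  apply (rule exI[of _ "[:0, 0, 2 * a * b:]"], simp add: algebra_simps)
  apply (rule exI[of _ "[:0, 2 * b:]"], simp add: algebra_simps)
  apply (rule exI[of _ "[:0, 0, 2 * a * b:]"], simp add: algebra_simps)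
  apply (rule exI[of _ "[:1, 0, 2 * b * b - 1:]"], simp add: algebra_simps)
  apply (rule exI[of _ "[:0, - 2 * a:]"], simp add: algebra_simps)
  apply (rule exI[of _ "[:0, - 2 * b:]"], simp add: algebra_simps)
  apply (rule exI[of _ "[:0, 2 * a:]"], simp add: algebra_simps)
  apply (rule exI[of _ "[:1, 0, - 1:]"], simp add: algebra_simps)
  done

lemma poly_entries_compose_uminus:
  assumes "poly_entries A"
  shows "poly_entries (\<lambda>t. A (- t))"
  unfolding poly_entries_def
proof (intro allI)
  fix i j
  obtain p where "\<And>t. A t $ i $ j = poly p t" using assms unfolding poly_entries_def by metis
  then show "\<exists>p. \<forall>t. A (- t) $ i $ j = poly p t"
    by (intro exI[of _ "p \<circ>\<^sub>p [:0, -1:]"]) (simp add: poly_pcompose)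
qed

text \<open>Distinct angles in the interval from 0 to 1: differences stay below pi, so distinct axes
  are neither equal nor opposite.\<close>

definition axis_angle :: "nat \<Rightarrow> real" where
  "axis_angle k = 1 / (real k + 1)"

lemma cos_axis_angle_diff:
  "cos (axis_angle k - axis_angle l) > -1" "k \<noteq> l \<Longrightarrow> cos (axis_angle k - axis_angle l) < 1"
proof -
  define x where "x = \<bar>axis_angle k - axis_angle l\<bar>"
  have "axis_angle j \<in> {0<..1}" for j by (auto simp: axis_angle_def divide_simps)
  from this[of k] this[of l] have x: "0 \<le> x" "x < 1" by (auto simp: x_def)
  have c: "cos (axis_angle k - axis_angle l) = cos x" by (simp add: x_def)
  have "cos pi < cos x"
    using x pi_gt3 by (intro cos_monotone_0_pi) auto
  then show "cos (axis_angle k - axis_angle l) > -1" unfolding c by simp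
  assume "k \<noteq> l"
  then have "x > 0" by (auto simp: x_def axis_angle_def)
  then have "cos x < cos 0"
    using x pi_gt3 by (intro cos_monotone_0_pi) auto
  then show "cos (axis_angle k - axis_angle l) < 1" unfolding c by simp
qed

text \<open>The normalizing factor is dropped to make the entries polynomial in \<open>t\<close>;
  inversion becomes a change of sign of \<open>t\<close>.\<close>

definition complex_letter :: "complex \<Rightarrow> nat \<times> bool \<Rightarrow> complex^3^3" where
  "complex_letter t s = half_tan_matrix (of_real (cos (axis_angle (fst s))))
     (of_real (sin (axis_angle (fst s)))) (if snd s then t else - t)"

text \<open>For \<open>z\<close> a square root of -1 the vector is orthogonal to itself under the
  bilinear form. Such vectors are the two factors of a letter at \<open>t = \<i>\<close>.\<close>

definition isotropic :: "nat \<Rightarrow> complex \<Rightarrow> complex^3" where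
  "isotropic k z = vector [- of_real (sin (axis_angle k)), of_real (cos (axis_angle k)), z]"

definition turn :: "bool \<Rightarrow> complex" where
  "turn b = (if b then \<i> else - \<i>)"

lemma half_tan_matrix_imaginary:
  assumes "z * z = -1" "a * a = 1 - b * b"
  shows "half_tan_matrix a b z = outer 2 (vector [- b, a, z]) (vector [- b, a, - z])"
proof -
  have z: "z^2 = -1" "z * (z * x) = - x" for x
    using assms(1) by (simp_all add: power2_eq_square flip: mult.assoc)
  show ?thesis
    by (simp add: vec_eq_iff forall_3 outer_def half_tan_matrix_def z)
      (simp add: power2_eq_square assms mult.assoc)
qed

lemma complex_letter_ii:
  "complex_letter \<i> s = outer 2 (isotropic (fst s) (turn (snd s))) (isotropic (fst s) (- turn (snd s)))"
proof -
  define x where "x = axis_angle (fst s)"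
  have "cos x * cos x = 1 - sin x * sin x"
    using sin_cos_squared_add[of x] by (simp add: power2_eq_square)
  then have "complex_of_real (cos x) * of_real (cos x) = 1 - of_real (sin x) * of_real (sin x)"
    by (metis of_real_1 of_real_diff of_real_mult)
  moreover have "turn (snd s) * turn (snd s) = -1" by (simp add: turn_def)
  ultimately show ?thesis
    using half_tan_matrix_imaginary
    by (simp add: complex_letter_def isotropic_def x_def turn_def)
qed

text \<open>The pairing is the cosine of the angle between the axes, plus 1 for equal signs and
  minus 1 for opposite ones; it vanishes only for mutually inverse letters.\<close>

lemma isotropic_pairing:
  assumes "s \<noteq> linv t"
  shows "(\<Sum>i\<in>UNIV. isotropic (fst s) (- turn (snd s)) $ i * isotropic (fst t) (turn (snd t)) $ i) \<noteq> 0"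
proof -
  define c where "c = cos (axis_angle (fst s) - axis_angle (fst t))"
  define e :: real where "e = (if snd s = snd t then 1 else -1)"
  have "(\<Sum>i\<in>UNIV. isotropic (fst s) (- turn (snd s)) $ i * isotropic (fst t) (turn (snd t)) $ i)
     = of_real (c + e)"
    by (simp add: sum_3 isotropic_def turn_def c_def e_def cos_diff)
  moreover have "c + e \<noteq> 0"
  proof (cases "snd s = snd t")
    case True
    then show ?thesis using cos_axis_angle_diff(1)[of "fst s" "fst t"] by (simp add: c_def e_def)
  next
    case False
    then have "fst s \<noteq> fst t" using assms by (auto simp: linv_def prod_eq_iff)
    then show ?thesis using cos_axis_angle_diff(2)[of "fst s" "fst t"] False by (simp add: c_def e_def)
  qed
  ultimately show ?thesis by (metis of_real_eq_0_iff)
qed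

lemma complex_word_ii:
  assumes "reduced w" "w \<noteq> []"
  shows "\<exists>k. k \<noteq> 0 \<and> word_matrix (complex_letter \<i>) w =
    outer k (isotropic (fst (hd w)) (turn (snd (hd w)))) (isotropic (fst (last w)) (- turn (snd (last w))))"
  using assms
proof (induction w)
  case (Cons s w)
  show ?case
  proof (cases "w = []")
    case True
    then show ?thesis by (intro exI[of _ 2]) (simp add: complex_letter_ii)
  next
    case False
    then obtain k where k: "k \<noteq> 0" "word_matrix (complex_letter \<i>) w =
      outer k (isotropic (fst (hd w)) (turn (snd (hd w)))) (isotropic (fst (last w)) (- turn (snd (last w))))"
      using Cons by (auto simp: reduced_Cons)
    have "s \<noteq> linv (hd w)" using Cons False by (auto simp: reduced_Cons)
    note ne = isotropic_pairing[OF this]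
    define l where "l = 2 * k * (\<Sum>i\<in>UNIV. isotropic (fst s) (- turn (snd s)) $ i *
          isotropic (fst (hd w)) (turn (snd (hd w))) $ i)"
    have "word_matrix (complex_letter \<i>) (s # w) =
      outer l (isotropic (fst s) (turn (snd s))) (isotropic (fst (last w)) (- turn (snd (last w))))"
      by (simp only: word_matrix_simps k(2) complex_letter_ii[of s] outer_mult l_def)
    moreover have "l \<noteq> 0" using k(1) ne by (simp add: l_def)
    ultimately show ?thesis
      using False by (intro exI[of _ l]) (simp only: last_ConsR list.sel not_False_eq_True simp_thms)
  qed
qed simp

lemma poly_entries_word: "poly_entries (\<lambda>t. word_matrix (complex_letter t) w)"
proof (induction w)
  case Nil
  then show ?case
    unfolding poly_entries_def by (auto intro: exI[of _ "[:c:]" for c])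
next
  case (Cons s w)
  have "poly_entries (\<lambda>t. complex_letter t s)"
    using poly_entries_half_tan_matrix poly_entries_compose_uminus[OF poly_entries_half_tan_matrix]
    unfolding complex_letter_def by (cases "snd s") auto
  then show ?case using Cons poly_entries_mult by simp
qed

definition axis_rotation :: "real \<Rightarrow> nat \<Rightarrow> real^3^3" where
  "axis_rotation t k = (1 / (1 + t^2)) *\<^sub>R half_tan_matrix (cos (axis_angle k)) (sin (axis_angle k)) t"

lemma complex_word_of_real:
  "word_matrix (complex_letter (of_real t)) w =
     (\<chi> i j. of_real ((1 + t^2) ^ length w * word_matrix (letter_matrix (axis_rotation t)) w $ i $ j))"
proof (induction w)
  case Nil
  then show ?case by (simp add: vec_eq_iff mat_def)
next
  case (Cons s w)
  have p: "1 + t^2 \<noteq> 0" by (metis add_pos_nonneg less_irrefl zero_le_power2 zero_less_one)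
  have h: "half_tan_matrix (complex_of_real a) (of_real b) (of_real u) $ i $ j = of_real (half_tan_matrix a b u $ i $ j)"
    for a b u i j
  proof -
    have "\<forall>i j. half_tan_matrix (complex_of_real a) (of_real b) (of_real u) $ i $ j = of_real (half_tan_matrix a b u $ i $ j)"
      by (simp add: forall_3 half_tan_matrix_def)
    then show ?thesis by blast
  qed
  have "letter_matrix (axis_rotation t) s = (1 / (1 + t^2)) *\<^sub>R
    half_tan_matrix (cos (axis_angle (fst s))) (sin (axis_angle (fst s))) (if snd s then t else - t)"
    by (simp add: letter_matrix_def axis_rotation_def flip: transpose_half_tan_matrix)
      (simp add: vec_eq_iff transpose_def)
  then have l: "complex_letter (of_real t) s $ i $ j = of_real ((1 + t^2) * letter_matrix (axis_rotation t) s $ i $ j)" for i j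
    using p h[of _ _ t] h[of _ _ "- t"] by (simp add: complex_letter_def)
  define q where "q = 1 + t^2"
  show ?case
    by (simp add: vec_eq_iff matrix_matrix_mult_def Cons.IH l sum_distrib_left mult_ac flip: q_def)
qed

text \<open>
  If a reduced word were trivial for infinitely many \<open>t\<close>, an entry of its polynomial matrix would
  be a power of \<open>1 + t\<^sup>2\<close>, which vanishes at \<open>\<i>\<close>; but there the word is a nonzero product of
  rank-one matrices.
\<close>

lemma finite_bad_parameters:
  assumes "reduced w" "w \<noteq> []"
  shows "finite {t. word_matrix (letter_matrix (axis_rotation t)) w = mat 1}"
proof -
  \<comment> \<open>The entry 3, 3 is convenient because the third coordinates of the isotropic
    factors are \<open>\<i>\<close> or \<open>- \<i>\<close>, never zero.\<close>
  obtain p where p: "\<And>t. word_matrix (complex_letter t) w $ 3 $ 3 = poly p t"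
    using poly_entries_word[of w] unfolding poly_entries_def by metis
  define r where "r = p - [:1, 0, 1:] ^ length w"
  obtain k where "k \<noteq> 0" "word_matrix (complex_letter \<i>) w =
    outer k (isotropic (fst (hd w)) (turn (snd (hd w)))) (isotropic (fst (last w)) (- turn (snd (last w))))"
    using complex_word_ii[OF assms] by blast
  then have "poly p \<i> \<noteq> 0"
    unfolding p[symmetric] by (simp add: outer_def isotropic_def turn_def)
  moreover have "poly ([:1, 0, 1:] ^ length w) \<i> = 0"
    using assms by (simp add: poly_power)
  ultimately have "poly r \<i> \<noteq> 0" by (simp only: r_def poly_diff diff_zero not_False_eq_True)
  then have "r \<noteq> 0" by auto
  then have fin: "finite {z. poly r z = 0}" by (rule poly_roots_finite)
  have "complex_of_real ` {t. word_matrix (letter_matrix (axis_rotation t)) w = mat 1} \<subseteq> {z. poly r z = 0}"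
  proof (clarify)
    fix t assume t: "word_matrix (letter_matrix (axis_rotation t)) w = mat 1"
    have "poly p (of_real t) = of_real ((1 + t^2) ^ length w)"
      unfolding p[symmetric] complex_word_of_real t by (simp add: mat_def)
    then show "poly r (of_real t) = 0"
      by (simp add: r_def poly_power power2_eq_square)
  qed
  then have "finite (complex_of_real ` {t. word_matrix (letter_matrix (axis_rotation t)) w = mat 1})"
    using fin finite_subset by blast
  then show ?thesis by (rule finite_imageD) (simp add: inj_on_def)
qed

text \<open>Countably many words each exclude finitely many parameters, so one \<open>t\<close>
  serves all generators, which differ only in their axes.\<close>

lemma free_rotations:
  obtains g :: "nat \<Rightarrow> real^3^3" where "\<And>k. rotation_matrix (g k)"
    "\<And>w. reduced w \<Longrightarrow> w \<noteq> [] \<Longrightarrow> word_matrix (letter_matrix g) w \<noteq> mat 1"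
proof -
  have "countable (\<Union>w\<in>{w. reduced w \<and> w \<noteq> []}. {t. word_matrix (letter_matrix (axis_rotation t)) w = mat 1})"
    using finite_bad_parameters by (intro countable_UN) (auto intro: countable_finite)
  then have "(\<Union>w\<in>{w. reduced w \<and> w \<noteq> []}. {t. word_matrix (letter_matrix (axis_rotation t)) w = mat 1}) \<noteq> UNIV"
    using uncountable_UNIV_real by auto
  then obtain t where "\<And>w. reduced w \<Longrightarrow> w \<noteq> [] \<Longrightarrow> word_matrix (letter_matrix (axis_rotation t)) w \<noteq> mat 1"
    by blast
  moreover have "rotation_matrix (axis_rotation t k)" for k
    unfolding axis_rotation_def by (rule rotation_half_tan_matrix) simp
  ultimately show thesis using that by blast
qed

section \<open>Category on the sphere\<close>

lemma nowhere_dense_in_mono: "nowhere_dense_in T N \<Longrightarrow> M \<subseteq> N \<Longrightarrow> nowhere_dense_in T M"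
  unfolding nowhere_dense_in_def
  by (metis closure_of_mono interior_of_mono order_trans subset_empty)

lemma nowhere_dense_in_closedin:
  "closedin T N \<Longrightarrow> T interior_of N = {} \<Longrightarrow> nowhere_dense_in T N"
  unfolding nowhere_dense_in_def by (simp add: closedin_subset closure_of_closedin)

lemma nowhere_dense_in_empty: "nowhere_dense_in T {}"
  by (simp add: nowhere_dense_in_def)

lemma meager_in_mono:
  assumes "meager_in T M" "N \<subseteq> M"
  shows "meager_in T N"
proof -
  obtain A :: "nat \<Rightarrow> 'a set" where A: "\<And>i. nowhere_dense_in T (A i)" "M = (\<Union>i. A i)"
    using assms unfolding meager_in_def by blast
  have "nowhere_dense_in T (A i \<inter> N)" for i
    using A nowhere_dense_in_mono by blast
  moreover have "N = (\<Union>i. A i \<inter> N)" using A assms by auto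
  ultimately show ?thesis unfolding meager_in_def by (intro exI[of _ "\<lambda>i. A i \<inter> N"]) simp
qed

lemma nowhere_dense_imp_meager: "nowhere_dense_in T N \<Longrightarrow> meager_in T N"
  unfolding meager_in_def by (rule exI[of _ "\<lambda>_. N"]) auto

lemma meager_in_UN:
  assumes "\<And>i::nat. meager_in T (M i)"
  shows "meager_in T (\<Union>i. M i)"
proof -
  have "\<forall>i. \<exists>A :: nat \<Rightarrow> 'a set. (\<forall>j. nowhere_dense_in T (A j)) \<and> M i = (\<Union>j. A j)"
    using assms unfolding meager_in_def by blast
  then obtain A :: "nat \<Rightarrow> nat \<Rightarrow> 'a set"
    where A: "\<And>i j. nowhere_dense_in T (A i j)" "\<And>i. M i = (\<Union>j. A i j)" by metis
  have "(\<Union>i. M i) = (\<Union>k. A (fst (prod_decode k)) (snd (prod_decode k)))"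
  proof (intro equalityI subsetI)
    fix x assume "x \<in> (\<Union>i. M i)"
    then obtain i j where "x \<in> A i j" using A by auto
    then show "x \<in> (\<Union>k. A (fst (prod_decode k)) (snd (prod_decode k)))"
      by (intro UN_I[of "prod_encode (i, j)"]) auto
  qed (use A in auto)
  then show ?thesis
    unfolding meager_in_def using A(1)
    by (intro exI[of _ "\<lambda>k. A (fst (prod_decode k)) (snd (prod_decode k))"]) simp
qed

lemma meager_in_countable_UN:
  assumes "countable I" "\<And>i. i \<in> I \<Longrightarrow> meager_in T (M i)"
  shows "meager_in T (\<Union>i\<in>I. M i)"
proof (cases "I = {}")
  case True
  then show ?thesis using nowhere_dense_imp_meager[OF nowhere_dense_in_empty] by simp
next
  case False
  then have "(\<Union>i\<in>I. M i) = (\<Union>k. M (from_nat_into I k))"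
    using assms(1) by (metis range_from_nat_into image_image)
  then show ?thesis
    using meager_in_UN[of T "\<lambda>k. M (from_nat_into I k)"] assms(2) False from_nat_into by metis
qed

lemma meager_in_Un:
  assumes "meager_in T M" "meager_in T N"
  shows "meager_in T (M \<union> N)"
proof -
  have "meager_in T (\<Union>b\<in>UNIV. if b then M else N)"
    using assms by (intro meager_in_countable_UN) auto
  then show ?thesis by (simp add: UNIV_bool Un_commute)
qed

lemma meager_in_homeomorphic_image:
  assumes "homeomorphic_map T T f" "meager_in T M"
  shows "meager_in T (f ` M)"
proof -
  obtain A :: "nat \<Rightarrow> 'a set" where A: "\<And>i. nowhere_dense_in T (A i)" "M = (\<Union>i. A i)"
    using assms unfolding meager_in_def by blast
  have "nowhere_dense_in T (f ` A i)" for i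
  proof -
    have s: "A i \<subseteq> topspace T" using A by (simp add: nowhere_dense_in_def)
    have "T interior_of (T closure_of f ` A i) = f ` (T interior_of (T closure_of A i))"
      using homeomorphic_map_closure_of[OF assms(1) s]
        homeomorphic_map_interior_of[OF assms(1) closure_of_subset_topspace] by metis
    moreover have "f ` A i \<subseteq> topspace T"
      using s homeomorphic_imp_surjective_map[OF assms(1)] by blast
    ultimately show ?thesis using A by (simp add: nowhere_dense_in_def)
  qed
  then show ?thesis unfolding meager_in_def A(2)
    by (intro exI[of _ "\<lambda>i. f ` A i"]) auto
qed

lemma Baire_open_not_meager:
  fixes S :: "'a::{real_normed_vector,heine_borel} set"
  assumes S: "closed S" and M: "meager_in (top_of_set S) M"
    and W: "openin (top_of_set S) W" "W \<noteq> {}"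
  shows "\<not> W \<subseteq> M"
proof
  assume WM: "W \<subseteq> M"
  let ?T = "top_of_set S"
  obtain A :: "nat \<Rightarrow> 'a set" where A: "\<And>i. nowhere_dense_in ?T (A i)" "M = (\<Union>i. A i)"
    using M unfolding meager_in_def by blast
  define G where "G i = S - ?T closure_of (A i)" for i
  have "S \<subseteq> closure (\<Inter>(range G))"
  proof (rule Baire[OF S])
    fix X assume "X \<in> range G"
    then obtain i where i: "X = G i" by auto
    have "openin ?T (G i)"
      unfolding G_def by (intro openin_diff) auto
    moreover have "S \<subseteq> closure (G i)"
    proof
      fix x assume x: "x \<in> S"
      show "x \<in> closure (G i)"
        unfolding closure_iff_nhds_not_empty
      proof (intro allI impI notI)
        fix B V assume B: "V \<subseteq> B" "open V" "x \<in> V" "G i \<inter> B = {}"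
        then have "S \<inter> V \<subseteq> ?T closure_of (A i)" by (auto simp: G_def)
        then have "S \<inter> V \<subseteq> ?T interior_of (?T closure_of (A i))"
          using B by (intro interior_of_maximal) (auto simp: openin_open)
        then show False using A(1)[of i] B x by (auto simp: nowhere_dense_in_def)
      qed
    qed
    ultimately show "openin ?T X \<and> S \<subseteq> closure X" using i by simp
  qed auto
  moreover obtain V where V: "open V" "W = S \<inter> V" using W(1) by (auto simp: openin_open)
  moreover obtain x where "x \<in> S" "x \<in> V" using V W(2) by auto
  ultimately obtain y where y: "y \<in> V" "y \<in> \<Inter>(range G)"
    by (metis (no_types, lifting) closure_iff_nhds_not_empty disjoint_iff order_refl subsetD)
  have "y \<in> S" using y by (auto simp: G_def)
  then have "y \<in> M" using WM V y by auto
  then obtain i where i: "y \<in> A i" using A by auto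
  have "A i \<subseteq> topspace ?T" using A(1)[of i] by (simp add: nowhere_dense_in_def)
  then have "A i \<subseteq> ?T closure_of (A i)" by (rule closure_of_subset)
  then show False using y i by (auto simp: G_def)
qed

lemma S2_open_meets_comeager:
  assumes "meager_in (top_of_set S2) (S2 - G)" "openin (top_of_set S2) W" "W \<noteq> {}"
  obtains x where "x \<in> W" "x \<in> G"
proof -
  have "\<not> W \<subseteq> S2 - G" by (rule Baire_open_not_meager[OF _ assms]) simp
  moreover have "W \<subseteq> S2" using openin_subset[OF assms(2)] by simp
  ultimately show thesis using that by blast
qed

lemma rotation_homeomorphic_map:
  assumes "rotation_matrix Q"
  shows "homeomorphic_map (top_of_set S2) (top_of_set S2) ((*v) Q)"
proof (rule homeomorphic_maps_imp_map)
  have c: "continuous_map (top_of_set S2) (top_of_set S2) ((*v) R)" if "rotation_matrix R" for R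
    using that rotation_matrix_norm[OF that]
    by (auto simp: continuous_map_in_subtopology intro: linear_continuous_on)
  show "homeomorphic_maps (top_of_set S2) (top_of_set S2) ((*v) Q) ((*v) (transpose Q))"
    unfolding homeomorphic_maps_def
    using c[OF assms] c[OF rotation_matrix_transpose[OF assms]] rotation_matrix_transpose_mult[OF assms]
    by (auto simp del: transpose_matrix_vector)
qed

lemma rotation_image_S2:
  assumes "rotation_matrix Q"
  shows "(*v) Q ` S2 = S2"
  using homeomorphic_imp_surjective_map[OF rotation_homeomorphic_map[OF assms]] by simp

text \<open>If \<open>Q\<close> fixes a neighbourhood of \<open>p\<close> on the sphere, it fixes
  \<open>p + t v\<close> for small \<open>t\<close> after normalization, and linearity gives
  \<open>Q v = v\<close> for every \<open>v\<close>.\<close>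

lemma sphere_fixed_points_nowhere_dense:
  assumes "Q \<noteq> mat 1"
  shows "nowhere_dense_in (top_of_set S2) {x \<in> S2. Q *v x = x}"
proof (rule nowhere_dense_in_closedin)
  let ?N = "{x \<in> S2. Q *v x = x}"
  have "closed {x. Q *v x = x}"
    by (intro closed_Collect_eq continuous_intros linear_continuous_on matrix_vector_mul_bounded_linear)
  then show "closedin (top_of_set S2) ?N"
    using closedin_closed_Int[of "{x. Q *v x = x}" S2] unfolding Collect_conj_eq Collect_mem_eq by blast
  show "top_of_set S2 interior_of ?N = {}"
  proof (rule ccontr)
    assume "top_of_set S2 interior_of ?N \<noteq> {}"
    then obtain p where "p \<in> top_of_set S2 interior_of ?N" by auto
    moreover have "openin (top_of_set S2) (top_of_set S2 interior_of ?N)" by simp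
    ultimately obtain V where V: "open V" "p \<in> V" "p \<in> S2" "S2 \<inter> V \<subseteq> ?N"
      using interior_of_subset[of "top_of_set S2" ?N] unfolding openin_open by blast
    have fix_all: "Q *v v = v" for v
    proof -
      define f where "f t = (p + t *\<^sub>R v) /\<^sub>R norm (p + t *\<^sub>R v)" for t
      have p0: "p \<noteq> 0" using V by auto
      have "(f \<longlongrightarrow> f 0) (at 0)"
        unfolding f_def using p0 by (intro tendsto_intros) auto
      moreover have "f 0 = p" using V by (simp add: f_def)
      ultimately have "eventually (\<lambda>t. f t \<in> V) (at 0)"
        using topological_tendstoD[of f "f 0" "at 0" V] V by simp
      moreover have "((\<lambda>t. p + t *\<^sub>R v) \<longlongrightarrow> p + 0 *\<^sub>R v) (at 0)"
        by (intro tendsto_intros)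
      then have "eventually (\<lambda>t. p + t *\<^sub>R v \<noteq> 0) (at 0)"
        using p0 tendsto_imp_eventually_ne by auto
      moreover have "eventually (\<lambda>t. t \<noteq> (0::real)) (at 0)"
        by (simp add: eventually_at_filter)
      ultimately have "eventually (\<lambda>t. f t \<in> V \<and> p + t *\<^sub>R v \<noteq> 0 \<and> t \<noteq> 0) (at 0)"
        by eventually_elim simp
      then obtain t where t: "f t \<in> V" "p + t *\<^sub>R v \<noteq> 0" "t \<noteq> 0"
        using eventually_happens[of _ "at (0::real)"] by auto
      note t(1)
      moreover have "f t \<in> S2" using t(2) by (simp add: f_def)
      ultimately have "f t \<in> ?N" using V(4) by blast
      then have "Q *v (p + t *\<^sub>R v) = p + t *\<^sub>R v"
        using t(2) by (simp add: f_def matrix_vector_mult_scaleR)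
      moreover have "Q *v p = p" using V by auto
      ultimately show ?thesis
        using t(3) by (simp add: matrix_vector_right_distrib matrix_vector_mult_scaleR)
    qed
    then have "Q = mat 1" by (simp add: matrix_eq)
    then show False using assms by simp
  qed
qed

lemma Baire_measurable_nonmeager_open:
  assumes "Baire_measurable_in T B" "\<not> meager_in T B"
  obtains W where "openin T W" "W \<noteq> {}" "meager_in T (W - B)"
proof -
  obtain W where W: "openin T W" "meager_in T ((B - W) \<union> (W - B))"
    using assms(1) by (auto simp: Baire_measurable_in_def)
  moreover have "W \<noteq> {}" using W(2) assms(2) by auto
  ultimately show thesis using that meager_in_mono[OF W(2), of "W - B"] by blast
qed

lemma rotation_not_compressing:
  assumes Q: "rotation_matrix Q" and B: "B \<subseteq> S2" and sub: "(*v) Q ` B \<subseteq> B - C" and CB: "C \<subseteq> B"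
    and C: "Baire_measurable_in (top_of_set S2) C"
  shows "meager_in (top_of_set S2) C"
proof (rule ccontr)
  let ?T = "top_of_set S2"
  assume "\<not> meager_in ?T C"
  then obtain W where W: "openin ?T W" "W \<noteq> {}" "meager_in ?T (W - C)"
    using Baire_measurable_nonmeager_open C by blast
  obtain V where V: "open V" "W = S2 \<inter> V" using W(1) by (auto simp: openin_open)
  obtain x where x: "x \<in> W" using W(2) by auto
  obtain e where e: "e > 0" "ball x e \<subseteq> V" using V x open_contains_ball by blast
  obtain m where m: "m > 0" "dist (((*v) Q ^^ m) x) x < e"
    using rotation_recurrence[OF Q _ e(1)] x V by blast
  define f where "f = (*v) Q ^^ m"
  have hom: "homeomorphic_map ?T ?T (((*v) Q) ^^ k)" for k
  proof (induction k)
    case (Suc k)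
    show ?case
      unfolding funpow.simps(2) by (rule homeomorphic_map_compose[OF Suc rotation_homeomorphic_map[OF Q]])
  next
    case 0
    show ?case unfolding funpow.simps(1) by (simp only: homeomorphic_map_id)
  qed
  have inB: "((*v) Q ^^ k) ` B \<subseteq> B" for k
    using sub by (induction k) auto
  have "f ` C \<inter> C = {}"
  proof -
    obtain k where k: "m = Suc k" using m by (cases m) auto
    have "f ` C \<subseteq> (*v) Q ` (((*v) Q ^^ k) ` B)" using CB by (auto simp: f_def k)
    also have "\<dots> \<subseteq> (*v) Q ` B" using inB by blast
    finally show ?thesis using sub by blast
  qed
  \<comment> \<open>\<open>f x\<close> is within \<open>e\<close> of \<open>x\<close>, so the image
    of \<open>W\<close> meets \<open>W\<close>. Up to a meager set this open intersection would lie
    in both \<open>C\<close> and its image, which are disjoint.\<close>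
  moreover have fx: "f x \<in> f ` W \<inter> W"
  proof -
    have "f x \<in> S2"
      using homeomorphic_imp_surjective_map[OF hom[of m]] x V by (auto simp: f_def)
    moreover have "f x \<in> ball x e" using m by (simp add: f_def dist_commute)
    ultimately show ?thesis using e V x by auto
  qed
  moreover have "openin ?T (f ` W \<inter> W)"
    using homeomorphic_map_openness[OF hom[of m]] W(1) openin_subset[OF W(1)]
    by (intro openin_Int) (auto simp: f_def)
  moreover have "meager_in ?T (f ` (W - C) \<union> (W - C))"
    using meager_in_Un[OF meager_in_homeomorphic_image[OF hom[of m] W(3)] W(3)] by (simp add: f_def)
  moreover have "f ` W \<inter> W \<subseteq> f ` (W - C) \<union> (W - C) \<union> (f ` C \<inter> C)" by auto
  ultimately show False
    using Baire_open_not_meager[of S2 "f ` (W - C) \<union> (W - C)" "f ` W \<inter> W"] by auto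
qed

section \<open>Generic points\<close>

locale rotation_coloring = congruences +
  fixes g :: "nat \<Rightarrow> real^3^3"
  assumes n_ge: "n \<ge> 1"
    and rotation_g: "rotation_matrix (g k)"
    and free_g: "reduced w \<Longrightarrow> w \<noteq> [] \<Longrightarrow> word_matrix (letter_matrix g) w \<noteq> mat 1"
begin

abbreviation act :: "nat \<times> bool \<Rightarrow> real^3 \<Rightarrow> real^3" where
  "act s \<equiv> (*v) (letter_matrix g s)"

lemma rotation_letter: "rotation_matrix (letter_matrix g s)"
  by (simp add: letter_matrix_def rotation_g rotation_matrix_transpose)

sublocale lc: letter_coloring act letters n rel
proof
  show "act (linv s) (act s x) = x" for s x
    using rotation_matrix_transpose_mult[OF rotation_g[of "fst s"]]
    by (simp add: letter_matrix_def linv_def del: transpose_matrix_vector)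
qed (use linv_letters n_ge rel_linv rel_total in auto)

lemma wact_eq: "lc.wact w x = word_matrix (letter_matrix g) w *v x"
  by (induction w) (simp_all add: matrix_vector_mul_assoc)

lemma rotation_word: "rotation_matrix (word_matrix (letter_matrix g) w)"
  by (induction w) (simp_all add: rotation_matrix_one rotation_matrix_mult rotation_letter)

lemma wact_S2 [simp]: "lc.wact w x \<in> S2 \<longleftrightarrow> x \<in> S2"
  unfolding wact_eq by (rule rotation_matrix_S2[OF rotation_word])

lemma act_S2: "act s x \<in> S2 \<longleftrightarrow> x \<in> S2"
  by (rule rotation_matrix_S2[OF rotation_letter])

lemma dist_wact [simp]: "dist (lc.wact w x) (lc.wact w y) = dist x y"
  unfolding wact_eq by (rule rotation_matrix_dist[OF rotation_word])

text \<open>Stated through matrices for all words, reduced or not, so that invariance under a letter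
  is plain conjugation.\<close>

definition Gen :: "(real^3) set" where
  "Gen = {x \<in> S2. \<forall>w. word_matrix (letter_matrix g) w \<noteq> mat 1 \<longrightarrow> lc.wact w x \<noteq> x}"

lemma Gen_S2: "x \<in> Gen \<Longrightarrow> x \<in> S2"
  by (simp add: Gen_def)

lemma Gen_act:
  assumes "x \<in> Gen"
  shows "act s x \<in> Gen"
  unfolding Gen_def
proof (intro CollectI conjI allI impI)
  show "act s x \<in> S2" using assms act_S2 Gen_S2 by blast
  fix w assume w: "word_matrix (letter_matrix g) w \<noteq> mat 1"
  show "lc.wact w (act s x) \<noteq> act s x"
  proof
    assume "lc.wact w (act s x) = act s x"
    then have "lc.wact (linv s # w @ [s]) x = x" by simp
    then have "word_matrix (letter_matrix g) (linv s # w @ [s]) = mat 1"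
      using assms unfolding Gen_def by blast
    then have id: "lc.wact (linv s # w @ [s]) y = y" for y
      by (simp only: wact_eq matrix_vector_mul_lid)
    have "lc.wact w z = z" for z
    proof -
      have "act (linv s) (lc.wact w z) = act (linv s) z"
        using id[of "act (linv s) z"] by simp
      then show ?thesis by (simp only: lc.act_inj)
    qed
    then have "word_matrix (letter_matrix g) w = mat 1"
      by (simp add: matrix_eq flip: wact_eq)
    then show False using w by simp
  qed
qed

lemma Gen_wact: "x \<in> Gen \<Longrightarrow> lc.wact w x \<in> Gen"
  by (induction w) (auto intro: Gen_act)

lemma Gen_free: "x \<in> Gen \<Longrightarrow> lc.rword w \<Longrightarrow> w \<noteq> [] \<Longrightarrow> lc.wact w x \<noteq> x"
  unfolding Gen_def lc.rword_def using free_g by blast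

lemma Gen_comeager: "meager_in (top_of_set S2) (S2 - Gen)"
proof -
  have "meager_in (top_of_set S2)
     (\<Union>w\<in>{w. word_matrix (letter_matrix g) w \<noteq> mat 1}. {x \<in> S2. word_matrix (letter_matrix g) w *v x = x})"
    by (intro meager_in_countable_UN nowhere_dense_imp_meager sphere_fixed_points_nowhere_dense) auto
  then show ?thesis
    by (rule meager_in_mono) (auto simp: Gen_def wact_eq)
qed

lemma Gen_meets:
  assumes "openin (top_of_set S2) W" "W \<noteq> {}"
  obtains x where "x \<in> W" "x \<in> Gen"
  using S2_open_meets_comeager[OF Gen_comeager assms] by blast

lemma S2_openin_nonempty: "openin (top_of_set S2) S2" "S2 \<noteq> {}"
  using rotation_matrix_fixed_point[OF rotation_matrix_one] by auto

definition N :: nat where "N = 2 * card P + 2"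

lemma mix: "lc.rword w \<Longrightarrow> length w = N \<Longrightarrow> c < n \<Longrightarrow> d < n \<Longrightarrow> lc.relw w c d"
  by (rule mixing) (auto simp: lc.rword_def N_def)

lemma coded_Gen: "\<exists>C. lc.coded Gen C (\<lambda>_ _. False)"
  by (rule lc.coded_free) (use Gen_act Gen_free in blast)+

lemma irreducible_Gen: "lc.irreducible_family Gen {x. lc.valid Gen x} (2 * N)"
proof -
  obtain C where "lc.coded Gen C (\<lambda>_ _. False)" using coded_Gen by blast
  from lc.irreducible_valid[OF this mix] show ?thesis .
qed

text \<open>No letter fixes a generic point, so a single point carries no edge condition and any
  color on it extends.\<close>

lemma prescribed_color:
  assumes z: "z \<in> Gen" and "j < n"
  shows "\<exists>x. lc.valid Gen x \<and> x z = j"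
proof -
  obtain C where C: "lc.coded Gen C (\<lambda>_ _. False)" using coded_Gen by blast
  have "act s z \<noteq> z" if "s \<in> letters" for s
    using Gen_free[OF z, of "[s]"] that by simp
  then have "lc.valid {z} (\<lambda>_. j)"
    using assms by (auto simp: lc.valid_def)
  moreover have "lc.clustered (2 * N) {z}" by (simp add: lc.clustered_def)
  ultimately show ?thesis
    using lc.extend_coloring[OF C mix, where A = "{z}" and a = "\<lambda>_. j"] z by simp
qed

lemma sphere_valid_coloring: "\<exists>c. lc.valid S2 c"
proof (rule lc.locally_commutative_coloring)
  show "act s x \<in> S2" if "x \<in> S2" for s x using that act_S2 by blast
  show "\<exists>x\<in>S2. lc.wact w x \<noteq> x" if "lc.rword w" "w \<noteq> []" for w
    using Gen_meets[OF S2_openin_nonempty] Gen_free that by metis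
  show "lc.wact u (lc.wact v x) = lc.wact v (lc.wact u x)"
    if "b \<in> S2" "lc.wact u b = b" "lc.wact v b = b" for b u v x
    using rotations_about_axis_commute[OF rotation_word _ rotation_word _ that(1)] that(2,3)
    unfolding wact_eq by blast
  show "\<exists>c<n. lc.relw w c c" if "set w \<subseteq> letters" "w \<noteq> []" for w
    using closed_word that by blast
qed

definition cols :: "(nat \<Rightarrow> (real^3) set) \<Rightarrow> (real^3 \<Rightarrow> nat) set" where
  "cols W = {x. lc.valid Gen x \<and> (\<forall>j<n. \<forall>z\<in>W j \<inter> Gen. x z = j)}"

lemma compact_words: "compact {y :: (nat \<times> bool) list \<Rightarrow> nat. \<forall>w. y w < n}"
proof -
  have "compactin (product_topology (\<lambda>_::(nat \<times> bool) list. euclidean :: nat topology) UNIV)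
    (PiE UNIV (\<lambda>_. {..<n}))"
    unfolding compactin_PiE by (simp add: finite_imp_compact)
  moreover have "PiE UNIV (\<lambda>_::(nat \<times> bool) list. {..<n}) = {y. \<forall>w. y w < n}"
    by (auto simp: PiE_UNIV_domain)
  ultimately show ?thesis by (simp add: euclidean_product_topology)
qed

text \<open>A limit of colorings of nearby orbits is a coloring of the limit orbit.\<close>

lemma attained_colors_closed:
  assumes W: "\<And>j. openin (top_of_set S2) (W j)" and z: "z \<in> Gen"
    and cl: "z \<in> closure {y \<in> Gen. \<exists>x\<in>cols W. x y = j}"
  shows "\<exists>x\<in>cols W. x z = j"
proof -
  obtain \<zeta> where \<zeta>: "\<And>i. \<zeta> i \<in> {y \<in> Gen. \<exists>x\<in>cols W. x y = j}" "\<zeta> \<longlonglongrightarrow> z"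
    using cl unfolding closure_sequential by blast
  then have \<zeta>G: "\<zeta> i \<in> Gen" for i by blast
  have "\<forall>i. \<exists>x. x \<in> cols W \<and> x (\<zeta> i) = j" using \<zeta>(1) by blast
  then obtain x where x: "\<And>i. x i \<in> cols W" "\<And>i. x i (\<zeta> i) = j" by metis
  have xv: "lc.valid Gen (x i)" for i using x(1) by (simp add: cols_def)
  \<comment> \<open>Each coloring is read along words from its own base point, which puts colorings
    of different orbits into one compact product space.\<close>
  define y where "y i w = x i (lc.wact w (\<zeta> i))" for i w
  have "y i \<in> {y. \<forall>w. y w < n}" for i
    using xv Gen_wact[OF \<zeta>G] by (auto simp: y_def lc.valid_def)
  then obtain l r where l: "l \<in> {y. \<forall>w. y w < n}" "strict_mono r" "(y \<circ> r) \<longlonglongrightarrow> l"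
    using compact_imp_seq_compact[OF compact_words] unfolding seq_compact_def by metis
  have ev: "eventually (\<lambda>i. y (r i) w = l w) sequentially" for w
  proof -
    have "((\<lambda>i. (y \<circ> r) i w) \<longlonglongrightarrow> l w)"
      by (rule continuous_on_tendsto_compose[OF continuous_on_product_coordinates[of w] l(3)]) auto
    then have "eventually (\<lambda>i. (y \<circ> r) i w \<in> {l w}) sequentially"
      by (rule topological_tendstoD) (auto simp: open_discrete)
    then show ?thesis by simp
  qed
  have cod: "lc.coded (lc.orbit z) {z} (\<lambda>_ _. False)"
  proof (rule lc.codedI)
    show "act s q \<in> lc.orbit z" if "q \<in> lc.orbit z" "s \<in> letters" for q s
      using lc.wact_in_orbit[OF that(1), of "[s]"] that(2) by simp
    show "\<exists>b\<in>{z}. \<exists>w. set w \<subseteq> letters \<and> q = lc.wact w b" if "q \<in> lc.orbit z" for q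
      using that by (auto simp: lc.orbit_def)
    show False if "lc.offw {z} (\<lambda>_ _. False) b w" "w \<noteq> []" "lc.wact w b \<in> {z}" for b w
      using that Gen_free[OF z, of w] by (auto simp: lc.offw_def)
  qed auto
  have uniq: "w = w'" if "lc.rword w" "lc.rword w'" "lc.wact w z = lc.wact w' z" for w w'
    using cod that unfolding lc.coded_def lc.offw_def by blast
  \<comment> \<open>The limit replaces the coloring on the orbit of \<open>z\<close> only; elsewhere
    \<open>x 0\<close> is kept.\<close>
  define X where "X q = (if \<exists>w. lc.rword w \<and> q = lc.wact w z
    then l (THE w. lc.rword w \<and> q = lc.wact w z) else x 0 q)" for q
  have X: "X (lc.wact w z) = l w" if "lc.rword w" for w
  proof -
    have "(THE w'. lc.rword w' \<and> lc.wact w z = lc.wact w' z) = w"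
      by (rule the_equality) (use that uniq in auto)
    then show ?thesis using that by (auto simp: X_def)
  qed
  have act_in: "\<exists>w'. lc.rword w' \<and> (\<forall>q. act s (lc.wact w q) = lc.wact w' q)"
    if "lc.rword w" "s \<in> letters" for w s
    using lc.reduce_word[of "s # w"] that by (auto simp: lc.rword_def)
  have "lc.valid Gen X"
    unfolding lc.valid_def
  proof (intro conjI ballI impI)
    fix q assume q: "q \<in> Gen"
    show "X q < n"
      using l(1) xv[of 0] q by (auto simp: X_def lc.valid_def)
    fix s assume s: "s \<in> letters"
    show "rel s (X q) (X (act s q))"
    proof (cases "\<exists>w. lc.rword w \<and> q = lc.wact w z")
      case True
      then obtain w where w: "lc.rword w" "q = lc.wact w z" by blast
      obtain w' where w': "lc.rword w'" "\<And>q. act s (lc.wact w q) = lc.wact w' q"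
        using act_in[OF w(1) s] by blast
      have "eventually (\<lambda>i. y (r i) w = l w \<and> y (r i) w' = l w') sequentially"
        using ev by (intro eventually_conj)
      then obtain i where i: "y (r i) w = l w" "y (r i) w' = l w'"
        using eventually_happens[of _ sequentially] by auto
      have "rel s (x (r i) (lc.wact w (\<zeta> (r i)))) (x (r i) (act s (lc.wact w (\<zeta> (r i)))))"
        using xv[of "r i"] s Gen_wact[OF \<zeta>G] Gen_act unfolding lc.valid_def by blast
      then have "rel s (l w) (l w')" using i by (simp only: w'(2) y_def)
      then show ?thesis using X w w' by simp
    next
      case False
      have "\<not> (\<exists>w. lc.rword w \<and> act s q = lc.wact w z)"
      proof
        assume "\<exists>w. lc.rword w \<and> act s q = lc.wact w z"
        then obtain w where w: "lc.rword w" "act s q = lc.wact w z" by blast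
        obtain w' where "lc.rword w'" "\<And>q. act (linv s) (lc.wact w q) = lc.wact w' q"
          using act_in[OF w(1), of "linv s"] s linv_letters by blast
        then have "q = lc.wact w' z" using w(2) lc.act_linv by metis
        then show False using False \<open>lc.rword w'\<close> by blast
      qed
      then have "X (act s q) = x 0 (act s q)" "X q = x 0 q"
        using False unfolding X_def by (simp_all only: if_False)
      then show ?thesis using xv[of 0] q s Gen_act by (simp add: lc.valid_def)
    qed
  qed
  moreover have "X q = i" if i: "i < n" and q: "q \<in> W i \<inter> Gen" for i q
  proof (cases "\<exists>w. lc.rword w \<and> q = lc.wact w z")
    case True
    then obtain w where w: "lc.rword w" "q = lc.wact w z" by blast
    \<comment> \<open>Openness of \<open>W i\<close> is used here: if \<open>wact w z\<close> lies
      in it, so do the nearby \<open>wact w (\<zeta> k)\<close>, which already have color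
      \<open>i\<close>.\<close>
    obtain V where V: "open V" "W i = S2 \<inter> V" using W[of i] by (auto simp: openin_open)
    have "(\<lambda>k. lc.wact w (\<zeta> k)) \<longlonglongrightarrow> lc.wact w z"
      unfolding wact_eq by (rule bounded_linear.tendsto[OF matrix_vector_mul_bounded_linear \<zeta>(2)])
    then have "eventually (\<lambda>k. lc.wact w (\<zeta> k) \<in> V) sequentially"
      by (rule topological_tendstoD) (use V q w in auto)
    then have "eventually (\<lambda>k. lc.wact w (\<zeta> (r k)) \<in> V) sequentially"
      by (rule eventually_subseq[OF l(2)])
    then have "eventually (\<lambda>k. y (r k) w = l w \<and> lc.wact w (\<zeta> (r k)) \<in> V) sequentially"
      using ev by (intro eventually_conj)
    then obtain k where k: "y (r k) w = l w" "lc.wact w (\<zeta> (r k)) \<in> V"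
      using eventually_happens[of _ sequentially] by auto
    have "lc.wact w (\<zeta> (r k)) \<in> W i \<inter> Gen"
      using V k Gen_wact[OF \<zeta>G] Gen_S2 by blast
    then have "y (r k) w = i" using x(1)[of "r k"] i unfolding cols_def y_def by blast
    then show ?thesis using k X w by simp
  next
    case False
    then have "X q = x 0 q" unfolding X_def by (simp only: if_False)
    then show ?thesis using x(1)[of 0] i q unfolding cols_def by auto
  qed
  ultimately have "X \<in> cols W" unfolding cols_def by blast
  moreover have "X z = j"
  proof -
    obtain i where "y (r i) [] = l []"
      using eventually_happens[OF ev[of "[]"]] by auto
    then show ?thesis using X[of "[]"] x(2) by (simp add: y_def)
  qed
  ultimately show ?thesis by blast
qed

end

section \<open>Building the coloring in stages\<close>

text \<open>Either \<open>B\<close> lies in one of the closed sets, or removing that set leaves a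
  nonempty open set covered by the others.\<close>

lemma finite_closed_cover_interior:
  assumes "finite J" "\<And>j. j \<in> J \<Longrightarrow> closedin T (C j)" "openin T B" "B \<noteq> {}" "B \<subseteq> (\<Union>j\<in>J. C j)"
  shows "\<exists>j\<in>J. \<exists>W. openin T W \<and> W \<noteq> {} \<and> W \<subseteq> B \<inter> C j"
  using assms
proof (induction J arbitrary: B rule: finite_induct)
  case (insert j J)
  show ?case
  proof (cases "B \<subseteq> C j")
    case True
    then show ?thesis using insert.prems by (intro bexI[of _ j] exI[of _ B]) auto
  next
    case False
    have "openin T (B - C j)" using insert.prems by (intro openin_diff) auto
    moreover have "B - C j \<noteq> {}" "B - C j \<subseteq> (\<Union>j\<in>J. C j)" using False insert.prems by auto
    ultimately obtain i W where "i \<in> J" "openin T W" "W \<noteq> {}" "W \<subseteq> (B - C j) \<inter> C i"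
      using insert.IH[of "B - C j"] insert.prems(1) by blast
    then show ?thesis by (intro bexI[of _ i] exI[of _ W]) auto
  qed
qed auto

lemma finite_positive_lower_bound:
  fixes d :: "'a \<Rightarrow> real"
  assumes "finite F" "\<And>u. u \<in> F \<Longrightarrow> d u > 0"
  shows "\<exists>e>0. \<forall>u\<in>F. e \<le> d u"
  using assms
proof (induction rule: finite_induct)
  case (insert u F)
  then obtain e where "e > 0" "\<forall>v\<in>F. e \<le> d v" by auto
  then show ?case using insert.prems[of u] by (intro exI[of _ "min e (d u)"]) auto
qed (auto intro: exI[of _ 1])

text \<open>The sphere is connected and not a single point, so a nonempty open subset is infinite;
  balls around \<open>n\<close> of its points, with half a lower bound of their distances as radius,
  are disjoint.\<close>

lemma disjoint_open_subsets:
  assumes W: "openin (top_of_set S2) W" "W \<noteq> {}"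
  obtains V :: "nat \<Rightarrow> (real^3) set" where "\<And>j. openin (top_of_set S2) (V j)" "\<And>j. j < n \<Longrightarrow> V j \<noteq> {}"
    "\<And>j. V j \<subseteq> W" "\<And>i j. i < n \<Longrightarrow> j < n \<Longrightarrow> i \<noteq> j \<Longrightarrow> V i \<inter> V j = {}"
proof -
  obtain p where p: "p \<in> W" using W by auto
  then have pS: "p \<in> S2" using openin_subset[OF W(1)] by auto
  have "S2 \<noteq> {x}" for x
  proof
    assume S: "S2 = {x}"
    then have x: "x \<in> S2" by simp
    then have "- x \<in> S2" by simp
    then have "- x = x" using S by simp
    then have "2 *\<^sub>R x = 0" by (metis add.right_inverse scaleR_2)
    then show False using x by simp
  qed
  moreover have "connected S2" by (rule connected_sphere) simp
  ultimately have "p islimpt S2" using connected_imp_perfect pS by blast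
  then have "infinite W" using infinite_openin[OF W(1) p] by blast
  then obtain Y where Y: "Y \<subseteq> W" "finite Y" "card Y = n"
    using infinite_arbitrarily_large by metis
  then obtain f where f: "bij_betw f {..<n} Y"
    using ex_bij_betw_nat_finite[OF Y(2)] by (metis atLeast0LessThan)
  have "\<exists>d>0. \<forall>u\<in>{(x, y) \<in> Y \<times> Y. x \<noteq> y}. d \<le> dist (fst u) (snd u)"
    by (rule finite_positive_lower_bound) (use Y in \<open>auto intro: finite_subset[of _ "Y \<times> Y"]\<close>)
  then obtain d where d0: "d > 0" "\<forall>u\<in>{(x, y) \<in> Y \<times> Y. x \<noteq> y}. d \<le> dist (fst u) (snd u)" by blast
  have d: "d \<le> dist x y" if "x \<in> Y" "y \<in> Y" "x \<noteq> y" for x y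
    using bspec[OF d0(2), of "(x, y)"] that by simp
  define V where "V j = W \<inter> ball (f j) (d / 2)" for j
  show thesis
  proof (rule that[of V])
    show "openin (top_of_set S2) (V j)" for j
      unfolding V_def using W(1) by (rule openin_Int_open) simp
    show "V j \<noteq> {}" if "j < n" for j
    proof -
      have "f j \<in> Y" using f that by (auto simp: bij_betw_def)
      then have "f j \<in> V j" using Y d0(1) by (auto simp: V_def)
      then show ?thesis by auto
    qed
    show "V j \<subseteq> W" for j by (auto simp: V_def)
    show "V i \<inter> V j = {}" if "i < n" "j < n" "i \<noteq> j" for i j
    proof (rule ccontr)
      assume "V i \<inter> V j \<noteq> {}"
      then obtain z where "dist (f i) z < d / 2" "dist (f j) z < d / 2" by (auto simp: V_def)
      then have "dist (f i) (f j) < d"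
        using dist_triangle[of "f i" "f j" z] by (simp add: dist_commute)
      moreover have "f i \<in> Y" "f j \<in> Y" "f i \<noteq> f j"
        using f that by (auto simp: bij_betw_def inj_on_def)
      ultimately show False using d[of "f i" "f j"] by simp
    qed
  qed
qed

context rotation_coloring
begin

text \<open>Finitely many short reduced words move \<open>y\<close> by at least some
  \<open>e\<close>; as they act by isometries, none maps a point of the ball of radius
  \<open>e / 2\<close> into that ball.\<close>

lemma separated_neighbourhood:
  assumes y: "y \<in> Gen" and V: "openin (top_of_set S2) V" "y \<in> V"
  obtains W where "openin (top_of_set S2) W" "y \<in> W" "W \<subseteq> V"
    "\<And>p q. p \<in> W \<Longrightarrow> q \<in> W \<Longrightarrow> lc.near r p q \<Longrightarrow> p = q"
proof -
  define F where "F = {u. set u \<subseteq> letters \<and> length u \<le> r \<and> lc.rword u \<and> u \<noteq> []}"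
  have "finite F"
    by (rule finite_subset[OF _ finite_lists_length_le[OF finite_letters, of r]]) (auto simp: F_def)
  then have "\<exists>e>0. \<forall>u\<in>F. e \<le> dist (lc.wact u y) y"
    by (rule finite_positive_lower_bound) (use Gen_free[OF y] in \<open>auto simp: F_def\<close>)
  then obtain e where e: "e > 0" "\<And>u. u \<in> F \<Longrightarrow> e \<le> dist (lc.wact u y) y" by auto
  define W where "W = V \<inter> ball y (e / 2)"
  have "openin (top_of_set S2) W"
    unfolding W_def using V(1) by (rule openin_Int_open) simp
  moreover have "p = q" if "p \<in> W" "q \<in> W" and near: "lc.near r p q" for p q
  proof -
    obtain w where "set w \<subseteq> letters" "length w \<le> r" "q = lc.wact w p"
      using near by (auto simp: lc.near_def)
    then obtain u where u: "lc.rword u" "length u \<le> r" "q = lc.wact u p"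
      using lc.reduce_word[of w] by auto
    show ?thesis
    proof (cases "u = []")
      case False
      then have "u \<in> F" using u by (auto simp: F_def lc.rword_def)
      then have "e \<le> dist (lc.wact u y) y" by (rule e(2))
      also have "\<dots> \<le> dist (lc.wact u y) (lc.wact u p) + dist (lc.wact u p) y" by (rule dist_triangle)
      also have "\<dots> < e / 2 + e / 2"
        using that u(3) by (intro add_strict_mono) (auto simp: W_def dist_commute)
      finally show ?thesis by simp
    qed (use u in simp)
  qed
  ultimately show thesis using that[of W] V e by (auto simp: W_def)
qed

definition stage :: "(nat \<Rightarrow> (real^3) set) \<Rightarrow> nat \<Rightarrow> bool" where
  "stage W r \<longleftrightarrow> (\<forall>j. openin (top_of_set S2) (W j)) \<and> r \<ge> 1 \<and> lc.irreducible_family Gen (cols W) r"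

text \<open>The empty set is clustered, so gluing over it already yields a compatible
  coloring.\<close>

lemma stage_cols: "stage W r \<Longrightarrow> \<exists>x. x \<in> cols W"
  unfolding stage_def lc.irreducible_family_def lc.clustered_def by (metis empty_iff empty_subsetI)

text \<open>\<open>irreducible_refine\<close> with all generic points of the new sets as
  \<open>Q\<close>; disjointness makes the prescribed color well defined.\<close>

lemma stage_extend:
  assumes W: "stage W r" and V: "\<And>j. openin (top_of_set S2) (V j)"
    and disj: "\<And>i j. i < n \<Longrightarrow> j < n \<Longrightarrow> i \<noteq> j \<Longrightarrow> V i \<inter> V j = {}"
    and VO: "\<And>j. V j \<subseteq> O'" and sep: "\<And>p q. p \<in> O' \<Longrightarrow> q \<in> O' \<Longrightarrow> lc.near (2 * r) p q \<Longrightarrow> p = q"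
    and attained: "\<And>j z. j < n \<Longrightarrow> z \<in> V j \<inter> Gen \<Longrightarrow> \<exists>x\<in>cols W. x z = j"
  shows "stage (\<lambda>j. W j \<union> V j) (3 * r)"
proof -
  define Q where "Q = Gen \<inter> (\<Union>j<n. V j)"
  define h where "h z = (SOME j. j < n \<and> z \<in> V j)" for z
  have h: "h z = j" if "j < n" "z \<in> V j" for z j
    unfolding h_def by (rule some_equality) (use that disj in auto)
  have "lc.irreducible_family Gen {e \<in> cols W. \<forall>q\<in>Q. e q = h q} (3 * r)"
  proof (rule lc.irreducible_refine)
    show "lc.irreducible_family Gen (cols W) r" "r \<ge> 1" using W by (auto simp: stage_def)
    show "p = q" if "p \<in> Q" "q \<in> Q" "lc.near (2 * r) p q" for p q
      using that sep VO unfolding Q_def by blast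
    show "\<exists>e\<in>cols W. e q = h q" if "q \<in> Q" for q
      using that attained h unfolding Q_def by force
  qed (auto simp: Q_def intro: Gen_act)
  moreover have "{e \<in> cols W. \<forall>q\<in>Q. e q = h q} = cols (\<lambda>j. W j \<union> V j)"
    unfolding cols_def Q_def using h by fastforce
  ultimately show ?thesis using W V unfolding stage_def by (auto intro: openin_Un)
qed

text \<open>Before any prescription every color is attained at every generic point, so disjoint
  parts of one separated set can receive all \<open>n\<close> colors. These nonempty open sets make
  every final piece nonmeager.\<close>

lemma first_stage:
  obtains W r where "stage W r" "\<And>j. j < n \<Longrightarrow> W j \<noteq> {}"
proof -
  have "cols (\<lambda>_. {}) = {x. lc.valid Gen x}" by (auto simp: cols_def)
  then have st: "stage (\<lambda>_. {}) (2 * N)"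
    using irreducible_Gen by (simp add: stage_def N_def)
  obtain y where y: "y \<in> S2" "y \<in> Gen" using Gen_meets[OF S2_openin_nonempty] .
  obtain O' where O': "openin (top_of_set S2) O'" "y \<in> O'"
    "\<And>p q. p \<in> O' \<Longrightarrow> q \<in> O' \<Longrightarrow> lc.near (2 * (2 * N)) p q \<Longrightarrow> p = q"
    using separated_neighbourhood[OF y(2) S2_openin_nonempty(1) y(1)] by metis
  then have "O' \<noteq> {}" by auto
  then obtain V :: "nat \<Rightarrow> (real^3) set" where V: "\<And>j. openin (top_of_set S2) (V j)"
    "\<And>j. j < n \<Longrightarrow> V j \<noteq> {}" "\<And>j. V j \<subseteq> O'"
    "\<And>i j. i < n \<Longrightarrow> j < n \<Longrightarrow> i \<noteq> j \<Longrightarrow> V i \<inter> V j = {}"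
    using disjoint_open_subsets[OF O'(1)] by metis
  have "stage (\<lambda>j. {} \<union> V j) (3 * (2 * N))"
  proof (rule stage_extend[OF st V(1,4,3) O'(3)])
    show "\<exists>x\<in>cols (\<lambda>_. {}). x z = j" if "j < n" "z \<in> V j \<inter> Gen" for j z
      using prescribed_color[of z j] that by (auto simp: cols_def)
  qed
  then show thesis using that[of V] V(2) by simp
qed

lemma next_stage:
  assumes W: "stage W r" and B: "openin (top_of_set S2) B" "B \<noteq> {}"
  shows "\<exists>W' r'. stage W' r' \<and> (\<forall>j. W j \<subseteq> W' j) \<and> (\<exists>j<n. W' j \<inter> B \<noteq> {})"
proof -
  define T where "T j = {z \<in> Gen. \<exists>x\<in>cols W. x z = j}" for j
  let ?C = "\<lambda>j. S2 \<inter> closure (T j)"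
  have Wo: "\<And>j. openin (top_of_set S2) (W j)" using W by (simp add: stage_def)
  have cl: "closedin (top_of_set S2) (?C j)" for j by (simp add: closedin_closed_Int)
  \<comment> \<open>An uncovered part of \<open>B\<close> would be open and contain a generic point,
    yet every member of \<open>cols W\<close> attains some color there.\<close>
  have "B \<subseteq> (\<Union>j\<in>{..<n}. ?C j)"
  proof (rule ccontr)
    assume "\<not> ?thesis"
    then have "B - (\<Union>j\<in>{..<n}. ?C j) \<noteq> {}" by blast
    moreover have "openin (top_of_set S2) (B - (\<Union>j\<in>{..<n}. ?C j))"
      using B cl by (intro openin_diff closedin_Union) auto
    ultimately obtain z where z: "z \<in> B - (\<Union>j\<in>{..<n}. ?C j)" "z \<in> Gen" using Gen_meets by metis
    obtain x where x: "x \<in> cols W" using stage_cols[OF W] by blast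
    then have "z \<in> T (x z)" "x z < n"
      using z by (auto simp: T_def cols_def lc.valid_def)
    then show False using z closure_subset[of "T (x z)"] Gen_S2 by auto
  qed
  then have "\<exists>j\<in>{..<n}. \<exists>O1. openin (top_of_set S2) O1 \<and> O1 \<noteq> {} \<and> O1 \<subseteq> B \<inter> ?C j"
    by (intro finite_closed_cover_interior[where C = ?C] finite_lessThan cl B)
  then obtain j O1 where j: "j < n" "openin (top_of_set S2) O1" "O1 \<noteq> {}" "O1 \<subseteq> B \<inter> ?C j"
    by blast
  obtain y where y: "y \<in> O1" "y \<in> Gen" using Gen_meets j by metis
  obtain O2 where O2: "openin (top_of_set S2) O2" "y \<in> O2" "O2 \<subseteq> O1"
    "\<And>p q. p \<in> O2 \<Longrightarrow> q \<in> O2 \<Longrightarrow> lc.near (2 * r) p q \<Longrightarrow> p = q"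
    using separated_neighbourhood[OF y(2) j(2) y(1)] by metis
  define V where "V i = (if i = j then O2 else {})" for i
  have "stage (\<lambda>i. W i \<union> V i) (3 * r)"
  proof (rule stage_extend[OF W _ _ _ O2(4)])
    show "\<exists>x\<in>cols W. x z = i" if "i < n" "z \<in> V i \<inter> Gen" for i z
    proof -
      have "i = j" "z \<in> O2" "z \<in> Gen" using that by (auto simp: V_def split: if_splits)
      then show ?thesis
        using attained_colors_closed[where W = W and z = z and j = j, OF Wo] O2(3) j(4) unfolding T_def by blast
    qed
  qed (use O2(1) in \<open>auto simp: V_def\<close>)
  moreover have "y \<in> (W j \<union> V j) \<inter> B" using O2 j y by (auto simp: V_def)
  ultimately show ?thesis using j(1)
    by (intro exI[of _ "\<lambda>i. W i \<union> V i"] exI[of _ "3 * r"]) auto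
qed

lemma dense_stages:
  obtains W :: "nat \<Rightarrow> nat \<Rightarrow> (real^3) set" where
    "\<And>k j. openin (top_of_set S2) (W k j)" "\<And>k. cols (W k) \<noteq> {}" "\<And>k l j. k \<le> l \<Longrightarrow> W k j \<subseteq> W l j"
    "\<And>j. j < n \<Longrightarrow> W 0 j \<noteq> {}"
    "\<And>B. openin (top_of_set S2) B \<Longrightarrow> B \<noteq> {} \<Longrightarrow> \<exists>k. \<exists>j<n. W k j \<inter> B \<noteq> {}"
proof -
  obtain \<B> :: "nat \<Rightarrow> (real^3) set" where "inj \<B>" and \<B>: "\<And>k. open (\<B> k)"
    "\<And>S. open S \<Longrightarrow> \<exists>K. S = \<Union>{\<B> k |k. k \<in> K}"
    by (rule univ_second_countable_sequence[where 'a = "real^3"]) (rule that; assumption)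
  have "\<exists>f. \<forall>k. (case f k of (W, r) \<Rightarrow> stage W r \<and> (\<forall>j<n. W j \<noteq> {})) \<and>
    (\<forall>j. fst (f k) j \<subseteq> fst (f (Suc k)) j) \<and>
    (S2 \<inter> \<B> k \<noteq> {} \<longrightarrow> (\<exists>j<n. fst (f (Suc k)) j \<inter> (S2 \<inter> \<B> k) \<noteq> {}))"
  proof (rule dependent_nat_choice)
    obtain W r where "stage W r" "\<And>j. j < n \<Longrightarrow> W j \<noteq> {}" by (rule first_stage) blast
    then show "\<exists>f. case f of (W, r) \<Rightarrow> stage W r \<and> (\<forall>j<n. W j \<noteq> {})"
      by (intro exI[of _ "(W, r)"]) simp
  next
    fix f :: "(nat \<Rightarrow> (real^3) set) \<times> nat" and k
    assume "case f of (W, r) \<Rightarrow> stage W r \<and> (\<forall>j<n. W j \<noteq> {})"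
    then have f: "stage (fst f) (snd f)" "\<And>j. j < n \<Longrightarrow> fst f j \<noteq> {}" by (auto simp: case_prod_unfold)
    have "\<exists>W r. stage W r \<and> (\<forall>j. fst f j \<subseteq> W j) \<and> (S2 \<inter> \<B> k \<noteq> {} \<longrightarrow> (\<exists>j<n. W j \<inter> (S2 \<inter> \<B> k) \<noteq> {}))"
    proof (cases "S2 \<inter> \<B> k = {}")
      case False
      then show ?thesis using next_stage[OF f(1) _ False] \<B>(1)[of k] by (auto simp: openin_open_Int)
    qed (use f in blast)
    then obtain W r where "stage W r" "\<And>j. fst f j \<subseteq> W j"
      "S2 \<inter> \<B> k \<noteq> {} \<longrightarrow> (\<exists>j<n. W j \<inter> (S2 \<inter> \<B> k) \<noteq> {})" by blast
    then show "\<exists>f'. (case f' of (W, r) \<Rightarrow> stage W r \<and> (\<forall>j<n. W j \<noteq> {})) \<and> (\<forall>j. fst f j \<subseteq> fst f' j) \<and>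
        (S2 \<inter> \<B> k \<noteq> {} \<longrightarrow> (\<exists>j<n. fst f' j \<inter> (S2 \<inter> \<B> k) \<noteq> {}))"
      using f(2) by (intro exI[of _ "(W, r)"]) fastforce
  qed
  then obtain f where f0: "\<And>k. (case f k of (W, r) \<Rightarrow> stage W r \<and> (\<forall>j<n. W j \<noteq> {})) \<and>
    (\<forall>j. fst (f k) j \<subseteq> fst (f (Suc k)) j) \<and>
    (S2 \<inter> \<B> k \<noteq> {} \<longrightarrow> (\<exists>j<n. fst (f (Suc k)) j \<inter> (S2 \<inter> \<B> k) \<noteq> {}))"
    by blast
  have f: "stage (fst (f k)) (snd (f k))" "j < n \<Longrightarrow> fst (f k) j \<noteq> {}"
    "fst (f k) j \<subseteq> fst (f (Suc k)) j"
    "S2 \<inter> \<B> k \<noteq> {} \<Longrightarrow> \<exists>j<n. fst (f (Suc k)) j \<inter> (S2 \<inter> \<B> k) \<noteq> {}" for k j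
    using f0[of k] unfolding case_prod_unfold by blast+
  show thesis
  proof (rule that[of "\<lambda>k. fst (f k)"])
    show "openin (top_of_set S2) (fst (f k) j)" for k j using f(1)[of k] by (simp add: stage_def)
    show "cols (fst (f k)) \<noteq> {}" for k using stage_cols[OF f(1)] by blast
    show "fst (f k) j \<subseteq> fst (f l) j" if "k \<le> l" for k l j
      using that f(3) by (induction rule: dec_induct) auto
    show "\<exists>k. \<exists>j<n. fst (f k) j \<inter> B \<noteq> {}" if B: "openin (top_of_set S2) B" "B \<noteq> {}" for B
    proof -
      obtain S where S: "open S" "B = S2 \<inter> S" using B by (auto simp: openin_open)
      obtain K where K: "S = \<Union>{\<B> k |k. k \<in> K}" using \<B>(2)[OF S(1)] by blast
      obtain k where "k \<in> K" "S2 \<inter> \<B> k \<noteq> {}" using B S K by auto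
      then show ?thesis using f(4)[of k] S K by blast
    qed
  qed (use f(2) in blast)
qed

lemma generic_coloring:
  "\<exists>c. lc.valid S2 c \<and> (\<forall>j<n. Baire_measurable_in (top_of_set S2) {x \<in> S2. c x = j} \<and>
     \<not> meager_in (top_of_set S2) {x \<in> S2. c x = j})"
proof -
  let ?T = "top_of_set S2"
  obtain W :: "nat \<Rightarrow> nat \<Rightarrow> (real^3) set" where W: "\<And>k j. openin ?T (W k j)" "\<And>k. cols (W k) \<noteq> {}"
    "\<And>k l j. k \<le> l \<Longrightarrow> W k j \<subseteq> W l j" "\<And>j. j < n \<Longrightarrow> W 0 j \<noteq> {}"
    "\<And>B. openin ?T B \<Longrightarrow> B \<noteq> {} \<Longrightarrow> \<exists>k. \<exists>j<n. W k j \<inter> B \<noteq> {}"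
    by (rule dense_stages) blast
  define Z where "Z j = (\<Union>k. W k j)" for j
  define D where "D = (\<Union>j<n. Z j)"
  \<comment> \<open>Asking for the whole orbit in \<open>D\<close> makes \<open>G\<close> invariant,
    so no edge joins it to the leftover orbits colored by \<open>c1\<close>.\<close>
  define G where "G = {z \<in> Gen. \<forall>w. lc.wact w z \<in> D}"
  have Zo: "openin ?T (Z j)" for j unfolding Z_def using W(1) by auto
  have Do: "openin ?T D" unfolding D_def using Zo by auto
  have ZS: "Z j \<subseteq> S2" for j using openin_subset[OF Zo] by simp
  \<comment> \<open>The stages increase, so both points are prescribed at the later of their two
    stages, and any coloring compatible with it serves.\<close>
  have two: "\<exists>x. lc.valid Gen x \<and> x z = i \<and> x z' = i'"
    if z: "z \<in> Gen" "z' \<in> Gen" "i < n" "i' < n" "z \<in> Z i" "z' \<in> Z i'" for z z' i i'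
  proof -
    obtain k k' where "z \<in> W k i" "z' \<in> W k' i'" using z by (auto simp: Z_def)
    then have m: "z \<in> W (max k k') i" "z' \<in> W (max k k') i'"
      using W(3)[of k "max k k'"] W(3)[of k' "max k k'"] by auto
    obtain x where "x \<in> cols (W (max k k'))" using W(2) by blast
    then show ?thesis using m z by (intro exI[of _ x]) (auto simp: cols_def)
  qed
  have nd: "nowhere_dense_in ?T (S2 - D)"
  proof (rule nowhere_dense_in_closedin)
    show "closedin ?T (S2 - D)" using Do by (intro closedin_diff) auto
    show "?T interior_of (S2 - D) = {}"
    proof (rule ccontr)
      assume "?T interior_of (S2 - D) \<noteq> {}"
      then have "\<exists>k. \<exists>j<n. W k j \<inter> ?T interior_of (S2 - D) \<noteq> {}" by (intro W(5)) simp
      then obtain k j x where "j < n" "x \<in> W k j" "x \<in> ?T interior_of (S2 - D)" by blast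
      moreover from this have "x \<in> S2 - D" using interior_of_subset[of ?T "S2 - D"] by blast
      ultimately show False by (auto simp: D_def Z_def)
    qed
  qed
  have Gm: "meager_in ?T (S2 - G)"
  proof -
    have "meager_in ?T (\<Union>w. (*v) (word_matrix (letter_matrix g) w) ` (S2 - D))"
      by (intro meager_in_countable_UN meager_in_homeomorphic_image
          rotation_homeomorphic_map rotation_word nowhere_dense_imp_meager nd) simp
    from meager_in_Un[OF Gen_comeager this] show ?thesis
    proof (rule meager_in_mono)
      show "S2 - G \<subseteq> (S2 - Gen) \<union> (\<Union>w. (*v) (word_matrix (letter_matrix g) w) ` (S2 - D))"
      proof
        fix z assume z: "z \<in> S2 - G"
        show "z \<in> (S2 - Gen) \<union> (\<Union>w. (*v) (word_matrix (letter_matrix g) w) ` (S2 - D))"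
        proof (cases "z \<in> Gen")
          case True
          then obtain w where "lc.wact w z \<notin> D" using z by (auto simp: G_def)
          then have "lc.wact w z \<in> S2 - D" using z wact_S2[of w z] by blast
          moreover have "z = word_matrix (letter_matrix g) (winv w) *v lc.wact w z"
            by (simp flip: wact_eq)
          ultimately show ?thesis by blast
        qed (use z in blast)
      qed
    qed
  qed
  obtain c1 where c1: "lc.valid S2 c1" using sphere_valid_coloring by blast
  define c where "c z = (if z \<in> G then SOME j. j < n \<and> z \<in> Z j else c1 z)" for z
  have cG: "c z < n \<and> z \<in> Z (c z)" if "z \<in> G" for z
  proof -
    have "z \<in> D" using that by (auto simp: G_def dest: spec[of _ "[]"])
    then have "\<exists>j. j < n \<and> z \<in> Z j" by (auto simp: D_def)
    from someI_ex[OF this] show ?thesis using that by (simp add: c_def)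
  qed
  have G_Gen: "z \<in> Gen" if "z \<in> G" for z using that by (simp add: G_def)
  have GS: "G \<subseteq> S2" using G_Gen Gen_S2 by blast
  have G_act: "act s z \<in> G" if "z \<in> G" for z s
  proof -
    have "lc.wact w (act s z) \<in> D" for w
      using that unfolding G_def by (auto dest: spec[of _ "w @ [s]"])
    then show ?thesis using Gen_act[OF G_Gen[OF that]] by (simp add: G_def)
  qed
  have G_act': "z \<in> G" if "act s z \<in> G" for z s
    using G_act[OF that, of "linv s"] by simp
  \<comment> \<open>The case of equal points in \<open>two\<close>: a generic point lies in only one
    \<open>Z j\<close>.\<close>
  have cZ: "c z = j" if "z \<in> G" "j < n" "z \<in> Z j" for z j
    using two[of z z "c z" j] cG[OF that(1)] that G_Gen by auto
  have "lc.valid S2 c"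
    unfolding lc.valid_def
  proof (intro conjI ballI impI)
    fix z assume z: "z \<in> S2"
    show "c z < n"
      using cG[of z] c1 z by (cases "z \<in> G") (auto simp: c_def lc.valid_def)
    fix s assume s: "s \<in> letters"
    show "rel s (c z) (c (act s z))"
    proof (cases "z \<in> G")
      case True
      then have "act s z \<in> G" by (rule G_act)
      then obtain x where "lc.valid Gen x" "x z = c z" "x (act s z) = c (act s z)"
        using two[of z "act s z" "c z" "c (act s z)"] True cG G_Gen by blast
      then show ?thesis
        using G_Gen[OF True] G_Gen[OF \<open>act s z \<in> G\<close>] s unfolding lc.valid_def by metis
    next
      case False
      then have "act s z \<notin> G" using G_act' by blast
      then show ?thesis
        using False c1 z s act_S2 unfolding c_def lc.valid_def by simp
    qed
  qed
  moreover have "Baire_measurable_in ?T {x \<in> S2. c x = j}" if "j < n" for j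
  proof -
    have "({x \<in> S2. c x = j} - Z j) \<union> (Z j - {x \<in> S2. c x = j}) \<subseteq> S2 - G"
      using cZ[OF _ that] cG ZS[of j] by auto
    then show ?thesis
      unfolding Baire_measurable_in_def using Zo[of j] meager_in_mono[OF Gm] by auto
  qed
  moreover have "\<not> meager_in ?T {x \<in> S2. c x = j}" if "j < n" for j
  proof
    assume "meager_in ?T {x \<in> S2. c x = j}"
    then have "meager_in ?T ({x \<in> S2. c x = j} \<union> (S2 - G))" using Gm by (rule meager_in_Un)
    moreover have "Z j \<subseteq> {x \<in> S2. c x = j} \<union> (S2 - G)" using cZ[OF _ that] ZS[of j] by auto
    moreover have "Z j \<noteq> {}" using W(4)[OF that] by (auto simp: Z_def)
    ultimately show False using Baire_open_not_meager[OF _ _ Zo[of j]] by auto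
  qed
  ultimately show ?thesis by blast
qed

end

section \<open>Realizations\<close>

context rotation_coloring
begin

text \<open>Letters only link sets to their representative, so two sets are joined through
  \<open>rho U\<close>. If \<open>U\<close> belongs to the complementary class, the complements are
  joined, and the same rotation matches the sets because it is a bijection of the sphere.\<close>

lemma color_classes_congruent:
  assumes c: "lc.valid S2 c" and UV: "(U, V) \<in> E"
  shows "\<exists>Q\<in>SO3. (*v) Q ` {x \<in> S2. c x \<in> U} = {x \<in> S2. c x \<in> V}"
proof -
  define M where "M U = {x \<in> S2. c x \<in> U}" for U
  have to_rho: "\<exists>Q. rotation_matrix Q \<and> (*v) Q ` M (rho U) = M U" if U: "(U, rho U) \<in> E" for U
  proof (cases "U = rho U")
    case True
    then show ?thesis using rotation_matrix_one by (intro exI[of _ "mat 1"]) (simp flip: True)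
  next
    case False
    define s where "s = (set_encode U, True)"
    have "finite U" using E_P(1)[OF U] by (auto simp: proper_subsets_def intro: finite_subset)
    then have dec: "set_decode (set_encode U) = U" by simp
    then have s: "s \<in> letters" "dm s = rho U" "rn s = U"
      using U False E_P(1)[OF U] by (simp_all add: letters_def gens_def s_def dm_def rn_def)
    have iff: "c x \<in> rho U \<longleftrightarrow> c (act s x) \<in> U" if "x \<in> S2" for x
      using c that s act_S2 unfolding lc.valid_def rel_def by blast
    have "(*v) (letter_matrix g s) ` M (rho U) = M U"
    proof (intro equalityI subsetI)
      fix y assume "y \<in> M U"
      then have y: "y \<in> S2" "c y \<in> U" by (auto simp: M_def)
      have "act (linv s) y \<in> S2" using y act_S2 by blast
      moreover from this have "c (act (linv s) y) \<in> rho U" using iff y by simp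
      ultimately have "act (linv s) y \<in> M (rho U)" by (simp add: M_def)
      moreover have "y = act s (act (linv s) y)" by simp
      ultimately show "y \<in> (*v) (letter_matrix g s) ` M (rho U)" by blast
    next
      fix y assume "y \<in> (*v) (letter_matrix g s) ` M (rho U)"
      then obtain x where x: "x \<in> S2" "c x \<in> rho U" "y = act s x" by (auto simp: M_def)
      then show "y \<in> M U" using iff[OF x(1)] act_S2[of s x] by (simp add: M_def)
    qed
    then show ?thesis using rotation_letter by blast
  qed
  have via_rho: "\<exists>Q. rotation_matrix Q \<and> (*v) Q ` M U = M V"
    if U: "(U, rho U) \<in> E" and UV: "(U, V) \<in> E" for U V
  proof -
    have r: "rho V = rho U" using rho_cong[OF UV] by simp
    have "(V, rho V) \<in> E" using E_trans[OF E_sym[OF UV] U] r by simp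
    then obtain R where R: "rotation_matrix R" "(*v) R ` M (rho U) = M V" using to_rho[of V] r by auto
    obtain Q where Q: "rotation_matrix Q" "(*v) Q ` M (rho U) = M U" using to_rho[OF U] by auto
    have "(*v) (R ** transpose Q) ` M U = (*v) R ` ((*v) (transpose Q) ` ((*v) Q ` M (rho U)))"
      by (simp add: Q(2) image_image matrix_vector_mul_assoc del: transpose_matrix_vector)
    also have "(*v) (transpose Q) ` ((*v) Q ` M (rho U)) = M (rho U)"
      by (simp add: image_image rotation_matrix_transpose_mult[OF Q(1)] del: transpose_matrix_vector)
    finally show ?thesis
      using R rotation_matrix_mult[OF R(1) rotation_matrix_transpose[OF Q(1)]] by auto
  qed
  have UP: "U \<in> P" "V \<in> P" using E_P UV by blast+
  have "\<exists>Q. rotation_matrix Q \<and> (*v) Q ` M U = M V"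
  proof (cases "(U, rho U) \<in> E")
    case True
    then show ?thesis using via_rho UV by blast
  next
    case False
    then have "(co U, rho (co U)) \<in> E" using rho_cases[OF UP(1)] rho_co[OF UP(1)] by simp
    then obtain Q where Q: "rotation_matrix Q" "(*v) Q ` M (co U) = M (co V)"
      using via_rho E_co[OF UV] by blast
    have M_co: "M (co U) = S2 - M U" for U
      using c by (auto simp: M_def lc.valid_def)
    have MS: "M U \<subseteq> S2" for U by (auto simp: M_def)
    have "inj ((*v) Q)"
      by (rule inj_on_inverseI[where g = "(*v) (transpose Q)"]) (rule rotation_matrix_transpose_mult(1)[OF Q(1)])
    then have "S2 - (*v) Q ` M U = S2 - M V"
      using Q(2) by (simp only: M_co image_set_diff rotation_image_S2[OF Q(1)])
    moreover have "(*v) Q ` M U \<subseteq> S2"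
      using image_mono[OF MS[of U], of "(*v) Q"] rotation_image_S2[OF Q(1)] by simp
    ultimately have "(*v) Q ` M U = M V" using MS[of V] by blast
    then show ?thesis using Q(1) by blast
  qed
  then show ?thesis unfolding M_def SO3_def by blast
qed

lemma realization_exists:
  "\<exists>A. realization SO3 (\<lambda>Q x. Q *v x) S2 n E A \<and>
     (\<forall>i<n. Baire_measurable_in (top_of_set S2) (A i) \<and> \<not> meager_in (top_of_set S2) (A i))"
proof -
  obtain c where c: "lc.valid S2 c" "\<And>j. j < n \<Longrightarrow> Baire_measurable_in (top_of_set S2) {x \<in> S2. c x = j}"
    "\<And>j. j < n \<Longrightarrow> \<not> meager_in (top_of_set S2) {x \<in> S2. c x = j}"
    using generic_coloring by blast
  define A where "A j = {x \<in> S2. c x = j}" for j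
  have ne: "A j \<noteq> {}" if "j < n" for j
    using c(3)[OF that] nowhere_dense_imp_meager[OF nowhere_dense_in_empty] unfolding A_def by metis
  have inj: "inj_on A {..<n}"
  proof (rule inj_onI)
    fix i j assume ij: "i \<in> {..<n}" "j \<in> {..<n}" "A i = A j"
    then obtain x where "x \<in> A i" "x \<in> A j" using ne by auto
    then show "i = j" by (simp add: A_def)
  qed
  have "partition_on S2 (A ` {..<n})"
  proof (rule partition_onI)
    show "\<Union> (A ` {..<n}) = S2"
      using c(1) by (auto simp: A_def lc.valid_def)
    show "{} \<notin> A ` {..<n}" using ne by auto
    show "disjnt p q" if "p \<in> A ` {..<n}" "q \<in> A ` {..<n}" "p \<noteq> q" for p q
      using that by (auto simp: A_def disjnt_def)
  qed
  moreover have "congruent_under SO3 (\<lambda>Q x. Q *v x) (\<Union>i\<in>U. A i) (\<Union>i\<in>V. A i)" if "(U, V) \<in> E" for U V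
  proof -
    have "(\<Union>i\<in>U. A i) = {x \<in> S2. c x \<in> U}" for U by (auto simp: A_def)
    then show ?thesis
      using color_classes_congruent[OF c(1) that] by (simp add: congruent_under_def)
  qed
  ultimately have "realization SO3 (\<lambda>Q x. Q *v x) S2 n E A"
    using inj by (simp add: realization_def)
  then show ?thesis using c(2,3) by (intro exI[of _ A]) (simp add: A_def)
qed

end

lemma realization_disjoint:
  assumes "realization \<Gamma> act X n E A" "i < n" "j < n" "x \<in> A i" "x \<in> A j"
  shows "i = j"
proof (rule ccontr)
  assume "i \<noteq> j"
  then have "A i \<noteq> A j" using assms by (auto simp: realization_def inj_on_def)
  then have "disjnt (A i) (A j)"
    using assms by (auto simp: realization_def partition_on_def disjoint_def disjnt_def)
  then show False using assms by (auto simp: disjnt_def)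
qed

lemma realization_mem_UN:
  assumes A: "realization \<Gamma> act X n E A" and i: "i < n" "x \<in> A i" and U: "U \<subseteq> {..<n}"
  shows "x \<in> (\<Union>i\<in>U. A i) \<longleftrightarrow> i \<in> U"
proof
  assume "x \<in> (\<Union>i\<in>U. A i)"
  then obtain j where j: "j \<in> U" "x \<in> A j" by blast
  then have "j < n" using U by blast
  then have "i = j" using realization_disjoint[OF A i(1) _ i(2) j(2)] by blast
  then show "i \<in> U" using j(1) by simp
qed (use i in blast)

lemma realization_rotation:
  assumes "realization SO3 (\<lambda>Q x. Q *v x) S2 n E A" "(U, V) \<in> E"
  obtains Q where "rotation_matrix Q" "(*v) Q ` (\<Union>i\<in>U. A i) = (\<Union>i\<in>V. A i)"
  using assms unfolding realization_def congruent_under_def SO3_def by blast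

lemma realization_imp_non_complementing:
  assumes A: "realization SO3 (\<lambda>Q x. Q *v x) S2 n E A"
  shows "non_complementing n E"
  unfolding non_complementing_def
proof
  assume "\<exists>U\<in>proper_subsets {..<n}. (U, {..<n} - U) \<in> E"
  then obtain U where U: "U \<subseteq> {..<n}" "(U, {..<n} - U) \<in> E" by (auto simp: proper_subsets_def)
  obtain Q where Q: "rotation_matrix Q" "(*v) Q ` (\<Union>i\<in>U. A i) = (\<Union>i\<in>{..<n} - U. A i)"
    using realization_rotation[OF A U(2)] .
  obtain x where x: "x \<in> S2" "Q *v x = x" using rotation_matrix_fixed_point[OF Q(1)] .
  have "\<Union> (A ` {..<n}) = S2" using A unfolding realization_def partition_on_def by blast
  then obtain i where i: "i < n" "x \<in> A i" using x(1) by blast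
  have "x \<in> (\<Union>i\<in>U. A i) \<longleftrightarrow> x \<in> (\<Union>i\<in>{..<n} - U. A i)"
  proof
    assume "x \<in> (\<Union>i\<in>U. A i)"
    then have "Q *v x \<in> (\<Union>i\<in>{..<n} - U. A i)" using Q(2) by blast
    then show "x \<in> (\<Union>i\<in>{..<n} - U. A i)" using x(2) by simp
  next
    assume "x \<in> (\<Union>i\<in>{..<n} - U. A i)"
    then obtain y where y: "y \<in> (\<Union>i\<in>U. A i)" "x = Q *v y" using Q(2) by blast
    have "Q *v y = Q *v x" using x(2) y(2) by simp
    then have "y = x" using rotation_matrix_transpose_mult(1)[OF Q(1)] by metis
    then show "x \<in> (\<Union>i\<in>U. A i)" using y(1) by simp
  qed
  moreover have "x \<in> (\<Union>i\<in>U. A i) \<longleftrightarrow> i \<in> U"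
    by (rule realization_mem_UN[OF A i U(1)])
  moreover have "x \<in> (\<Union>i\<in>{..<n} - U. A i) \<longleftrightarrow> i \<in> {..<n} - U"
    by (rule realization_mem_UN[OF A i]) blast
  ultimately show False using i(1) by simp
qed

text \<open>Composing the rotations of an expanding chain moves the union over \<open>V 0\<close>
  into the union over \<open>W k\<close>, which misses the piece of any index in
  \<open>V 0 - W k\<close>.\<close>

lemma realization_imp_non_expanding:
  assumes A: "realization SO3 (\<lambda>Q x. Q *v x) S2 n E A"
    and B: "\<And>i. i < n \<Longrightarrow> Baire_measurable_in (top_of_set S2) (A i)"
      "\<And>i. i < n \<Longrightarrow> \<not> meager_in (top_of_set S2) (A i)"
  shows "non_expanding n E"
  unfolding non_expanding_def
proof
  assume "\<exists>k V W. (\<forall>i\<le>k. V i \<in> proper_subsets {..<n} \<and> W i \<in> proper_subsets {..<n} \<and> (V i, W i) \<in> E) \<and>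
      (\<forall>i<k. W i \<subseteq> V (Suc i)) \<and> W k \<subset> V 0"
  then obtain k :: nat and V W where
    *: "\<forall>i\<le>k. V i \<in> proper_subsets {..<n} \<and> W i \<in> proper_subsets {..<n} \<and> (V i, W i) \<in> E"
      "\<forall>i<k. W i \<subseteq> V (Suc i)" "W k \<subset> V 0"
    by (elim exE conjE)
  have VW: "V i \<subseteq> {..<n}" "W i \<subseteq> {..<n}" "(V i, W i) \<in> E" if "i \<le> k" for i
    using *(1) that unfolding proper_subsets_def by blast+
  define M where "M U = (\<Union>i\<in>U. A i)" for U
  have cong: "\<exists>Q. rotation_matrix Q \<and> (*v) Q ` M U = M V" if UV: "(U, V) \<in> E" for U V
  proof -
    obtain Q where "rotation_matrix Q" "(*v) Q ` (\<Union>i\<in>U. A i) = (\<Union>i\<in>V. A i)"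
      using realization_rotation[OF A UV] .
    then show ?thesis unfolding M_def by (intro exI[of _ Q] conjI)
  qed
  have "\<exists>Q. rotation_matrix Q \<and> (*v) Q ` M (V 0) \<subseteq> M (W m)" if "m \<le> k" for m
    using that
  proof (induction m)
    case 0
    obtain Q where "rotation_matrix Q" "(*v) Q ` M (V 0) = M (W 0)" using cong[OF VW(3)[OF le0]] by blast
    then show ?case by blast
  next
    case (Suc m)
    then obtain Q where Q: "rotation_matrix Q" "(*v) Q ` M (V 0) \<subseteq> M (W m)" by auto
    obtain R where R: "rotation_matrix R" "(*v) R ` M (V (Suc m)) = M (W (Suc m))"
      using cong[OF VW(3)[OF Suc.prems]] by blast
    have "M (W m) \<subseteq> M (V (Suc m))" using *(2) Suc.prems unfolding M_def by (simp add: UN_mono)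
    then have "(*v) R ` ((*v) Q ` M (V 0)) \<subseteq> M (W (Suc m))" using Q R by blast
    then have "(*v) (R ** Q) ` M (V 0) \<subseteq> M (W (Suc m))"
      by (simp add: image_image matrix_vector_mul_assoc)
    then show ?case using rotation_matrix_mult[OF R(1) Q(1)] by blast
  qed
  then obtain Q where Q: "rotation_matrix Q" "(*v) Q ` M (V 0) \<subseteq> M (W k)" by blast
  obtain j where j: "j \<in> V 0" "j \<notin> W k" using *(3) by blast
  have jn: "j < n" using j VW(1)[OF le0] by blast
  have "M (W k) \<subseteq> M (V 0) - A j"
  proof
    fix x assume "x \<in> M (W k)"
    then obtain i where i: "i \<in> W k" "x \<in> A i" by (auto simp: M_def)
    then have "i \<in> {..<n}" "i \<in> V 0" using VW(2)[OF order_refl] *(3) by blast+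
    moreover have "x \<notin> A j"
    proof
      assume "x \<in> A j"
      then have "i = j" using realization_disjoint[OF A _ jn i(2)] \<open>i \<in> {..<n}\<close> by blast
      then show False using i(1) j(2) by simp
    qed
    ultimately show "x \<in> M (V 0) - A j" using i(2) by (auto simp: M_def)
  qed
  moreover have "\<Union> (A ` {..<n}) = S2" using A unfolding realization_def partition_on_def by blast
  then have "M (V 0) \<subseteq> S2" using VW(1)[OF le0] unfolding M_def by blast
  moreover have "A j \<subseteq> M (V 0)" using j by (auto simp: M_def)
  ultimately have "meager_in (top_of_set S2) (A j)"
    using rotation_not_compressing[OF Q(1), of "M (V 0)" "A j"] Q(2) B(1)[OF jn] by blast
  then show False using B(2)[OF jn] by blast
qed

theorem theorem1p2:
  fixes n :: nat and E :: "(nat set \<times> nat set) set"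
  assumes "n \<ge> 1" and "congruence_system n E"
  shows "(\<exists>A :: nat \<Rightarrow> (real ^ 3) set.
            realization SO3 (\<lambda>Q x. Q *v x) S2 n E A \<and>
            (\<forall>i<n. Baire_measurable_in (top_of_set S2) (A i) \<and> \<not> meager_in (top_of_set S2) (A i)))
         \<longleftrightarrow> non_complementing n E \<and> non_expanding n E"
proof
  assume "non_complementing n E \<and> non_expanding n E"
  then interpret congruences n E using assms by unfold_locales auto
  obtain g :: "nat \<Rightarrow> real^3^3" where "\<And>k. rotation_matrix (g k)"
    "\<And>w. reduced w \<Longrightarrow> w \<noteq> [] \<Longrightarrow> word_matrix (letter_matrix g) w \<noteq> mat 1"
    by (rule free_rotations) (rule that; assumption)
  then interpret rotation_coloring n E g using assms by unfold_locales auto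
  show "\<exists>A :: nat \<Rightarrow> (real ^ 3) set.
            realization SO3 (\<lambda>Q x. Q *v x) S2 n E A \<and>
            (\<forall>i<n. Baire_measurable_in (top_of_set S2) (A i) \<and> \<not> meager_in (top_of_set S2) (A i))"
    by (rule realization_exists)
next
  assume "\<exists>A :: nat \<Rightarrow> (real ^ 3) set.
            realization SO3 (\<lambda>Q x. Q *v x) S2 n E A \<and>
            (\<forall>i<n. Baire_measurable_in (top_of_set S2) (A i) \<and> \<not> meager_in (top_of_set S2) (A i))"
  then obtain A :: "nat \<Rightarrow> (real ^ 3) set" where
    A: "realization SO3 (\<lambda>Q x. Q *v x) S2 n E A"
      "\<forall>i<n. Baire_measurable_in (top_of_set S2) (A i) \<and> \<not> meager_in (top_of_set S2) (A i)"
    by (elim exE conjE)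
  show "non_complementing n E \<and> non_expanding n E"
    using realization_imp_non_complementing[OF A(1)] realization_imp_non_expanding[OF A(1)] A(2) by simp
qed

end
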